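(* Let $R$ be a triangle with side lengths $(a,b,c)$ and respective opposite angles $(\alpha,\beta,\gamma)$, where $\gamma = 2\pi/3$ and $R$ has non-commensurable angles. Suppose a triangle $ABC$ is tiled by $R$, and $ABC$ is not similar to $R$. Then $R$ has commensurable sides.
   Context: A tiling of a triangle (or polygon) $ABC$ by a triangle $R$ (the tile) is an expression of $ABC$ as a union of non-overlapping congruent copies of $R$. A triangle has commensurable angles if all its angles are rational multiples of $\pi$, and non-commensurable angles otherwise. It has commensurable sides if all pairwise ratios of its side lengths are rational. *)

theory Defs
  imports "HOL-Analysis.Analysis"
begin

text \<open>The unoriented angle at the middle point \<open>Y\<close>, with values in \<open>[0, pi]\<close>;
  it is meant for \<open>X \<noteq> Y\<close> and \<open>Z \<noteq> Y\<close>.\<close>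

definition angle :: "real^2 \<Rightarrow> real^2 \<Rightarrow> real^2 \<Rightarrow> real" where
  "angle X Y Z = arccos (((X - Y) \<bullet> (Z - Y)) / (norm (X - Y) * norm (Z - Y)))"

definition is_triangle :: "real^2 \<Rightarrow> real^2 \<Rightarrow> real^2 \<Rightarrow> bool" where
  "is_triangle X Y Z \<longleftrightarrow> \<not> collinear {X, Y, Z}"

definition triangle_region :: "real^2 \<Rightarrow> real^2 \<Rightarrow> real^2 \<Rightarrow> (real^2) set" where
  "triangle_region X Y Z = convex hull {X, Y, Z}"

definition similar :: "(real^2) set \<Rightarrow> (real^2) set \<Rightarrow> bool" where
  "similar S T \<longleftrightarrow>
     (\<exists>k>0. \<exists>f :: real^2 \<Rightarrow> real^2. (\<forall>x y. dist (f x) (f y) = k * dist x y) \<and> f ` S = T)"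

text \<open>Isometries may reverse orientation, so mirror images count as congruent.\<close>

definition congruent_sets :: "(real^2) set \<Rightarrow> (real^2) set \<Rightarrow> bool" where
  "congruent_sets S T \<longleftrightarrow>
     (\<exists>f :: real^2 \<Rightarrow> real^2. (\<forall>x y. dist (f x) (f y) = dist x y) \<and> f ` S = T)"

text \<open>Tiles may meet in arbitrary boundary pieces: a tiling need not be edge-to-edge.
  Finiteness is not demanded; for a bounded \<open>P\<close> and a tile \<open>R\<close> with nonempty interior
  it follows by comparing areas.\<close>

definition is_tiling :: "(real^2) set set \<Rightarrow> (real^2) set \<Rightarrow> (real^2) set \<Rightarrow> bool" where
  "is_tiling \<T> P R \<longleftrightarrow>
     (\<forall>T\<in>\<T>. congruent_sets R T) \<and>
     pairwise (\<lambda>S T. interior S \<inter> interior T = {}) \<T> \<and>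
     \<Union>\<T> = P"

definition tiled_by :: "(real^2) set \<Rightarrow> (real^2) set \<Rightarrow> bool" where
  "tiled_by P R \<longleftrightarrow> (\<exists>\<T>. is_tiling \<T> P R)"

definition commensurable_angles :: "real^2 \<Rightarrow> real^2 \<Rightarrow> real^2 \<Rightarrow> bool" where
  "commensurable_angles X Y Z \<longleftrightarrow>
     (\<forall>\<theta>\<in>{angle Y X Z, angle X Y Z, angle X Z Y}. \<exists>q\<in>\<rat>. \<theta> = q * pi)"

definition commensurable_sides :: "real^2 \<Rightarrow> real^2 \<Rightarrow> real^2 \<Rightarrow> bool" where
  "commensurable_sides X Y Z \<longleftrightarrow>
     (\<forall>s\<in>{dist Y Z, dist X Z, dist X Y}. \<forall>t\<in>{dist Y Z, dist X Z, dist X Y}. s / t \<in> \<rat>)"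

end

theory Submission
  imports Defs "HOL-Library.Multiset"
begin

text \<open>A function \<open>F p q\<close> of directed segments that is additive along lines has the same total over the
  positively oriented tile edges as over the edges of the big triangle: inner edges cancel. Two choices
  of \<open>F\<close> matter: viewing angles and twisted lengths.

  The angle under which \<open>p q\<close> is seen from a point \<open>w\<close> yields the equation of angles at \<open>w\<close>.
  As \<open>\<alpha> + \<beta> = \<pi>/3\<close> and \<open>\<alpha>/\<pi>\<close> is irrational, a vertex that is not a corner meets as many
  \<open>\<alpha>\<close> as \<open>\<beta>\<close>, and the corners together take three of each and no \<open>2\<pi>/3\<close> (otherwise the
  big triangle is similar to the tile). Since every tile has one angle of each kind, points with three
  angles \<open>2\<pi>/3\<close> (stars) outnumber the points with three \<open>\<alpha>\<close>, three \<open>\<beta>\<close> and no \<open>2\<pi>/3\<close>.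

  Suppose no side relation \<open>m a = i a + j b + k c\<close> with \<open>j + k > 0\<close> holds. If at a vertex two edges leave in the
  same direction on both sides of a line, exactly one of them of length \<open>a\<close>, then the run of \<open>a\<close>-edges
  starting there ends in the interior of an edge on the other side. Such runs start at every star, and every
  run ending at a point with one angle of each kind continues as a new run from that point; so the runs
  inject the stars into the points with three \<open>\<alpha>\<close> and three \<open>\<beta>\<close>, a contradiction. The relation for \<open>a\<close> and
  the one for \<open>b\<close> make \<open>b/a\<close> rational.

  If \<open>c/a\<close> were irrational, take \<open>F p q = \<phi> |q - p| \<chi> (q - p)\<close>, where \<open>\<chi>\<close> is a character of directions with
  \<open>\<chi>(e^(i \<alpha>)) = 1\<close>, \<open>\<chi>(e^(i \<beta>)) = -1\<close> and \<open>\<phi>\<close> is \<open>\<rat>\<close>-linear with \<open>\<phi>(c + a - b) = 0\<close>. The tiles contribute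
  nothing, so a signed perimeter of the big triangle is a rational multiple of \<open>c + a - b\<close>; similarly for
  \<open>c + b - a\<close>. By the law of sines this fails for each of the possible corner angles.\<close>

section \<open>Oriented triangles in the complex plane\<close>

text \<open>Tiles may meet in arbitrary pieces of edges and may be reflected; both facts shape the
  proof. Edges do not cancel in pairs, but at each point of each line as many edges end as start,
  once the outside counts as a cell; for a function additive along lines this is enough. Reflections
  are harmless because \<open>chi\<close> is 1 or -1 on each angle of the tile: turning left or
  right by it has the same effect. With the values chosen, the signs along the boundary of a tile
  are + for c, + for a and - for b, whence c + a - b. The character and \<open>\<phi>\<close> both
  come from prescribing values on two reals that are linearly independent over the rationals:
  \<alpha> and \<pi>/3 are so as \<alpha>/\<pi> is irrational, the two lengths by the assumption to
  be refuted. The relation for a may involve c, so it takes the one for b to eliminate c. Once b/a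
  is rational, the law of cosines makes (c/a)^2 rational; an irrational c/a is then a quadratic
  surd, and equations in it split into two rational ones.\<close>

text \<open>\<open>cr x y q > 0\<close> says that \<open>q\<close> lies to the left of the line from \<open>x\<close> to \<open>y\<close>; \<open>ded\<close> lists the edges of a
  triangle counterclockwise, whatever the order of its vertices.\<close>

definition cr :: "complex \<Rightarrow> complex \<Rightarrow> complex \<Rightarrow> real" where
  "cr x y q = Im (cnj (y - x) * (q - x))"

definition ded :: "complex \<Rightarrow> complex \<Rightarrow> complex \<Rightarrow> (complex \<times> complex) set" where
  "ded A B C = (if cr A B C > 0 then {(A, B), (B, C), (C, A)} else {(B, A), (C, B), (A, C)})"

definition tri :: "complex \<Rightarrow> complex \<Rightarrow> complex \<Rightarrow> complex set" where
  "tri A B C = {q. \<forall>(x, y)\<in>ded A B C. cr x y q \<ge> 0}"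

definition itri :: "complex \<Rightarrow> complex \<Rightarrow> complex \<Rightarrow> complex set" where
  "itri A B C = {q. \<forall>(x, y)\<in>ded A B C. cr x y q > 0}"

lemma cr_alt: "cr x y q = Re (y - x) * Im (q - x) - Im (y - x) * Re (q - x)"
  by (simp add: cr_def algebra_simps)

lemma cr_rotate: "cr y q x = cr x y q" "cr q x y = cr x y q"
  by (simp_all add: cr_alt algebra_simps)

lemma cr_swap: "cr y x q = - cr x y q" "cr x q y = - cr x y q"
  by (simp_all add: cr_alt algebra_simps)

lemma cr_same [simp]: "cr x x q = 0" "cr x y x = 0" "cr x y y = 0"
  by (simp_all add: cr_alt algebra_simps)

lemma cr_sum: "cr A B q + cr B C q + cr C A q = cr A B C"
  by (simp add: cr_alt algebra_simps)

lemma ded_swap: "cr A B C \<noteq> 0 \<Longrightarrow> ded B A C = ded A B C"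
  using cr_swap(1)[of A B C] by (auto simp: ded_def)

lemma tri_swap: "cr A B C \<noteq> 0 \<Longrightarrow> tri B A C = tri A B C" "cr A B C \<noteq> 0 \<Longrightarrow> itri B A C = itri A B C"
  by (simp_all add: tri_def itri_def ded_swap)

text \<open>Exchanging two vertices turns a clockwise triangle into a counterclockwise one and
  leaves edges, region, interior and vertex set alone. So a property of these four needs a proof for
  one orientation only.\<close>

lemma ccw_wlog:
  assumes "cr A B C \<noteq> 0"
    and "\<And>A B C. cr A B C > 0 \<Longrightarrow> P (ded A B C) (tri A B C) (itri A B C) {A, B, C}"
  shows "P (ded A B C) (tri A B C) (itri A B C) {A, B, C}"
proof (cases "cr A B C > 0")
  case False
  then have "cr B A C > 0" using assms(1) cr_swap(1)[of B A C] by linarith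
  from assms(2)[OF this] show ?thesis
    using ded_swap[OF assms(1)] tri_swap[OF assms(1)] by (simp add: insert_commute)
qed (use assms in auto)

lemma tri_ccw:
  assumes "cr A B C > 0"
  shows "tri A B C = {q. cr A B q \<ge> 0 \<and> cr B C q \<ge> 0 \<and> cr C A q \<ge> 0}"
    "itri A B C = {q. cr A B q > 0 \<and> cr B C q > 0 \<and> cr C A q > 0}"
  using assms by (auto simp: tri_def itri_def ded_def)

text \<open>\<open>cr\<close> is twice the signed area, and the coordinate of a vertex is the share
  of the subtriangle opposite to it.\<close>

lemma barycentric:
  assumes "cr A B C \<noteq> 0"
  shows "q = (cr B C q / cr A B C) *\<^sub>R A + (cr C A q / cr A B C) *\<^sub>R B + (cr A B q / cr A B C) *\<^sub>R C"
proof -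
  have "cr A B C *\<^sub>R q = cr B C q *\<^sub>R A + cr C A q *\<^sub>R B + cr A B q *\<^sub>R C"
    by (auto simp: complex_eq_iff cr_alt algebra_simps)
  then have "(1 / cr A B C) *\<^sub>R (cr A B C *\<^sub>R q) = (1 / cr A B C) *\<^sub>R (cr B C q *\<^sub>R A + cr C A q *\<^sub>R B + cr A B q *\<^sub>R C)"
    by simp
  then show ?thesis using assms by (simp add: scaleR_add_right)
qed

lemma cr_affine:
  assumes "u + v + w = 1"
  shows "cr x y (u *\<^sub>R A + v *\<^sub>R B + w *\<^sub>R C) = u * cr x y A + v * cr x y B + w * cr x y C"
proof -
  have u: "u = 1 - v - w" using assms by simp
  show ?thesis unfolding u by (simp add: cr_alt algebra_simps)
qed

lemma tri_hull:
  assumes "cr A B C \<noteq> 0"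
  shows "tri A B C = convex hull {A, B, C}"
proof -
  have "tri A B C = convex hull {A, B, C}" if "cr A B C > 0" for A B C
  proof (rule set_eqI)
    fix q
    show "q \<in> tri A B C \<longleftrightarrow> q \<in> convex hull {A, B, C}"
    proof
      assume "q \<in> tri A B C"
      then have *: "cr A B q \<ge> 0" "cr B C q \<ge> 0" "cr C A q \<ge> 0" by (auto simp: tri_ccw[OF that])
      have s: "cr B C q / cr A B C + cr C A q / cr A B C + cr A B q / cr A B C = 1"
        using that cr_sum[of A B q C] by (simp add: field_simps)
      have "q = (cr B C q / cr A B C) *\<^sub>R A + (cr C A q / cr A B C) *\<^sub>R B + (cr A B q / cr A B C) *\<^sub>R C"
        using barycentric that by simp
      then show "q \<in> convex hull {A, B, C}"
        unfolding convex_hull_3 using * that s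
        by (intro CollectI exI[of _ "cr B C q / cr A B C"] exI[of _ "cr C A q / cr A B C"] exI[of _ "cr A B q / cr A B C"]) auto
    next
      assume "q \<in> convex hull {A, B, C}"
      then obtain u v w where *: "q = u *\<^sub>R A + v *\<^sub>R B + w *\<^sub>R C" "u + v + w = 1" "u \<ge> 0" "v \<ge> 0" "w \<ge> 0"
        unfolding convex_hull_3 by auto
      show "q \<in> tri A B C"
        using * that cr_rotate[of A B C] by (auto simp: tri_ccw[OF that] cr_affine)
    qed
  qed
  then show ?thesis using ccw_wlog[OF assms, of "\<lambda>_ T _ S. T = convex hull S"] by blast
qed

lemma continuous_cr [continuous_intros]: "continuous_on S (cr x y)"
  unfolding cr_def by (intro continuous_intros)

lemma open_itri: "open (itri A B C)"
proof -
  have "open {q. cr x y q > 0}" for x y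
    by (intro open_Collect_less continuous_intros)
  moreover have "finite (ded A B C)" by (simp add: ded_def)
  moreover have "itri A B C = (\<Inter>(x, y)\<in>ded A B C. {q. cr x y q > 0})" by (auto simp: itri_def)
  ultimately show ?thesis by (auto intro!: open_INT)
qed

lemma closed_tri: "closed (tri A B C)"
proof -
  have "closed {q. cr x y q \<ge> 0}" for x y
    by (intro closed_Collect_le continuous_intros)
  moreover have "tri A B C = (\<Inter>(x, y)\<in>ded A B C. {q. cr x y q \<ge> 0})" by (auto simp: tri_def)
  ultimately show ?thesis by (auto intro!: closed_INT)
qed

lemma itri_subset: "itri A B C \<subseteq> tri A B C"
  by (auto simp: itri_def tri_def intro: less_imp_le)

text \<open>The length of the edge enters only as a positive factor, so the side of \<open>q\<close>
  is decided by the unit direction and any point \<open>p\<close> of the edge. This makes edges of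
  different cells through one point comparable.\<close>

lemma cr_oseg:
  assumes "p \<in> open_segment x y"
  shows "cr x y q = norm (y - x) * Im (cnj (sgn (y - x)) * (q - p))"
proof -
  obtain t where t: "p = (1 - t) *\<^sub>R x + t *\<^sub>R y" and "x \<noteq> y" using assms by (auto simp: in_segment)
  have "norm (y - x) * Im (cnj (sgn (y - x)) * (q - p)) = Im (cnj (norm (y - x) *\<^sub>R sgn (y - x)) * (q - p))"
    by (simp add: algebra_simps)
  also have "norm (y - x) *\<^sub>R sgn (y - x) = y - x" using \<open>x \<noteq> y\<close> by (simp add: sgn_div_norm)
  finally show ?thesis unfolding t by (simp add: cr_alt algebra_simps)
qed

lemma oseg_triI:
  assumes "cr A B C > 0" "cr A B p = 0" "cr B C p > 0" "cr C A p > 0"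
  shows "p \<in> open_segment A B"
proof -
  have AB: "A \<noteq> B" using assms(1) by auto
  have "p = (cr B C p / cr A B C) *\<^sub>R A + (cr C A p / cr A B C) *\<^sub>R B"
    using barycentric[of A B C p] assms by simp
  moreover have "cr B C p / cr A B C = 1 - cr C A p / cr A B C"
    using cr_sum[of A B p C] assms by (simp add: field_simps)
  moreover have "cr C A p / cr A B C < 1" using cr_sum[of A B p C] assms by (simp add: field_simps)
  ultimately show ?thesis using AB assms by (auto simp: in_segment intro!: exI[of _ "cr C A p / cr A B C"])
qed

lemma oseg_triD:
  assumes "cr A B C > 0" "p \<in> open_segment A B"
  shows "cr A B p = 0" "cr B C p > 0" "cr C A p > 0"
proof -
  obtain t where t: "p = (1 - t) *\<^sub>R A + t *\<^sub>R B + 0 *\<^sub>R C" "0 < t" "t < 1" using assms by (auto simp: in_segment)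
  show "cr A B p = 0" "cr B C p > 0" "cr C A p > 0"
    unfolding t(1) by (subst cr_affine; use t assms cr_rotate[of A B C] in \<open>simp\<close>)+
qed

text \<open>Seen from close to \<open>p\<close>, \<open>R\<close> is the closed and \<open>I\<close>
  the open half-plane to the left. The regions are arguments because the predicate must also serve
  the complement of the big triangle.\<close>

definition edge_nbhd :: "complex \<Rightarrow> complex \<Rightarrow> complex \<Rightarrow> complex set \<Rightarrow> complex set \<Rightarrow> bool" where
  "edge_nbhd p x y R I \<longleftrightarrow> (\<forall>\<^sub>F q in nhds p. (q \<in> R \<longleftrightarrow> Im (cnj (sgn (y - x)) * (q - p)) \<ge> 0) \<and>
     (q \<in> I \<longleftrightarrow> Im (cnj (sgn (y - x)) * (q - p)) > 0))"

text \<open>Inside an edge the inequalities of the other two edges are strict, and by continuity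
  they stay strict nearby.\<close>

lemma tri_edge_nbhd:
  assumes "cr A B C \<noteq> 0"
  shows "\<forall>(x, y)\<in>ded A B C. \<forall>p\<in>open_segment x y. edge_nbhd p x y (tri A B C) (itri A B C)"
proof -
  have 1: "edge_nbhd p A B (tri A B C) (itri A B C)" if d: "cr A B C > 0" and p: "p \<in> open_segment A B" for A B C p
  proof -
    have "\<forall>\<^sub>F q in nhds p. cr B C q > 0"
      using oseg_triD(2)[OF d p] continuous_cr[of UNIV B C] 
      by (intro order_tendstoD) (auto simp: continuous_on_def tendsto_at_iff_tendsto_nhds)
    moreover have "\<forall>\<^sub>F q in nhds p. cr C A q > 0"
      using oseg_triD(3)[OF d p] continuous_cr[of UNIV C A] 
      by (intro order_tendstoD) (auto simp: continuous_on_def tendsto_at_iff_tendsto_nhds)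
    ultimately show ?thesis unfolding edge_nbhd_def
    proof eventually_elim
      case (elim q)
      have "A \<noteq> B" using d by auto
      then show ?case using elim cr_oseg[OF p, of q]
        by (simp add: tri_ccw[OF d] zero_le_mult_iff zero_less_mult_iff)
    qed
  qed
  have 2: "\<forall>(x, y)\<in>ded A B C. \<forall>p\<in>open_segment x y. edge_nbhd p x y (tri A B C) (itri A B C)"
    if d: "cr A B C > 0" for A B C
  proof -
    have d': "cr B C A > 0" "cr C A B > 0" using d cr_rotate[of A B C] by simp_all
    have "tri B C A = tri A B C" "tri C A B = tri A B C" "itri B C A = itri A B C" "itri C A B = itri A B C"
      by (auto simp: tri_ccw[OF d] tri_ccw[OF d'(1)] tri_ccw[OF d'(2)])
    then show ?thesis using 1[OF d] 1[OF d'(1)] 1[OF d'(2)] d by (auto simp: ded_def)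
  qed
  show ?thesis
    by (rule ccw_wlog[OF assms, of "\<lambda>D T I S. \<forall>(x, y)\<in>D. \<forall>p\<in>open_segment x y. edge_nbhd p x y T I"]) (rule 2)
qed

text \<open>The number of vanishing barycentric coordinates decides: none in the interior, one on an
  open edge, two at a vertex.\<close>

lemma tri_cases:
  assumes "cr A B C \<noteq> 0"
  shows "\<forall>p\<in>tri A B C. p \<in> {A, B, C} \<or> p \<in> itri A B C \<or> (\<exists>(x, y)\<in>ded A B C. p \<in> open_segment x y)"
proof -
  have 2: "\<forall>p\<in>tri A B C. p \<in> {A, B, C} \<or> p \<in> itri A B C \<or> (\<exists>(x, y)\<in>ded A B C. p \<in> open_segment x y)"
    if d: "cr A B C > 0" for A B C
  proof
    fix p assume p: "p \<in> tri A B C"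
    have d': "cr B C A > 0" "cr C A B > 0" using d cr_rotate[of A B C] by simp_all
    have D: "ded A B C = {(A, B), (B, C), (C, A)}" using d by (simp add: ded_def)
    have nn: "cr A B p \<ge> 0" "cr B C p \<ge> 0" "cr C A p \<ge> 0" using p by (auto simp: tri_ccw[OF d])
    note bc = barycentric[of A B C p] and s = cr_sum[of A B p C]
    have v: "p = C" if "cr B C p = 0" "cr C A p = 0"
      using bc s that d by simp
    have v': "p = A" if "cr A B p = 0" "cr C A p = 0"
      using bc s that d by simp
    have v'': "p = B" if "cr A B p = 0" "cr B C p = 0"
      using bc s that d by simp
    consider "p \<in> {A, B, C}" | "p \<in> itri A B C" | "cr A B p = 0" "cr B C p > 0" "cr C A p > 0"
      | "cr B C p = 0" "cr C A p > 0" "cr A B p > 0" | "cr C A p = 0" "cr A B p > 0" "cr B C p > 0"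
      using nn v v' v'' unfolding tri_ccw(2)[OF d] by (smt (verit) insert_iff mem_Collect_eq)
    then show "p \<in> {A, B, C} \<or> p \<in> itri A B C \<or> (\<exists>(x, y)\<in>ded A B C. p \<in> open_segment x y)"
    proof cases
      case 3 then show ?thesis using oseg_triI[OF d] D by auto
    next
      case 4 then show ?thesis using oseg_triI[OF d'(1)] D by auto
    next
      case 5 then show ?thesis using oseg_triI[OF d'(2)] D by auto
    qed auto
  qed
  show ?thesis
    by (rule ccw_wlog[OF assms, of "\<lambda>D T I S. \<forall>p\<in>T. p \<in> S \<or> p \<in> I \<or> (\<exists>(x, y)\<in>D. p \<in> open_segment x y)"]) (rule 2)
qed

lemma tri_edges_disjoint:
  assumes "cr A B C \<noteq> 0"
  shows "\<forall>(x, y)\<in>ded A B C. \<forall>(x', y')\<in>ded A B C. open_segment x y \<inter> open_segment x' y' \<noteq> {} \<longrightarrow> (x, y) = (x', y')"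
proof -
  have 2: "\<forall>(x, y)\<in>ded A B C. \<forall>(x', y')\<in>ded A B C. open_segment x y \<inter> open_segment x' y' \<noteq> {} \<longrightarrow> (x, y) = (x', y')"
    if d: "cr A B C > 0" for A B C
  proof -
    have d': "cr B C A > 0" "cr C A B > 0" using d cr_rotate[of A B C] by simp_all
    have D: "ded A B C = {(A, B), (B, C), (C, A)}" using d by (simp add: ded_def)
    show ?thesis unfolding D
      using oseg_triD[OF d] oseg_triD[OF d'(1)] oseg_triD[OF d'(2)] by fastforce
  qed
  show ?thesis
    by (rule ccw_wlog[OF assms, of "\<lambda>D T I S. \<forall>(x, y)\<in>D. \<forall>(x', y')\<in>D. open_segment x y \<inter> open_segment x' y' \<noteq> {} \<longrightarrow> (x, y) = (x', y')"]) (rule 2)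
qed

section \<open>Segments, rays and lines\<close>

lemma oseg_iff:
  fixes x y :: complex
  shows "v \<in> open_segment x y \<longleftrightarrow> (\<exists>t. 0 < t \<and> t < norm (y - x) \<and> v = x + of_real t * sgn (y - x))"
proof (cases "x = y")
  case False
  define n where "n = norm (y - x)"
  have n: "n > 0" using False by (simp add: n_def)
  have s: "sgn (y - x) = (y - x) / of_real n" by (simp add: n_def sgn_eq)
  show ?thesis
  proof
    assume "v \<in> open_segment x y"
    then obtain t where t: "v = (1 - t) *\<^sub>R x + t *\<^sub>R y" "0 < t" "t < 1" by (auto simp: in_segment)
    have "v = x + of_real (t * n) * sgn (y - x)" unfolding t s using n by (simp add: scaleR_conv_of_real field_simps)
    then show "\<exists>t. 0 < t \<and> t < norm (y - x) \<and> v = x + of_real t * sgn (y - x)"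
      using t n n_def by (intro exI[of _ "t * n"]) auto
  next
    assume "\<exists>t. 0 < t \<and> t < norm (y - x) \<and> v = x + of_real t * sgn (y - x)"
    then obtain t where t: "0 < t" "t < n" "v = x + of_real t * sgn (y - x)" unfolding n_def by blast
    have "v = (1 - t / n) *\<^sub>R x + (t / n) *\<^sub>R y" unfolding t(3) s using n by (simp add: scaleR_conv_of_real field_simps)
    then show "v \<in> open_segment x y" using False t n by (auto simp: in_segment intro!: exI[of _ "t / n"])
  qed
qed auto

lemma endpoint_sgn:
  fixes x y :: complex
  shows "y = x + of_real (norm (y - x)) * sgn (y - x)"
  by (cases "x = y") (simp_all add: sgn_eq)

lemma sgn_swap: "sgn (x - y) = - sgn (y - x)" for x y :: complex
  by (metis minus_diff_eq sgn_minus)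

text \<open>The edge from \<open>x\<close> to \<open>y\<close> covers an initial piece of the ray from \<open>v\<close> in direction \<open>u\<close>.\<close>

definition cov :: "complex \<Rightarrow> complex \<Rightarrow> complex \<Rightarrow> complex \<Rightarrow> bool" where
  "cov v u x y \<longleftrightarrow> x \<noteq> y \<and> sgn (y - x) = u \<and> (x = v \<or> v \<in> open_segment x y)"

text \<open>A line as a set of points, so that edges running along it in opposite directions share
  one index when edges are grouped by lines.\<close>

definition lin :: "complex \<Rightarrow> complex \<Rightarrow> complex set" where
  "lin w u = {w + of_real t * u | t. True}"

lemma lin_uminus: "lin w (- u) = lin w u"
proof -
  have "lin w (- u) \<subseteq> lin w u" for u
  proof
    fix z assume "z \<in> lin w (- u)"
    then obtain t where "z = w + of_real t * - u" by (auto simp: lin_def)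
    then have "z = w + of_real (- t) * u" by simp
    then show "z \<in> lin w u" unfolding lin_def by blast
  qed
  from this[of u] this[of "- u"] show ?thesis by auto
qed

lemma lin_shift: "lin (w + of_real s * u) u = lin w u"
proof -
  have *: "lin (w + of_real s * u) u \<subseteq> lin w u" for w s
  proof
    fix z assume "z \<in> lin (w + of_real s * u) u"
    then obtain t where "z = w + of_real s * u + of_real t * u" by (auto simp: lin_def)
    then have "z = w + of_real (s + t) * u" by (simp add: algebra_simps)
    then show "z \<in> lin w u" unfolding lin_def by blast
  qed
  have "w = (w + of_real s * u) + of_real (- s) * u" by simp
  then have "lin w u \<subseteq> lin (w + of_real s * u) u" using *[of "w + of_real s * u" "- s"] by metis
  with *[of w s] show ?thesis by blast
qed

lemma lin_eqD:
  assumes "lin v u = lin v u'" "norm u = 1" "norm u' = 1"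
  shows "u' = u \<or> u' = - u"
proof -
  have "v + u' \<in> lin v u'" unfolding lin_def by (auto intro!: exI[of _ 1])
  then have "v + u' \<in> lin v u" using assms(1) by simp
  then obtain t where t: "u' = of_real t * u" unfolding lin_def by auto
  then have "\<bar>t\<bar> = 1" using assms by (simp add: norm_mult)
  then show ?thesis using t by (auto simp: abs_if split: if_splits)
qed

lemma cr_lin: "p \<in> lin w u \<Longrightarrow> q \<in> lin w u \<Longrightarrow> r \<in> lin w u \<Longrightarrow> cr p q r = 0"
  unfolding lin_def by (auto simp: cr_alt algebra_simps)

lemma sum_eq_fibres:
  fixes G :: "'b \<Rightarrow> 'v::real_vector"
  assumes "finite S" "\<And>z. card {e\<in>S. f e = z} = card {e\<in>S. h e = z}"
  shows "(\<Sum>e\<in>S. G (f e)) = (\<Sum>e\<in>S. G (h e))"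
proof -
  have *: "(\<Sum>e\<in>S. G (k e)) = (\<Sum>z\<in>f ` S \<union> h ` S. real (card {e\<in>S. k e = z}) *\<^sub>R G z)" if "k \<in> {f, h}" for k
  proof -
    have "(\<Sum>e\<in>S. G (k e)) = (\<Sum>z\<in>f ` S \<union> h ` S. \<Sum>e | e \<in> S \<and> k e = z. G (k e))"
      using assms(1) that by (intro sum.group[symmetric]) auto
    also have "\<dots> = (\<Sum>z\<in>f ` S \<union> h ` S. \<Sum>e | e \<in> S \<and> k e = z. G z)"
      by (intro sum.cong) auto
    finally show ?thesis by (simp only: sum_constant_scaleR)
  qed
  show ?thesis using *[of f] *[of h] assms(2) by simp
qed

lemma card_eq_subsingletons:
  assumes "A \<noteq> {} \<longleftrightarrow> B \<noteq> {}" "\<And>x y. x \<in> A \<Longrightarrow> y \<in> A \<Longrightarrow> x = y" "\<And>x y. x \<in> B \<Longrightarrow> y \<in> B \<Longrightarrow> x = y"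
  shows "card A = card B"
proof (cases "A = {}")
  case False
  then obtain x y where "A = {x}" "B = {y}" using assms by blast
  then show ?thesis by simp
qed (use assms in auto)

section \<open>Tilings and cancellation of inner edges\<close>

locale tiling =
  fixes I :: "'i set" and tA tB tC :: "'i \<Rightarrow> complex" and X Y Z :: complex
  assumes fin: "finite I"
    and nondeg: "i \<in> I \<Longrightarrow> cr (tA i) (tB i) (tC i) \<noteq> 0"
    and NONDEG: "cr X Y Z \<noteq> 0"
    and disj: "i \<in> I \<Longrightarrow> j \<in> I \<Longrightarrow> i \<noteq> j \<Longrightarrow> itri (tA i) (tB i) (tC i) \<inter> itri (tA j) (tB j) (tC j) = {}"
    and cover: "(\<Union>i\<in>I. tri (tA i) (tB i) (tC i)) = tri X Y Z"
begin

text \<open>The complement of the big triangle is treated as one more cell, indexed by \<open>None\<close>; every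
  edge is directed so that its cell lies on the left.\<close>

definition cells :: "'i option set" where
  "cells = insert None (Some ` I)"

fun ed :: "'i option \<Rightarrow> (complex \<times> complex) set" where
  "ed None = (ded X Y Z)\<inverse>"
| "ed (Some i) = ded (tA i) (tB i) (tC i)"

text \<open>Complements swap open and closed: with \<open>itri\<close> here and \<open>tri\<close>
  in \<open>ireg\<close>, \<open>reg\<close> is closed and \<open>ireg\<close> open for every
  cell.\<close>

fun reg :: "'i option \<Rightarrow> complex set" where
  "reg None = - itri X Y Z"
| "reg (Some i) = tri (tA i) (tB i) (tC i)"

fun ireg :: "'i option \<Rightarrow> complex set" where
  "ireg None = - tri X Y Z"
| "ireg (Some i) = itri (tA i) (tB i) (tC i)"

fun verts :: "'i option \<Rightarrow> complex set" where
  "verts None = {X, Y, Z}"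
| "verts (Some i) = {tA i, tB i, tC i}"

definition EE :: "('i option \<times> complex \<times> complex) set" where
  "EE = Sigma cells ed"

definition VV :: "complex set" where
  "VV = (\<Union>j\<in>cells. verts j)"

lemma finite_ded: "finite (ded A B C)"
  by (simp add: ded_def)

lemma finite_cells: "finite cells"
  by (simp add: cells_def fin)

lemma finite_ed: "finite (ed j)"
  by (cases j) (auto simp: finite_ded)

lemma finite_EE: "finite EE"
  unfolding EE_def using finite_cells finite_ed by blast

lemma finite_VV: "finite VV"
proof -
  have "finite (verts j)" for j by (cases j) auto
  then show ?thesis unfolding VV_def using finite_cells by blast
qed

lemma ed_verts: "(x, y) \<in> ed j \<Longrightarrow> x \<in> verts j \<and> y \<in> verts j"
  by (cases j) (auto simp: ded_def split: if_splits)

lemma EE_VV: "(j, x, y) \<in> EE \<Longrightarrow> x \<in> VV \<and> y \<in> VV"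
  unfolding EE_def VV_def using ed_verts by blast

lemma ed_neq: "j \<in> cells \<Longrightarrow> (x, y) \<in> ed j \<Longrightarrow> x \<noteq> y"
  using nondeg[of "the j"] NONDEG by (cases j) (auto simp: cells_def ded_def split: if_splits)

lemma EE_neq: "(j, x, y) \<in> EE \<Longrightarrow> x \<noteq> y"
  unfolding EE_def using ed_neq by blast

lemma tri_sub: "i \<in> I \<Longrightarrow> tri (tA i) (tB i) (tC i) \<subseteq> tri X Y Z"
  using cover by blast

lemma ireg_disj: "j \<in> cells \<Longrightarrow> k \<in> cells \<Longrightarrow> j \<noteq> k \<Longrightarrow> ireg j \<inter> ireg k = {}"
proof -
  assume a: "j \<in> cells" "k \<in> cells" "j \<noteq> k"
  have *: "i \<in> I \<Longrightarrow> itri (tA i) (tB i) (tC i) \<subseteq> tri X Y Z" for i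
    using tri_sub itri_subset by blast
  show ?thesis
  proof (cases j)
    case None
    then show ?thesis using a *[of "the k"] by (cases k) (auto simp: cells_def)
  next
    case (Some i)
    then show ?thesis using a *[of i] disj[of i "the k"] by (cases k) (auto simp: cells_def)
  qed
qed

lemma reg_cover: "\<exists>j\<in>cells. q \<in> reg j"
proof (cases "q \<in> tri X Y Z")
  case True
  then show ?thesis using cover by (auto simp: cells_def)
next
  case False
  then have "q \<in> reg None" using itri_subset by auto
  then show ?thesis unfolding cells_def by blast
qed

lemma ed_nbhd:
  assumes "j \<in> cells" "(x, y) \<in> ed j" "p \<in> open_segment x y"
  shows "edge_nbhd p x y (reg j) (ireg j)"
proof (cases j)
  case None
  then have "(y, x) \<in> ded X Y Z" "p \<in> open_segment y x" using assms by (auto simp: open_segment_commute)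
  then have "edge_nbhd p y x (tri X Y Z) (itri X Y Z)" using tri_edge_nbhd[OF NONDEG] by blast
  then show ?thesis unfolding edge_nbhd_def None
    by eventually_elim (auto simp: sgn_swap[of x y])
next
  case (Some i)
  then show ?thesis using assms tri_edge_nbhd[OF nondeg, of i] by (auto simp: cells_def)
qed

lemma reg_cases:
  assumes "j \<in> cells" "p \<in> reg j" "p \<notin> VV"
  shows "p \<in> ireg j \<or> (\<exists>(x, y)\<in>ed j. p \<in> open_segment x y)"
proof (cases j)
  case None
  have "p \<notin> {X, Y, Z}" using assms(3) by (auto simp: VV_def cells_def)
  then have "p \<in> tri X Y Z \<Longrightarrow> \<exists>(x, y)\<in>ded X Y Z. p \<in> open_segment x y"
    using tri_cases[OF NONDEG] assms None by auto
  then have "p \<in> tri X Y Z \<Longrightarrow> \<exists>(x, y)\<in>ed j. p \<in> open_segment x y"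
    unfolding None using open_segment_commute by (metis (no_types, lifting) case_prodE case_prodI converse.intros ed.simps(1))
  then show ?thesis using None by auto
next
  case (Some i)
  then have i: "i \<in> I" using assms by (auto simp: cells_def)
  then have "p \<notin> {tA i, tB i, tC i}" using assms(3) by (auto simp: VV_def cells_def)
  then show ?thesis using tri_cases[OF nondeg[OF i]] assms Some by auto
qed

lemma open_ireg: "open (ireg j)"
  by (cases j) (auto simp: open_itri closed_tri)

lemma closed_reg: "closed (reg j)"
  by (cases j) (auto simp: open_itri closed_tri)

lemma ed_disjoint:
  assumes "j \<in> cells" "(x, y) \<in> ed j" "(x', y') \<in> ed j" "p \<in> open_segment x y" "p \<in> open_segment x' y'"
  shows "x = x' \<and> y = y'"
proof (cases j)
  case None
  then have "(y, x) \<in> ded X Y Z" "(y', x') \<in> ded X Y Z" "p \<in> open_segment y x" "p \<in> open_segment y' x'"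
    using assms by (auto simp: open_segment_commute)
  then show ?thesis using tri_edges_disjoint[OF NONDEG] by blast
next
  case (Some i)
  then have "(x, y) \<in> ded (tA i) (tB i) (tC i)" "(x', y') \<in> ded (tA i) (tB i) (tC i)" "i \<in> I"
    using assms by (auto simp: cells_def)
  then show ?thesis using tri_edges_disjoint[OF nondeg, of i] assms(4,5) by blast
qed

text \<open>A point just to the right of the edge lies in some cell \<open>k\<close>. By closedness
  \<open>p\<close> lies in \<open>k\<close> too, but not in its interior, so it is on an edge of
  \<open>k\<close>; unless that edge runs in the opposite direction, the interiors of
  \<open>j\<close> and \<open>k\<close> overlap near \<open>p\<close>.\<close>

lemma edge_reverse:
  assumes e: "(j, x, y) \<in> EE" and p: "p \<in> open_segment x y" and pV: "p \<notin> VV"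
  shows "\<exists>(k, x', y')\<in>EE. p \<in> open_segment x' y' \<and> sgn (y' - x') = - sgn (y - x)"
proof -
  define u where "u = sgn (y - x)"
  have xy: "x \<noteq> y" using EE_neq[OF e] .
  then have nu: "norm u = 1" by (simp add: u_def norm_sgn)
  have jc: "j \<in> cells" "(x, y) \<in> ed j" using e by (auto simp: EE_def)
  define h where "h w q = Im (cnj w * (q - p))" for w q
  have "\<forall>\<^sub>F q in nhds p. \<forall>k\<in>cells. (p \<notin> reg k \<longrightarrow> q \<notin> reg k) \<and> (p \<in> ireg k \<longrightarrow> q \<in> ireg k) \<and>
     (\<forall>(x', y')\<in>ed k. p \<in> open_segment x' y' \<longrightarrow> (q \<in> reg k \<longleftrightarrow> h (sgn (y' - x')) q \<ge> 0) \<and>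
     (q \<in> ireg k \<longleftrightarrow> h (sgn (y' - x')) q > 0))"
  proof (rule eventually_ball_finite[OF finite_cells], intro ballI eventually_conj)
    fix k assume k: "k \<in> cells"
    show "\<forall>\<^sub>F q in nhds p. p \<notin> reg k \<longrightarrow> q \<notin> reg k"
      using closed_reg[of k] by (cases "p \<in> reg k") (auto simp: eventually_nhds closed_def intro!: exI[of _ "- reg k"])
    show "\<forall>\<^sub>F q in nhds p. p \<in> ireg k \<longrightarrow> q \<in> ireg k"
      using open_ireg[of k] by (cases "p \<in> ireg k") (auto simp: eventually_nhds)
    show "\<forall>\<^sub>F q in nhds p. \<forall>(x', y')\<in>ed k. p \<in> open_segment x' y' \<longrightarrow> (q \<in> reg k \<longleftrightarrow> h (sgn (y' - x')) q \<ge> 0) \<and>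
     (q \<in> ireg k \<longleftrightarrow> h (sgn (y' - x')) q > 0)"
    proof (rule eventually_ball_finite[OF finite_ed], intro ballI)
      fix z assume z: "z \<in> ed k"
      obtain x' y' where [simp]: "z = (x', y')" by force
      show "\<forall>\<^sub>F q in nhds p. case z of (x', y') \<Rightarrow> p \<in> open_segment x' y' \<longrightarrow> (q \<in> reg k \<longleftrightarrow> h (sgn (y' - x')) q \<ge> 0) \<and>
     (q \<in> ireg k \<longleftrightarrow> h (sgn (y' - x')) q > 0)"
        using ed_nbhd[OF k, of x' y' p] z by (cases "p \<in> open_segment x' y'") (auto simp: edge_nbhd_def h_def)
    qed
  qed
  \<comment> \<open>One radius serves all of the finitely many cells: closed regions missing
    \<open>p\<close> are avoided, open ones containing \<open>p\<close> are not left, and those with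
    \<open>p\<close> on an edge look like half-planes.\<close>
  then obtain d where d: "d > 0" and D0: "\<And>q. dist q p < d \<Longrightarrow> \<forall>k\<in>cells. (p \<notin> reg k \<longrightarrow> q \<notin> reg k) \<and> (p \<in> ireg k \<longrightarrow> q \<in> ireg k) \<and>
     (\<forall>(x', y')\<in>ed k. p \<in> open_segment x' y' \<longrightarrow> (q \<in> reg k \<longleftrightarrow> h (sgn (y' - x')) q \<ge> 0) \<and>
     (q \<in> ireg k \<longleftrightarrow> h (sgn (y' - x')) q > 0))"
    unfolding eventually_nhds_metric by blast
  have D1: "p \<in> reg k" if "q \<in> reg k" "dist q p < d" "k \<in> cells" for q k using D0 that by blast
  have D2: "q \<in> ireg k" if "p \<in> ireg k" "dist q p < d" "k \<in> cells" for q k using D0 that by blast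
  have D3: "(q \<in> reg k \<longleftrightarrow> h (sgn (y' - x')) q \<ge> 0) \<and> (q \<in> ireg k \<longleftrightarrow> h (sgn (y' - x')) q > 0)"
    if "dist q p < d" "k \<in> cells" "(x', y') \<in> ed k" "p \<in> open_segment x' y'" for q k x' y' using D0 that by blast
  have h_ray: "h w (p + of_real t * \<i> * z) = t * Re (cnj w * z)" for w t z
    by (simp add: h_def algebra_simps)
  have Dj: "(q \<in> reg j \<longleftrightarrow> h u q \<ge> 0) \<and> (q \<in> ireg j \<longleftrightarrow> h u q > 0)" if "dist q p < d" for q
    using D3[OF that jc p] by (simp add: u_def)
  have uu: "Re (cnj u * u) = 1" using nu by (simp add: cmod_def power2_eq_square)
  define p' where "p' = p + of_real (- d / 2) * \<i> * u"
  have dp': "dist p' p < d" using d nu by (simp add: p'_def dist_norm norm_mult)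
  have "h u p' < 0" unfolding p'_def h_ray using uu d by simp
  then have p'j: "p' \<notin> reg j" using Dj[OF dp'] by simp
  obtain k where k: "k \<in> cells" "p' \<in> reg k" using reg_cover by blast
  have pk: "p \<in> reg k" using D1[OF k(2) dp' k(1)] .
  define w where "w = p + of_real (d / 2) * \<i> * u"
  have dw: "dist w p < d" using d nu by (simp add: w_def dist_norm norm_mult)
  have "h u w > 0" unfolding w_def h_ray using uu d by simp
  then have wj: "w \<in> ireg j" using Dj[OF dw] by simp
  have "p \<notin> ireg k"
  proof
    assume "p \<in> ireg k"
    then have "w \<in> ireg k" using D2[OF _ dw k(1)] by blast
    then have "j = k" using wj ireg_disj[OF jc(1) k(1)] by blast
    then show False using p'j k by blast
  qed
  then obtain x' y' where e': "(x', y') \<in> ed k" "p \<in> open_segment x' y'" using reg_cases[OF k(1) pk pV] by blast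
  define u' where "u' = sgn (y' - x')"
  have "x' \<noteq> y'" using e' by auto
  then have nu': "norm u' = 1" by (simp add: u'_def norm_sgn)
  have uu': "Re (cnj u' * u') = 1" using nu' by (simp add: cmod_def power2_eq_square)
  have Dk: "(q \<in> reg k \<longleftrightarrow> h u' q \<ge> 0) \<and> (q \<in> ireg k \<longleftrightarrow> h u' q > 0)" if "dist q p < d" for q
    using D3[OF that k(1) e'] by (simp add: u'_def)
  have "u' = - u"
  proof (rule ccontr)
    assume ne: "u' \<noteq> - u"
    \<comment> \<open>\<open>r\<close> is the cosine of the angle between the two directions, so 1 +
      r > 0 as they are not opposite. Hence \<open>q\<close>, which is \<open>p\<close> moved along
      the sum of the two left normals, lies strictly to the left of both edges.\<close>
    define r where "r = Re (cnj u * u')"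
    have r': "Re (cnj u' * u) = r" by (simp add: r_def mult.commute)
    have r1: "1 + r > 0"
    proof -
      have "norm (u + u') > 0" using ne by (simp add: add_eq_0_iff)
      then have "0 < (norm (u + u'))\<^sup>2" by simp
      also have "\<dots> = (norm u)\<^sup>2 + (norm u')\<^sup>2 + 2 * r"
        unfolding cmod_power2 by (simp add: r_def power2_eq_square algebra_simps)
      finally show ?thesis using nu nu' by simp
    qed
    define q where "q = p + of_real (d / 4) * \<i> * (u + u')"
    have "norm (u + u') \<le> 2" using nu nu' norm_triangle_ineq[of u u'] by simp
    then have dq: "dist q p < d" using d by (simp add: q_def dist_norm norm_mult)
    have "h u q = d / 4 * (1 + r)" unfolding q_def h_ray distrib_left[of "cnj u"] using uu by (simp add: r_def)
    then have 1: "q \<in> ireg j" using Dj[OF dq] mult_pos_pos[of "d / 4" "1 + r"] r1 d by linarith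
    have "h u' q = d / 4 * (1 + r)" unfolding q_def h_ray distrib_left[of "cnj u'"] using uu' r' by simp
    then have 2: "q \<in> ireg k" using Dk[OF dq] mult_pos_pos[of "d / 4" "1 + r"] r1 d by linarith
    have "j = k" using 1 2 ireg_disj[OF jc(1) k(1)] by blast
    then show False using p'j k by blast
  qed
  then show ?thesis using e' k unfolding EE_def u'_def u_def by blast
qed

text \<open>Both cells contain the points just to the left of \<open>p\<close>, and interiors are
  disjoint; so the cell is the same, and a triangle has only one edge through
  \<open>p\<close>.\<close>

lemma edge_unique:
  assumes e: "(j, x, y) \<in> EE" "p \<in> open_segment x y" and e': "(k, x', y') \<in> EE" "p \<in> open_segment x' y'"
    and s: "sgn (y - x) = sgn (y' - x')"
  shows "(j, x, y) = (k, x', y')"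
proof -
  have jk: "j \<in> cells" "(x, y) \<in> ed j" "k \<in> cells" "(x', y') \<in> ed k" using assms by (auto simp: EE_def)
  define u where "u = sgn (y - x)"
  have nu: "norm u = 1" using EE_neq[OF e(1)] by (simp add: u_def norm_sgn)
  have "\<forall>\<^sub>F q in nhds p. (q \<in> ireg j \<longleftrightarrow> Im (cnj u * (q - p)) > 0) \<and> (q \<in> ireg k \<longleftrightarrow> Im (cnj u * (q - p)) > 0)"
    using ed_nbhd[OF jk(1,2) e(2)] ed_nbhd[OF jk(3,4) e'(2)] unfolding edge_nbhd_def u_def s
    by eventually_elim auto
  then obtain d where d: "d > 0" and D: "\<And>q. dist q p < d \<Longrightarrow> (q \<in> ireg j \<longleftrightarrow> Im (cnj u * (q - p)) > 0) \<and> (q \<in> ireg k \<longleftrightarrow> Im (cnj u * (q - p)) > 0)"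
    unfolding eventually_nhds_metric by blast
  define w where "w = p + of_real (d / 2) * \<i> * u"
  have dw: "dist w p < d" using d nu by (simp add: w_def dist_norm norm_mult)
  have uu: "cnj u * u = 1" using nu by (metis complex_norm_square mult.commute of_real_1 one_power2)
  have "cnj u * (w - p) = of_real (d / 2) * \<i> * (cnj u * u)" by (simp add: w_def)
  then have "cnj u * (w - p) = of_real (d / 2) * \<i>" using uu by simp
  then have "Im (cnj u * (w - p)) > 0" using d by (simp only:) simp
  then have "w \<in> ireg j \<inter> ireg k" using D[OF dw] by simp
  then have "j = k" using ireg_disj jk by blast
  then show ?thesis using ed_disjoint[of j x y x' y' p] jk e e' by blast
qed

section \<open>Germs of edges on the rays from a point\<close>

lemma small_step:
  obtains s where "s > 0" "\<And>w. w \<in> VV \<Longrightarrow> w \<noteq> v \<Longrightarrow> s < norm (w - v)"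
proof -
  define S where "S = insert 1 ((\<lambda>w. norm (w - v)) ` (VV - {v}))"
  have "finite S" "S \<noteq> {}" "\<forall>z\<in>S. z > 0" using finite_VV by (auto simp: S_def)
  then have M: "Min S > 0" by simp
  have "Min S / 2 < z" if "z \<in> S" for z using Min_le[OF \<open>finite S\<close> that] M by linarith
  with M show thesis using that[of "Min S / 2"] by (auto simp: S_def)
qed

text \<open>At \<open>v\<close> edges start, end and pass. A step \<open>s\<close> too short to
  reach another vertex leads to a point of the ray at which no edge starts or ends, where covering
  the ray simply means passing; there \<open>edge_reverse\<close> and \<open>edge_unique\<close>
  apply.\<close>

lemma cov_step:
  assumes "norm u = 1" "s > 0" "\<And>w. w \<in> VV \<Longrightarrow> w \<noteq> v \<Longrightarrow> s < norm (w - v)" "x \<in> VV" "y \<in> VV" "x \<noteq> y"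
  shows "cov v u x y \<longleftrightarrow> sgn (y - x) = u \<and> v + of_real s * u \<in> open_segment x y"
proof -
  define n where "n = norm (y - x)"
  have n: "n > 0" using assms by (simp add: n_def)
  have y: "y = x + of_real n * u" if "sgn (y - x) = u" using endpoint_sgn[of y x] that by (simp add: n_def)
  show ?thesis
  proof
    assume c: "cov v u x y"
    then have su: "sgn (y - x) = u" by (simp add: cov_def)
    have "\<exists>t\<ge>0. t < n \<and> v = x + of_real t * u"
    proof (cases "x = v")
      case True
      then show ?thesis using n by (intro exI[of _ 0]) auto
    next
      case False
      then have "\<exists>t. 0 < t \<and> t < n \<and> v = x + of_real t * u"
        using c unfolding cov_def oseg_iff su n_def[symmetric] by simp
      then show ?thesis using less_imp_le by blast
    qed
    then obtain t where t: "t \<ge> 0" "t < n" "v = x + of_real t * u" by blast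
    have "y - v = of_real (n - t) * u" using y[OF su] t(3) by (simp add: algebra_simps)
    then have "norm (y - v) = \<bar>n - t\<bar>" using assms(1) by (simp only: norm_mult norm_of_real) simp
    then have "norm (y - v) = n - t" "y \<noteq> v" using t by auto
    then have "s < n - t" using assms(3)[of y] assms(5) by simp
    then have "\<exists>r. 0 < r \<and> r < n \<and> v + of_real s * u = x + of_real r * u"
      using t assms(2) by (intro exI[of _ "t + s"]) (auto simp: algebra_simps)
    then show "sgn (y - x) = u \<and> v + of_real s * u \<in> open_segment x y"
      unfolding oseg_iff su n_def[symmetric] using su by auto
  next
    assume c: "sgn (y - x) = u \<and> v + of_real s * u \<in> open_segment x y"
    then have su: "sgn (y - x) = u" by simp
    obtain r where r: "0 < r" "r < n" "v + of_real s * u = x + of_real r * u"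
      using c unfolding oseg_iff n_def[symmetric] by auto
    have v: "v = x + of_real (r - s) * u" using r(3) by (simp add: algebra_simps)
    have "r \<ge> s"
    proof (rule ccontr)
      assume "\<not> r \<ge> s"
      have "x - v = of_real (s - r) * u" using v by (simp add: algebra_simps)
      then have "norm (x - v) = \<bar>s - r\<bar>" using assms(1) by (simp only: norm_mult norm_of_real) simp
      then have "norm (x - v) = s - r" "x \<noteq> v" using \<open>\<not> r \<ge> s\<close> by auto
      then show False using assms(3)[of x] assms(4) r by simp
    qed
    then consider "x = v" | "0 < r - s" using v by force
    then show "cov v u x y"
    proof cases
      case 2
      then have "\<exists>t. 0 < t \<and> t < n \<and> v = x + of_real t * u" using r v assms(2) by (intro exI[of _ "r - s"]) auto
      then show ?thesis unfolding cov_def oseg_iff su n_def[symmetric] using assms(6) by auto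
    qed (use su assms(6) in \<open>auto simp: cov_def\<close>)
  qed
qed

lemma germ_unique:
  assumes "(j, x, y) \<in> EE" "cov v u x y" "(k, x', y') \<in> EE" "cov v u x' y'"
  shows "(j, x, y) = (k, x', y')"
proof -
  have nu: "norm u = 1" using assms(2) by (auto simp: cov_def norm_sgn)
  obtain s where s: "s > 0" "\<And>w. w \<in> VV \<Longrightarrow> w \<noteq> v \<Longrightarrow> s < norm (w - v)" using small_step[of v] by blast
  have "sgn (y - x) = u \<and> v + of_real s * u \<in> open_segment x y"
    using cov_step[OF nu s, of x y] assms(2) EE_VV[OF assms(1)] EE_neq[OF assms(1)] by blast
  moreover have "sgn (y' - x') = u \<and> v + of_real s * u \<in> open_segment x' y'"
    using cov_step[OF nu s, of x' y'] assms(4) EE_VV[OF assms(3)] EE_neq[OF assms(3)] by blast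
  ultimately show ?thesis using edge_unique[OF assms(1) _ assms(3), of "v + of_real s * u"] by simp
qed

lemma germ_unique_rev:
  assumes "(j, x, y) \<in> EE" "cov v u y x" "(k, x', y') \<in> EE" "cov v u y' x'"
  shows "(j, x, y) = (k, x', y')"
proof -
  have nu: "norm u = 1" using assms(2) by (auto simp: cov_def norm_sgn)
  obtain s where s: "s > 0" "\<And>w. w \<in> VV \<Longrightarrow> w \<noteq> v \<Longrightarrow> s < norm (w - v)" using small_step[of v] by blast
  have "sgn (x - y) = u \<and> v + of_real s * u \<in> open_segment y x"
    using cov_step[OF nu s, of y x] assms(2) EE_VV[OF assms(1)] EE_neq[OF assms(1)] by blast
  moreover have "sgn (x' - y') = u \<and> v + of_real s * u \<in> open_segment y' x'"
    using cov_step[OF nu s, of y' x'] assms(4) EE_VV[OF assms(3)] EE_neq[OF assms(3)] by blast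
  ultimately show ?thesis using edge_unique[OF assms(1) _ assms(3), of "v + of_real s * u"] sgn_swap[of y x] sgn_swap[of y' x']
    by (simp add: open_segment_commute)
qed

text \<open>An edge along the ray with its cell on one side faces an edge with its cell on the other
  side; the two need not have an endpoint in common.\<close>

lemma germ_iff:
  "(\<exists>(j, x, y)\<in>EE. cov v u x y) \<longleftrightarrow> (\<exists>(j, x, y)\<in>EE. cov v u y x)"
proof (cases "norm u = 1")
  case nu: True
  obtain s where s: "s > 0" "\<And>w. w \<in> VV \<Longrightarrow> w \<noteq> v \<Longrightarrow> s < norm (w - v)" using small_step[of v] by blast
  define p where "p = v + of_real s * u"
  have pV: "p \<notin> VV"
  proof
    assume "p \<in> VV"
    moreover have "p \<noteq> v" "norm (p - v) = s" using s(1) nu by (auto simp: p_def norm_mult)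
    ultimately show False using s(2)[of p] by simp
  qed
  have c: "(cov v u x y \<longleftrightarrow> sgn (y - x) = u \<and> p \<in> open_segment x y) \<and> (cov v u y x \<longleftrightarrow> sgn (y - x) = - u \<and> p \<in> open_segment x y)"
    if "(j, x, y) \<in> EE" for j x y
    using cov_step[OF nu s, of x y] cov_step[OF nu s, of y x] EE_VV[OF that] EE_neq[OF that] sgn_swap[of x y]
    by (auto simp: p_def open_segment_commute)
  show ?thesis
  proof
    assume "\<exists>(j, x, y)\<in>EE. cov v u x y"
    then obtain j x y where e: "(j, x, y) \<in> EE" "cov v u x y" by blast
    then show "\<exists>(j, x, y)\<in>EE. cov v u y x"
      using edge_reverse[OF e(1) _ pV] c by blast
  next
    assume "\<exists>(j, x, y)\<in>EE. cov v u y x"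
    then obtain j x y where e: "(j, x, y) \<in> EE" "cov v u y x" by blast
    then show "\<exists>(j, x, y)\<in>EE. cov v u x y"
      using edge_reverse[OF e(1) _ pV] c by force
  qed
qed (auto simp: cov_def norm_sgn)

end

section \<open>Sums over all directed edges\<close>

lemma sum_ded:
  fixes F :: "complex \<Rightarrow> complex \<Rightarrow> 'v::real_vector"
  assumes add: "\<And>p q r. cr p q r = 0 \<Longrightarrow> F p q + F q r = F p r" and nd: "cr A B C \<noteq> 0"
  shows "(\<Sum>(x, y)\<in>ded A B C. F x y) = sgn (cr A B C) *\<^sub>R (F A B + F B C + F C A)"
proof -
  have ne: "A \<noteq> B" "B \<noteq> C" "C \<noteq> A" using nd by auto
  have F0: "F p p = 0" for p using add[of p p p] by simp
  have sw: "F q p = - F p q" for p q using add[of p q p] F0[of p] by (simp add: eq_neg_iff_add_eq_0 add.commute)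
  show ?thesis
  proof (cases "cr A B C > 0")
    case True
    then show ?thesis using ne by (simp add: ded_def)
  next
    case False
    then have "sgn (cr A B C) = -1" using nd by (simp add: sgn_if)
    then show ?thesis using False ne sw[of B A] sw[of C B] sw[of A C] by (auto simp: ded_def)
  qed
qed

context tiling
begin

text \<open>By \<open>germ_iff\<close> and uniqueness, the edges that start at \<open>v\<close> or
  pass through it in direction \<open>u\<close> are as many as those that end at \<open>v\<close> or
  pass through it in direction \<open>- u\<close>. Adding this for \<open>u\<close> and
  \<open>- u\<close> cancels the passing edges.\<close>

lemma vertex_balance:
  assumes nu: "norm u = 1"
  shows "card {(j, x, y)\<in>EE. y = v \<and> (sgn (y - x) = u \<or> sgn (y - x) = - u)} =
    card {(j, x, y)\<in>EE. x = v \<and> (sgn (y - x) = u \<or> sgn (y - x) = - u)}"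
proof -
  define D where "D u = {(j, x, y)\<in>EE. y = v \<and> sgn (y - x) = u}" for u
  define S where "S u = {(j, x, y)\<in>EE. x = v \<and> sgn (y - x) = u}" for u
  define P where "P u = {(j, x, y)\<in>EE. v \<in> open_segment x y \<and> sgn (y - x) = u}" for u
  have fin: "finite (D u)" "finite (S u)" "finite (P u)" for u
    unfolding D_def S_def P_def by (rule finite_subset[OF _ finite_EE], auto)+
  have u0: "u \<noteq> - u" using nu by auto
  have germ: "card (S u) + card (P u) = card (D (- u)) + card (P (- u))" for u
  proof -
    have 1: "S u \<union> P u = {(j, x, y)\<in>EE. cov v u x y}"
      unfolding S_def P_def cov_def using EE_neq by blast
    have 2: "D (- u) \<union> P (- u) = {(j, x, y)\<in>EE. cov v u y x}"
    proof -
      have "sgn (x - y) = u \<longleftrightarrow> sgn (y - x) = - u" for x y :: complex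
        using sgn_swap[of x y] by auto
      then show ?thesis unfolding D_def P_def cov_def by (auto simp: open_segment_commute dest: EE_neq)
    qed
    have "card {(j, x, y)\<in>EE. cov v u x y} = card {(j, x, y)\<in>EE. cov v u y x}"
    proof (rule card_eq_subsingletons)
      show "({(j, x, y)\<in>EE. cov v u x y} \<noteq> {}) = ({(j, x, y)\<in>EE. cov v u y x} \<noteq> {})"
        using germ_iff[of v u] by blast
    qed (use germ_unique germ_unique_rev in blast)+
    moreover have "card (S u \<union> P u) = card (S u) + card (P u)"
      using fin by (intro card_Un_disjoint) (auto simp: S_def P_def open_segment_def)
    moreover have "card (D (- u) \<union> P (- u)) = card (D (- u)) + card (P (- u))"
      using fin by (intro card_Un_disjoint) (auto simp: D_def P_def open_segment_def)
    ultimately show ?thesis using 1 2 by metis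
  qed
  have "{(j, x, y)\<in>EE. y = v \<and> (sgn (y - x) = u \<or> sgn (y - x) = - u)} = D u \<union> D (- u)"
    by (auto simp: D_def)
  moreover have "{(j, x, y)\<in>EE. x = v \<and> (sgn (y - x) = u \<or> sgn (y - x) = - u)} = S u \<union> S (- u)"
    by (auto simp: S_def)
  moreover have "card (D u \<union> D (- u)) = card (D u) + card (D (- u))"
    using fin u0 by (intro card_Un_disjoint) (auto simp: D_def)
  moreover have "card (S u \<union> S (- u)) = card (S u) + card (S (- u))"
    using fin u0 by (intro card_Un_disjoint) (auto simp: S_def)
  ultimately show ?thesis using germ[of u] germ[of "- u"] by simp
qed

text \<open>On each line \<open>F\<close> is the difference of a potential. The sum therefore
  regroups into one term per line and point, the potential times the excess of ending over starting
  edges, and \<open>vertex_balance\<close> makes that excess 0.\<close>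

lemma edge_sum_zero:
  fixes F :: "complex \<Rightarrow> complex \<Rightarrow> 'v::real_vector"
  assumes add: "\<And>p q r. cr p q r = 0 \<Longrightarrow> F p q + F q r = F p r"
  shows "(\<Sum>(j, x, y)\<in>EE. F x y) = 0"
proof -
  define ln :: "'i option \<times> complex \<times> complex \<Rightarrow> complex set" where "ln = (\<lambda>(j, x, y). lin x (sgn (y - x)))"
  define src :: "'i option \<times> complex \<times> complex \<Rightarrow> complex" where "src = (\<lambda>(j, x, y). x)"
  define dst :: "'i option \<times> complex \<times> complex \<Rightarrow> complex" where "dst = (\<lambda>(j, x, y). y)"
  \<comment> \<open>The potential on a line is \<open>F\<close> measured from a base point that
    depends only on the line as a set, hence is common to both directions.\<close>
  define G where "G = (\<lambda>(l, v). F (SOME p. p \<in> l) v)"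
  have ln_dst: "ln (j, x, y) = lin y (sgn (y - x))" for j x y
    using lin_shift[of x "norm (y - x)" "sgn (y - x)"] endpoint_sgn[of y x] by (simp add: ln_def)
  have in_lin: "w \<in> lin w u" for w u by (auto simp: lin_def intro: exI[of _ 0])
  have split: "F x y = G (ln (j, x, y), dst (j, x, y)) - G (ln (j, x, y), src (j, x, y))" for j x y
  proof -
    define b where "b = (SOME p. p \<in> ln (j, x, y))"
    have "x \<in> ln (j, x, y)" by (simp add: ln_def in_lin)
    then have "b \<in> ln (j, x, y)" unfolding b_def by (rule someI)
    moreover have "y \<in> ln (j, x, y)" using in_lin ln_dst by simp
    ultimately have "cr b x y = 0" using \<open>x \<in> ln (j, x, y)\<close> cr_lin by (auto simp: ln_def)
    then have "F b x + F x y = F b y" by (rule add)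
    then show ?thesis by (simp add: G_def b_def src_def dst_def algebra_simps)
  qed
  have "(\<Sum>(j, x, y)\<in>EE. F x y) = (\<Sum>e\<in>EE. G (ln e, dst e) - G (ln e, src e))"
    by (rule sum.cong) (auto simp: split)
  also have "\<dots> = (\<Sum>e\<in>EE. G (ln e, dst e)) - (\<Sum>e\<in>EE. G (ln e, src e))" by (rule sum_subtractf)
  also have "(\<Sum>e\<in>EE. G (ln e, dst e)) = (\<Sum>e\<in>EE. G (ln e, src e))"
  proof (rule sum_eq_fibres[OF finite_EE, of "\<lambda>e. (ln e, dst e)" "\<lambda>e. (ln e, src e)" G])
    fix z :: "complex set \<times> complex"
    obtain l v where z: "z = (l, v)" by force
    show "card {e \<in> EE. (ln e, dst e) = z} = card {e \<in> EE. (ln e, src e) = z}"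
    proof (cases "\<exists>u. norm u = 1 \<and> l = lin v u")
      case True
      then obtain u where u: "norm u = 1" "l = lin v u" by blast
      have k: "lin v (sgn w) = l \<longleftrightarrow> sgn w = u \<or> sgn w = - u" if "w \<noteq> 0" for w
        using lin_eqD[of v u "sgn w"] that u by (auto simp: norm_sgn lin_uminus)
      have "{e \<in> EE. (ln e, dst e) = z} = {(j, x, y)\<in>EE. y = v \<and> (sgn (y - x) = u \<or> sgn (y - x) = - u)}"
      proof (rule set_eqI)
        fix e :: "'i option \<times> complex \<times> complex" obtain j x y where e: "e = (j, x, y)" using prod_cases3 by blast
        show "e \<in> {e \<in> EE. (ln e, dst e) = z} \<longleftrightarrow> e \<in> {(j, x, y)\<in>EE. y = v \<and> (sgn (y - x) = u \<or> sgn (y - x) = - u)}"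
          using k[of "y - x"] EE_neq[of j x y] ln_dst[of j x y] unfolding e z by (auto simp: dst_def)
      qed
      moreover have "{e \<in> EE. (ln e, src e) = z} = {(j, x, y)\<in>EE. x = v \<and> (sgn (y - x) = u \<or> sgn (y - x) = - u)}"
      proof (rule set_eqI)
        fix e :: "'i option \<times> complex \<times> complex" obtain j x y where e: "e = (j, x, y)" using prod_cases3 by blast
        show "e \<in> {e \<in> EE. (ln e, src e) = z} \<longleftrightarrow> e \<in> {(j, x, y)\<in>EE. x = v \<and> (sgn (y - x) = u \<or> sgn (y - x) = - u)}"
          using k[of "y - x"] EE_neq[of j x y] unfolding e z by (auto simp: src_def ln_def)
      qed
      ultimately show ?thesis using vertex_balance[OF u(1)] by simp
    next
      case False
      have "(ln e, dst e) \<noteq> z \<and> (ln e, src e) \<noteq> z" if "e \<in> EE" for e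
      proof -
        obtain j x y where e: "e = (j, x, y)" using prod_cases3 by blast
        have "norm (sgn (y - x)) = 1" using EE_neq that e by (auto simp: norm_sgn)
        then show ?thesis using False unfolding e z using ln_dst[of j x y] by (auto simp: src_def dst_def ln_def)
      qed
      then have "{e \<in> EE. (ln e, dst e) = z} = {}" "{e \<in> EE. (ln e, src e) = z} = {}" by blast+
      then show ?thesis by (simp only:)
    qed
  qed
  finally show ?thesis by simp
qed

text \<open>The edges of the outer cell are those of the big triangle reversed; moved to the other
  side they give the claim. The factor \<open>sgn\<close> lets reflected tiles keep their vertex
  labels although \<open>ded\<close> orders edges counterclockwise.\<close>

theorem boundary_sum:
  fixes F :: "complex \<Rightarrow> complex \<Rightarrow> 'v::real_vector"
  assumes add: "\<And>p q r. cr p q r = 0 \<Longrightarrow> F p q + F q r = F p r"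
  shows "(\<Sum>i\<in>I. sgn (cr (tA i) (tB i) (tC i)) *\<^sub>R (F (tA i) (tB i) + F (tB i) (tC i) + F (tC i) (tA i))) =
    sgn (cr X Y Z) *\<^sub>R (F X Y + F Y Z + F Z X)"
proof -
  have F0: "F p p = 0" for p using add[of p p p] by simp
  have sw: "F q p = - F p q" for p q using add[of p q p] F0[of p] by (simp add: eq_neg_iff_add_eq_0 add.commute)
  have aux: "l = r" if "- r + l = 0" for l r :: 'v using that by (simp add: add_eq_0_iff2)
  have "(\<Sum>(j, x, y)\<in>EE. F x y) = (\<Sum>j\<in>cells. \<Sum>(x, y)\<in>ed j. F x y)"
    unfolding EE_def by (subst sum.Sigma) (auto simp: finite_cells finite_ed split_beta)
  then have e1: "(\<Sum>j\<in>cells. \<Sum>(x, y)\<in>ed j. F x y) = 0" using edge_sum_zero[OF add] by simp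
  have e2: "(\<Sum>j\<in>cells. \<Sum>(x, y)\<in>ed j. F x y) =
      (\<Sum>(x, y)\<in>ed None. F x y) + (\<Sum>j\<in>Some ` I. \<Sum>(x, y)\<in>ed j. F x y)"
    unfolding cells_def using fin by (intro sum.insert) auto
  have e3: "(\<Sum>j\<in>Some ` I. \<Sum>(x, y)\<in>ed j. F x y) = (\<Sum>i\<in>I. \<Sum>(x, y)\<in>ed (Some i). F x y)"
    by (subst sum.reindex) auto
  have e4: "(\<Sum>i\<in>I. \<Sum>(x, y)\<in>ed (Some i). F x y) =
      (\<Sum>i\<in>I. sgn (cr (tA i) (tB i) (tC i)) *\<^sub>R (F (tA i) (tB i) + F (tB i) (tC i) + F (tC i) (tA i)))"
    using sum_ded[OF add nondeg] by (intro sum.cong) auto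
  have e5: "(\<Sum>(x, y)\<in>ed None. F x y) = - (sgn (cr X Y Z) *\<^sub>R (F X Y + F Y Z + F Z X))"
  proof -
    have 1: "(\<Sum>(x, y)\<in>ed None. F x y) = (\<Sum>(x, y)\<in>ded X Y Z. F y x)"
      by (rule sum.reindex_bij_witness[of _ prod.swap prod.swap]) auto
    have 2: "(\<Sum>(x, y)\<in>ded X Y Z. F y x) = (\<Sum>z\<in>ded X Y Z. - (case z of (x, y) \<Rightarrow> F x y))"
      by (intro sum.cong) (auto intro: sw)
    have 3: "(\<Sum>z\<in>ded X Y Z. case z of (x, y) \<Rightarrow> F x y) = sgn (cr X Y Z) *\<^sub>R (F X Y + F Y Z + F Z X)"
      by (rule sum_ded[OF add NONDEG])
    show ?thesis unfolding 1 2 sum_negf 3 ..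
  qed
  have "- (sgn (cr X Y Z) *\<^sub>R (F X Y + F Y Z + F Z X)) +
    (\<Sum>i\<in>I. sgn (cr (tA i) (tB i) (tC i)) *\<^sub>R (F (tA i) (tB i) + F (tB i) (tC i) + F (tC i) (tA i))) = 0"
    using e1 unfolding e2 e3 e4 e5 .
  then show ?thesis by (rule aux)
qed

end

section \<open>Angles around a point\<close>

text \<open>The oriented angle at \<open>w\<close> under which the segment from \<open>p\<close> to \<open>q\<close> is seen; it is 0 also when
  \<open>w\<close> lies between \<open>p\<close> and \<open>q\<close>.\<close>

definition av :: "complex \<Rightarrow> complex \<Rightarrow> complex \<Rightarrow> real" where
  "av w p q = (if cr w p q = 0 then 0 else Arg ((q - w) / (p - w)))"

lemma Arg_divide_upper:
  assumes "Im s > 0" "Im t > 0"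
  shows "Arg (t / s) = Arg t - Arg s"
proof -
  have nz: "s \<noteq> 0" "t \<noteq> 0" using assms by auto
  have b: "0 < Arg s" "Arg s < pi" "0 < Arg t" "Arg t < pi" using assms Arg_lt_pi by blast+
  have "t / s = rcis (norm t / norm s) (Arg t - Arg s)"
    using rcis_cmod_Arg[of s] rcis_cmod_Arg[of t] rcis_divide[of "norm t" "Arg t" "norm s" "Arg s"] by simp
  then show ?thesis using b nz by (simp add: Arg_rcis)
qed

text \<open>Multiplication by \<open>cnj d\<close> moves the half-plane to the upper one, where
  \<open>Arg\<close> has no jump and angles are plain differences.\<close>

lemma av_halfplane:
  assumes "Im (cnj d * (p - w)) > 0" "Im (cnj d * (q - w)) > 0"
  shows "av w p q = Arg (cnj d * (q - w)) - Arg (cnj d * (p - w))"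
proof -
  have nz: "d \<noteq> 0" "p \<noteq> w" "q \<noteq> w" using assms by auto
  have "(cnj d * (q - w)) / (cnj d * (p - w)) = (q - w) / (p - w)" using nz by simp
  then have e: "Arg ((q - w) / (p - w)) = Arg (cnj d * (q - w)) - Arg (cnj d * (p - w))"
    using Arg_divide_upper[OF assms] by simp
  show ?thesis
  proof (cases "cr w p q = 0")
    case True
    have "Im ((q - w) / (p - w)) = 0" using True by (simp add: cr_alt Im_divide algebra_simps)
    then have r: "(q - w) / (p - w) = of_real (Re ((q - w) / (p - w)))" by (simp add: complex_eq_iff)
    define x where "x = Re ((q - w) / (p - w))"
    have "q - w = of_real x * (p - w)" using r nz by (simp add: x_def field_simps)
    then have "cnj d * (q - w) = of_real x * (cnj d * (p - w))" by simp
    then have "Im (cnj d * (q - w)) = x * Im (cnj d * (p - w))" by (simp only: times_complex.sel complex.sel Re_complex_of_real Im_complex_of_real mult_zero_left mult_zero_right add_0_right diff_0_right add_0_left)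
    then have "x > 0" using assms by (simp add: zero_less_mult_iff)
    then have "Arg ((q - w) / (p - w)) = 0" using r x_def by (metis Arg_of_real not_less_iff_gr_or_eq)
    then show ?thesis using True e by (simp add: av_def)
  qed (use e in \<open>simp add: av_def\<close>)
qed

text \<open>A line missing \<open>w\<close> lies in an open half-plane bounded by its parallel
  through \<open>w\<close>, where the angles telescope. On a line through \<open>w\<close> all three
  are 0, which is the reason for the convention in \<open>av\<close>.\<close>

lemma av_add:
  assumes "cr p q r = 0"
  shows "av w p q + av w q r = av w p r"
proof -
  have *: ?thesis if d: "d \<noteq> 0" "\<exists>s t. q = p + of_real s * d \<and> r = p + of_real t * d" for d
  proof -
    obtain s t where st: "q = p + of_real s * d" "r = p + of_real t * d" using d by blast
    define h where "h = Im (cnj d * (p - w))"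
    have h: "Im (cnj d * (q - w)) = h" "Im (cnj d * (r - w)) = h"
      by (simp_all add: h_def st algebra_simps)
    consider "h = 0" | "h > 0" | "h < 0" by linarith
    then show ?thesis
    proof cases
      case 1
      then have "Im (cnj d * (p - w)) = 0" using h_def by simp
      then obtain k where k: "p = w + of_real k * d"
      proof -
        have "Im ((p - w) / d) = 0" using \<open>Im (cnj d * (p - w)) = 0\<close> by (simp add: Im_divide algebra_simps)
        then have "(p - w) / d = of_real (Re ((p - w) / d))" by (simp add: complex_eq_iff)
        then have "p = w + of_real (Re ((p - w) / d)) * d" using d(1) by (simp add: field_simps)
        then show thesis using that by blast
      qed
      have "cr w p q = 0" "cr w q r = 0" "cr w p r = 0"
        unfolding st k by (simp_all add: cr_alt algebra_simps)
      then show ?thesis by (simp add: av_def)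
    next
      case 2
      then show ?thesis using av_halfplane[of d] h h_def by simp
    next
      case 3
      have m: "Im (cnj (- d) * (z - w)) = - Im (cnj d * (z - w))" for z by simp
      have "Im (cnj (- d) * (p - w)) > 0" "Im (cnj (- d) * (q - w)) > 0" "Im (cnj (- d) * (r - w)) > 0"
        unfolding m using h h_def 3 by simp_all
      then show ?thesis using av_halfplane[of "- d"] by simp
    qed
  qed
  show ?thesis
  proof (cases "p = q")
    case True
    then show ?thesis by (cases "r = p") (auto simp: av_def)
  next
    case False
    have "Im ((r - p) / (q - p)) = 0" using assms by (simp add: cr_alt Im_divide algebra_simps)
    then have "(r - p) / (q - p) = of_real (Re ((r - p) / (q - p)))" by (simp add: complex_eq_iff)
    then have "r = p + of_real (Re ((r - p) / (q - p))) * (q - p)" using False by (simp add: field_simps)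
    moreover have "q = p + of_real 1 * (q - p)" by simp
    ultimately have "\<exists>s t. q = p + of_real s * (q - p) \<and> r = p + of_real t * (q - p)" by blast
    then show ?thesis using *[of "q - p"] False by simp
  qed
qed

definition cang :: "complex \<Rightarrow> complex \<Rightarrow> complex \<Rightarrow> real" where
  "cang p q r = arccos (((p - q) \<bullet> (r - q)) / (norm (p - q) * norm (r - q)))"

lemma cang_commute: "cang p q r = cang r q p"
  by (simp add: cang_def inner_commute mult.commute)

lemma Im_div_cr: "Im ((q - w) / (p - w)) = cr w p q / (norm (p - w))\<^sup>2"
  unfolding cmod_power2 by (simp add: cr_alt Im_divide algebra_simps)

lemma Arg_eq_cang:
  assumes "cr w p q > 0"
  shows "Arg ((q - w) / (p - w)) = cang p w q"
proof -
  define z where "z = (q - w) / (p - w)"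
  have nz: "p \<noteq> w" "q \<noteq> w" using assms by auto
  have "Im z > 0" unfolding z_def Im_div_cr using assms nz by simp
  then have b: "0 < Arg z" "Arg z < pi" using Arg_lt_pi by blast+
  have "z \<noteq> 0" using nz by (simp add: z_def)
  then have "cos (Arg z) = Re z / norm z" by (rule cos_Arg)
  also have "\<dots> = ((p - w) \<bullet> (q - w)) / (norm (p - w) * norm (q - w))"
  proof -
    have "Re z = ((p - w) \<bullet> (q - w)) / (norm (p - w))\<^sup>2"
      unfolding cmod_power2 by (simp add: z_def Re_divide inner_complex_def algebra_simps)
    moreover have "norm z = norm (q - w) / norm (p - w)" by (simp add: z_def norm_divide)
    ultimately show ?thesis using nz by (simp only:) (simp add: field_simps power2_eq_square)
  qed
  finally have "Arg z = arccos (((p - w) \<bullet> (q - w)) / (norm (p - w) * norm (q - w)))"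
    using b by (metis arccos_cos less_imp_le)
  then show ?thesis by (simp add: z_def cang_def)
qed

lemma av_pos: "cr w p q > 0 \<Longrightarrow> av w p q = cang p w q \<and> 0 < av w p q \<and> av w p q < pi"
proof -
  assume a: "cr w p q > 0"
  then have "p \<noteq> w" by auto
  then have "Im ((q - w) / (p - w)) > 0" unfolding Im_div_cr using a by simp
  then show ?thesis using a Arg_eq_cang[OF a] Arg_lt_pi[of "(q - w) / (p - w)"] by (simp add: av_def)
qed

lemma av_cis: "cr w p q \<noteq> 0 \<Longrightarrow> cis (av w p q) = sgn ((q - w) / (p - w))"
  by (cases "p = w"; cases "q = w") (simp_all add: av_def cis_Arg del: sgn_divide)

text \<open>The angle that a triangle occupies at \<open>w\<close>.\<close>

definition wang :: "complex \<Rightarrow> complex \<Rightarrow> complex \<Rightarrow> complex \<Rightarrow> real" where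
  "wang A B C w = (if w = A then cang B A C else if w = B then cang A B C else if w = C then cang A C B
     else if w \<in> itri A B C then 2 * pi else if w \<in> tri A B C then pi else 0)"

lemma cis_eq_1: "cis x = 1 \<Longrightarrow> 0 < x \<Longrightarrow> x < 4 * pi \<Longrightarrow> x = 2 * pi"
proof -
  assume a: "cis x = 1" "0 < x" "x < 4 * pi"
  then have "cos x = 1" by (metis cis.sel(1) one_complex.sel(1))
  then obtain n :: int where n: "x = of_int n * 2 * pi" using cos_one_2pi_int by auto
  then have "0 < n" "n < 2" using a by (auto simp: zero_less_mult_iff)
  then have "n = 1" by linarith
  then show ?thesis using n by simp
qed

lemma cis_eq_m1: "cis x = -1 \<Longrightarrow> 0 < x \<Longrightarrow> x < 3 * pi \<Longrightarrow> x = pi"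
  using cis_eq_1[of "x + pi"] by (simp add: cis_mult[symmetric])

lemma sgn_oseg:
  assumes "w \<in> open_segment p q"
  shows "sgn ((p - w) / (q - w)) = (-1 :: complex)"
proof -
  obtain t where t: "w = (1 - t) *\<^sub>R p + t *\<^sub>R q" "0 < t" "t < 1" and ne: "p \<noteq> q" using assms by (auto simp: in_segment)
  define k where "k = p - q"
  have "p - w = of_real t * k" "q - w = of_real (t - 1) * k" by (simp_all add: k_def t scaleR_conv_of_real algebra_simps)
  then have "(p - w) / (q - w) = (of_real t * k) / (of_real (t - 1) * k)" by (simp only:)
  also have "\<dots> = of_real (t / (t - 1))" using ne by (simp add: k_def)
  finally have "sgn ((p - w) / (q - w)) = of_real (sgn (t / (t - 1)))" by (simp only: sgn_of_real)
  moreover have "t / (t - 1) < 0" using t by (simp add: divide_pos_neg)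
  ultimately show ?thesis by (simp only: sgn_neg) simp
qed

text \<open>If \<open>w\<close> is outside, some edge separates it from the triangle and the angles
  telescope to 0. At a corner only one angle is left. Otherwise the product of the quotients gives
  the sum modulo a full turn, and since each angle lies between 0 and \<pi>, this pins it down to
  2\<pi> inside and to \<pi> on an edge.\<close>

lemma wang_av:
  assumes "cr A B C \<noteq> 0"
  shows "sgn (cr A B C) * (av w A B + av w B C + av w C A) = wang A B C w"
proof -
  have ccw: "av w A B + av w B C + av w C A = wang A B C w" if d: "cr A B C > 0" for A B C
  proof -
    have ne: "A \<noteq> B" "B \<noteq> C" "C \<noteq> A" using d by auto
    have d': "cr B C A > 0" "cr C A B > 0" using d cr_rotate[of A B C] by simp_all
    have z: "cr w A B = cr A B w" "cr w B C = cr B C w" "cr w C A = cr C A w"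
      by (rule cr_rotate(2))+
    consider "w \<in> {A, B, C}" | "w \<notin> {A, B, C}" "w \<notin> tri A B C" | "w \<in> itri A B C"
      | "w \<in> open_segment A B" | "w \<in> open_segment B C" | "w \<in> open_segment C A"
    proof -
      have "ded A B C = {(A, B), (B, C), (C, A)}" using d by (simp add: ded_def)
      then show thesis using tri_cases[of A B C] d that by (cases "w \<in> tri A B C"; cases "w \<in> {A, B, C}") auto
    qed
    then show ?thesis
    proof cases
      case 1
      have "av A A B = 0" "av A C A = 0" "av B A B = 0" "av B B C = 0" "av C B C = 0" "av C C A = 0"
        by (simp_all add: av_def)
      with 1 show ?thesis using av_pos[OF d] av_pos[OF d'(1)] av_pos[OF d'(2)] ne cang_commute[of C B A]
        by (auto simp: wang_def)
    next
      case 2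
      then obtain x y where xy: "(x, y) \<in> ded A B C" "cr x y w < 0" by (auto simp: tri_def not_le)
      have "A \<in> tri A B C" "B \<in> tri A B C" "C \<in> tri A B C" using d d' by (auto simp: tri_ccw[OF d])
      then have nn: "cr x y A \<ge> 0" "cr x y B \<ge> 0" "cr x y C \<ge> 0" using xy by (auto simp: tri_def)
      have "Im (cnj (y - x) * (q - w)) = cr x y q - cr x y w" for q by (simp add: cr_alt algebra_simps)
      then have "Im (cnj (y - x) * (A - w)) > 0" "Im (cnj (y - x) * (B - w)) > 0" "Im (cnj (y - x) * (C - w)) > 0"
        using xy nn by simp_all
      moreover have "w \<notin> itri A B C" using 2 itri_subset by blast
      ultimately show ?thesis using av_halfplane[of "y - x" _ w] 2 by (simp add: wang_def)
    next
      case 3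
      then have p: "cr w A B > 0" "cr w B C > 0" "cr w C A > 0" using z by (auto simp: tri_ccw[OF d])
      have n: "w \<noteq> A" "w \<noteq> B" "w \<noteq> C" using p by auto
      have "cis (av w A B + av w B C + av w C A) = sgn ((B - w) / (A - w)) * sgn ((C - w) / (B - w)) * sgn ((A - w) / (C - w))"
        using p by (simp add: cis_mult[symmetric] av_cis)
      also have "\<dots> = sgn ((B - w) / (A - w) * ((C - w) / (B - w)) * ((A - w) / (C - w)))" by (simp only: sgn_mult)
      also have "(B - w) / (A - w) * ((C - w) / (B - w)) * ((A - w) / (C - w)) = 1" using n by simp
      also have "sgn (1::complex) = 1" by simp
      finally show ?thesis using av_pos[OF p(1)] av_pos[OF p(2)] av_pos[OF p(3)] cis_eq_1 3 n by (simp add: wang_def)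
    next
      case 4
      have p: "cr A B w = 0" "cr w B C > 0" "cr w C A > 0" using oseg_triD[OF d 4] z by auto
      have n: "w \<noteq> A" "w \<noteq> B" "w \<noteq> C" using p by auto
      have "sgn ((A - w) / (B - w)) = -1" using sgn_oseg[OF 4] .
      have "cis (av w B C + av w C A) = sgn ((C - w) / (B - w)) * sgn ((A - w) / (C - w))"
        using p by (simp add: cis_mult[symmetric] av_cis)
      also have "\<dots> = sgn ((C - w) / (B - w) * ((A - w) / (C - w)))" by (simp only: sgn_mult)
      also have "(C - w) / (B - w) * ((A - w) / (C - w)) = (A - w) / (B - w)" using n by simp
      finally have "av w B C + av w C A = pi" using \<open>sgn ((A - w) / (B - w)) = -1\<close> av_pos[OF p(2)] av_pos[OF p(3)] cis_eq_m1 by simp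
      moreover have "w \<notin> itri A B C" "w \<in> tri A B C" using p z by (auto simp: tri_ccw[OF d])
      ultimately show ?thesis using n p z by (simp add: wang_def av_def)
    next
      case 5
      have p: "cr B C w = 0" "cr w C A > 0" "cr w A B > 0" using oseg_triD[OF d'(1) 5] z by auto
      have n: "w \<noteq> A" "w \<noteq> B" "w \<noteq> C" using p by auto
      have "sgn ((B - w) / (C - w)) = -1" using sgn_oseg[OF 5] .
      have "cis (av w C A + av w A B) = sgn ((A - w) / (C - w)) * sgn ((B - w) / (A - w))"
        using p by (simp add: cis_mult[symmetric] av_cis)
      also have "\<dots> = sgn ((A - w) / (C - w) * ((B - w) / (A - w)))" by (simp only: sgn_mult)
      also have "(A - w) / (C - w) * ((B - w) / (A - w)) = (B - w) / (C - w)" using n by simp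
      finally have "av w C A + av w A B = pi" using \<open>sgn ((B - w) / (C - w)) = -1\<close> av_pos[OF p(2)] av_pos[OF p(3)] cis_eq_m1 by simp
      moreover have "w \<notin> itri A B C" "w \<in> tri A B C" using p z by (auto simp: tri_ccw[OF d])
      ultimately show ?thesis using n p z by (simp add: wang_def av_def)
    next
      case 6
      have p: "cr C A w = 0" "cr w A B > 0" "cr w B C > 0" using oseg_triD[OF d'(2) 6] z by auto
      have n: "w \<noteq> A" "w \<noteq> B" "w \<noteq> C" using p by auto
      have "sgn ((C - w) / (A - w)) = -1" using sgn_oseg[OF 6] .
      have "cis (av w A B + av w B C) = sgn ((B - w) / (A - w)) * sgn ((C - w) / (B - w))"
        using p by (simp add: cis_mult[symmetric] av_cis)
      also have "\<dots> = sgn ((B - w) / (A - w) * ((C - w) / (B - w)))" by (simp only: sgn_mult)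
      also have "(B - w) / (A - w) * ((C - w) / (B - w)) = (C - w) / (A - w)" using n by simp
      finally have "av w A B + av w B C = pi" using \<open>sgn ((C - w) / (A - w)) = -1\<close> av_pos[OF p(2)] av_pos[OF p(3)] cis_eq_m1 by simp
      moreover have "w \<notin> itri A B C" "w \<in> tri A B C" using p z by (auto simp: tri_ccw[OF d])
      ultimately show ?thesis using n p z by (simp add: wang_def av_def)
    qed
  qed
  show ?thesis
  proof (cases "cr A B C > 0")
    case True
    then show ?thesis using ccw by simp
  next
    case False
    then have d: "cr B A C > 0" using assms cr_swap(1)[of B A C] by linarith
    have sw: "av w q p = - av w p q" for p q using av_add[of p q p w] by (simp add: av_def)
    have "wang B A C w = wang A B C w"
      using assms by (auto simp: wang_def tri_swap cang_commute)
    moreover have "sgn (cr A B C) = -1" using False assms by (simp add: sgn_if)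
    ultimately show ?thesis using ccw[OF d] sw[of A B] sw[of B C] sw[of C A] by simp
  qed
qed

text \<open>The three quotients of directions multiply to -1, and three angles between 0 and \<pi>
  with that total direction add up to \<pi>.\<close>

lemma triangle_angle_sum:
  assumes "cr A B C \<noteq> 0"
  shows "cang B A C + cang A B C + cang A C B = pi"
proof -
  have *: "cang B A C + cang A B C + cang A C B = pi" if d: "cr A B C > 0" for A B C
  proof -
    have ne: "A \<noteq> B" "B \<noteq> C" "C \<noteq> A" using d by auto
    have d': "cr B C A > 0" "cr C A B > 0" using d cr_rotate[of A B C] by simp_all
    have "cis (av A B C + av B C A + av C A B) = sgn ((C - A) / (B - A)) * sgn ((A - B) / (C - B)) * sgn ((B - C) / (A - C))"
      using d d' by (simp add: cis_mult[symmetric] av_cis)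
    also have "\<dots> = sgn (((C - A) / (B - A)) * ((A - B) / (C - B)) * ((B - C) / (A - C)))" by (simp only: sgn_mult)
    also have "((C - A) / (B - A)) * ((A - B) / (C - B)) * ((B - C) / (A - C)) = -1"
      using ne by (simp add: divide_simps) (simp add: algebra_simps)
    finally have "cis (av A B C + av B C A + av C A B) = -1" by (simp add: sgn_minus)
    then show ?thesis using cis_eq_m1 av_pos[OF d] av_pos[OF d'(1)] av_pos[OF d'(2)] cang_commute[of A B C] cang_commute[of A C B] by simp
  qed
  show ?thesis
  proof (cases "cr A B C > 0")
    case False
    then have d: "cr B A C > 0" using assms cr_swap(1)[of B A C] by linarith
    then show ?thesis using *[OF d] by (simp add: cang_commute)
  qed (use * in auto)
qed

lemma (in tiling) angle_sum:
  "(\<Sum>i\<in>I. wang (tA i) (tB i) (tC i) w) = wang X Y Z w"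
proof -
  have "(\<Sum>i\<in>I. wang (tA i) (tB i) (tC i) w) =
    (\<Sum>i\<in>I. sgn (cr (tA i) (tB i) (tC i)) *\<^sub>R (av w (tA i) (tB i) + av w (tB i) (tC i) + av w (tC i) (tA i)))"
    by (rule sum.cong) (use wang_av[OF nondeg] in auto)
  also have "\<dots> = sgn (cr X Y Z) *\<^sub>R (av w X Y + av w Y Z + av w Z X)"
    by (rule boundary_sum) (rule av_add)
  also have "\<dots> = wang X Y Z w" using wang_av[OF NONDEG] by simp
  finally show ?thesis .
qed

lemma sum_indicator_card:
  fixes z :: real
  assumes "finite S"
  shows "(\<Sum>i\<in>S. if P i then z else 0) = real (card {i\<in>S. P i}) * z"
  using assms by (simp add: sum.inter_filter[symmetric])

lemma sum_card_fibres:
  assumes "finite S" "finite V" "f ` S \<subseteq> V"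
  shows "(\<Sum>w\<in>V. card {i\<in>S. f i = w}) = card S"
  using sum.group[OF assms, of "\<lambda>_. 1 :: nat"] by simp

lemma cang_bounds:
  assumes "cr A B C \<noteq> 0"
  shows "0 < cang B A C" "cang B A C < pi"
proof -
  consider "cr A B C > 0" | "cr A C B > 0" using assms cr_swap(2)[of A B C] by linarith
  then have "0 < cang B A C \<and> cang B A C < pi"
    using av_pos[of A B C] av_pos[of A C B] cang_commute[of C A B] by cases auto
  then show "0 < cang B A C" "cang B A C < pi" by auto
qed

section \<open>Vertex types\<close>

locale tile_tiling = tiling I tA tB tC X Y Z
  for I :: "'i set" and tA tB tC :: "'i \<Rightarrow> complex" and X Y Z :: complex +
  fixes a b c \<alpha> \<beta> :: real
  assumes lens: "i \<in> I \<Longrightarrow> norm (tC i - tB i) = a" "i \<in> I \<Longrightarrow> norm (tC i - tA i) = b" "i \<in> I \<Longrightarrow> norm (tB i - tA i) = c"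
    and angs: "i \<in> I \<Longrightarrow> cang (tB i) (tA i) (tC i) = \<alpha>" "i \<in> I \<Longrightarrow> cang (tA i) (tB i) (tC i) = \<beta>"
      "i \<in> I \<Longrightarrow> cang (tA i) (tC i) (tB i) = 2 * pi / 3"
    and ab_pos: "\<alpha> > 0" "\<beta> > 0" and ab_sum: "\<alpha> + \<beta> = pi / 3"
    and irr: "q \<in> \<rat> \<Longrightarrow> \<alpha> \<noteq> q * pi"
begin

definition nA :: "complex \<Rightarrow> nat" where "nA w = card {i\<in>I. tA i = w}"
definition nB :: "complex \<Rightarrow> nat" where "nB w = card {i\<in>I. tB i = w}"
definition nC :: "complex \<Rightarrow> nat" where "nC w = card {i\<in>I. tC i = w}"
definition nE :: "complex \<Rightarrow> nat" where
  "nE w = card {i\<in>I. w \<in> tri (tA i) (tB i) (tC i) - itri (tA i) (tB i) (tC i) - {tA i, tB i, tC i}}"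
definition nI :: "complex \<Rightarrow> nat" where "nI w = card {i\<in>I. w \<in> itri (tA i) (tB i) (tC i)}"

lemma tile_neq: "i \<in> I \<Longrightarrow> tA i \<noteq> tB i \<and> tA i \<noteq> tC i \<and> tB i \<noteq> tC i"
  using nondeg by fastforce

lemma vertex_not_inside: "A \<notin> itri A B C \<and> B \<notin> itri A B C \<and> C \<notin> itri A B C"
  by (auto simp: itri_def ded_def)

lemma vertex_equation:
  "nA w * \<alpha> + nB w * \<beta> + nC w * (2 * pi / 3) + nE w * pi + nI w * (2 * pi) = wang X Y Z w"
proof -
  let ?T = "\<lambda>i. tri (tA i) (tB i) (tC i)" and ?J = "\<lambda>i. itri (tA i) (tB i) (tC i)"
  have "wang X Y Z w = (\<Sum>i\<in>I. wang (tA i) (tB i) (tC i) w)" by (rule angle_sum[symmetric])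
  also have "\<dots> = (\<Sum>i\<in>I. (if tA i = w then \<alpha> else 0) + (if tB i = w then \<beta> else 0) + (if tC i = w then 2 * pi / 3 else 0) +
      (if w \<in> ?T i - ?J i - {tA i, tB i, tC i} then pi else 0) + (if w \<in> ?J i then 2 * pi else 0))"
  proof (rule sum.cong[OF refl])
    fix i assume i: "i \<in> I"
    show "wang (tA i) (tB i) (tC i) w = (if tA i = w then \<alpha> else 0) + (if tB i = w then \<beta> else 0) + (if tC i = w then 2 * pi / 3 else 0) +
      (if w \<in> ?T i - ?J i - {tA i, tB i, tC i} then pi else 0) + (if w \<in> ?J i then 2 * pi else 0)"
      using angs[OF i] tile_neq[OF i] vertex_not_inside[of "tA i" "tB i" "tC i"] unfolding wang_def by auto
  qed
  also have "\<dots> = nA w * \<alpha> + nB w * \<beta> + nC w * (2 * pi / 3) + nE w * pi + nI w * (2 * pi)"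
    by (simp only: sum.distrib sum_indicator_card[OF fin] nA_def nB_def nC_def nE_def nI_def)
  finally show ?thesis by simp
qed

lemma irr_int:
  assumes "of_int m * \<alpha> = of_int n * (pi / 3)"
  shows "m = 0 \<and> n = 0"
proof -
  have "m = 0"
  proof (rule ccontr)
    assume "m \<noteq> 0"
    then have "\<alpha> = (of_int n / (3 * of_int m)) * pi" using assms by (simp add: field_simps)
    then show False using irr[of "of_int n / (3 * of_int m)"] by simp
  qed
  then show ?thesis using assms by simp
qed

text \<open>With \<beta> = \<pi>/3 - \<alpha> everything is an integer combination of \<alpha> and
  \<pi>/3, which are linearly independent over the integers.\<close>

lemma angle_count:
  fixes p q r h k n :: nat
  assumes "p * \<alpha> + q * \<beta> + r * (2 * pi / 3) + h * pi + k * (2 * pi) = n * (pi / 3)"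
  shows "p = q \<and> q + 2 * r + 3 * h + 6 * k = n"
proof -
  have \<beta>: "\<beta> = pi / 3 - \<alpha>" using ab_sum by simp
  have "of_int (int p - int q) * \<alpha> = of_int (int n - int q - 2 * int r - 3 * int h - 6 * int k) * (pi / 3)"
    using assms unfolding \<beta> by (simp add: algebra_simps)
  then show ?thesis using irr_int by fastforce
qed

lemma vertex_in_tri: "i \<in> I \<Longrightarrow> w \<in> {tA i, tB i, tC i} \<Longrightarrow> w \<in> tri X Y Z"
proof -
  assume i: "i \<in> I" "w \<in> {tA i, tB i, tC i}"
  then have "w \<in> tri (tA i) (tB i) (tC i)" using tri_hull[OF nondeg[OF i(1)]] hull_inc[of w] by auto
  then show ?thesis using tri_sub[OF i(1)] by blast
qed

text \<open>An \<alpha> and a \<beta> together make one unit \<pi>/3; a full turn offers 6 units and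
  a half turn 3.\<close>

lemma vertex_types:
  assumes "w \<notin> {X, Y, Z}"
  shows "nB w = nA w"
    and "w \<in> itri X Y Z \<Longrightarrow> nA w + 2 * nC w + 3 * nE w + 6 * nI w = 6"
    and "w \<in> tri X Y Z \<Longrightarrow> w \<notin> itri X Y Z \<Longrightarrow> nA w + 2 * nC w + 3 * nE w + 6 * nI w = 3"
    and "w \<notin> tri X Y Z \<Longrightarrow> nA w + 2 * nC w + 3 * nE w + 6 * nI w = 0"
proof -
  have sub: "itri X Y Z \<subseteq> tri X Y Z" by (rule itri_subset)
  define n :: nat where "n = (if w \<in> itri X Y Z then 6 else if w \<in> tri X Y Z then 3 else 0)"
  have "wang X Y Z w = n * (pi / 3)" using assms by (auto simp: wang_def n_def)
  then have "nA w * \<alpha> + nB w * \<beta> + nC w * (2 * pi / 3) + nE w * pi + nI w * (2 * pi) = n * (pi / 3)"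
    using vertex_equation[of w] by (simp only:)
  from angle_count[OF this] have *: "nA w = nB w \<and> nB w + 2 * nC w + 3 * nE w + 6 * nI w = n" .
  show "nB w = nA w" using * by simp
  show "w \<in> itri X Y Z \<Longrightarrow> nA w + 2 * nC w + 3 * nE w + 6 * nI w = 6"
    "w \<in> tri X Y Z \<Longrightarrow> w \<notin> itri X Y Z \<Longrightarrow> nA w + 2 * nC w + 3 * nE w + 6 * nI w = 3"
    "w \<notin> tri X Y Z \<Longrightarrow> nA w + 2 * nC w + 3 * nE w + 6 * nI w = 0"
    using * sub by (auto simp: n_def)
qed

text \<open>The corners share 3 units of \<pi>/3. An angle 2\<pi>/3 takes two of them and leaves one
  \<alpha> and one \<beta> for the other corners, which is the case excluded by
  \<open>ns\<close>.\<close>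

lemma corner_types:
  assumes ns: "\<not> {#cang Y X Z, cang X Y Z, cang X Z Y#} = {#\<alpha>, \<beta>, 2 * pi / 3#}"
  shows "nA X + nA Y + nA Z = 3 \<and> nB X + nB Y + nB Z = 3 \<and> nC X = 0 \<and> nC Y = 0 \<and> nC Z = 0 \<and>
    cang Y X Z = nA X * \<alpha> + nB X * \<beta> \<and> cang X Y Z = nA Y * \<alpha> + nB Y * \<beta> \<and> cang X Z Y = nA Z * \<alpha> + nB Z * \<beta>"
proof -
  have ne: "X \<noteq> Y" "Y \<noteq> Z" "X \<noteq> Z" using NONDEG by auto
  have w: "wang X Y Z X = cang Y X Z" "wang X Y Z Y = cang X Y Z" "wang X Y Z Z = cang X Z Y"
    using ne by (auto simp: wang_def)
  note eq = vertex_equation[of X, unfolded w] vertex_equation[of Y, unfolded w] vertex_equation[of Z, unfolded w]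
  have "(nA X + nA Y + nA Z) * \<alpha> + (nB X + nB Y + nB Z) * \<beta> + (nC X + nC Y + nC Z) * (2 * pi / 3) +
    (nE X + nE Y + nE Z) * pi + (nI X + nI Y + nI Z) * (2 * pi) = (3::nat) * (pi / 3)"
    using eq triangle_angle_sum[OF NONDEG] by (simp add: algebra_simps)
  from angle_count[OF this] have t: "nA X + nA Y + nA Z = nB X + nB Y + nB Z"
    "nB X + nB Y + nB Z + 2 * (nC X + nC Y + nC Z) + 3 * (nE X + nE Y + nE Z) + 6 * (nI X + nI Y + nI Z) = 3" by auto
  have pos: "0 < cang Y X Z" "0 < cang X Y Z" "0 < cang X Z Y"
    using cang_bounds[of X Y Z] cang_bounds[of Y X Z] cang_bounds[of Z X Y] NONDEG cr_swap[of X Y Z] cr_rotate[of X Y Z] by auto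
  have I0: "nI X = 0" "nI Y = 0" "nI Z = 0" using t by auto
  have nz: "nA X + nB X + nC X + nE X > 0" "nA Y + nB Y + nC Y + nE Y > 0" "nA Z + nB Z + nC Z + nE Z > 0"
    using eq pos I0 by (auto intro: ccontr)
  \<comment> \<open>A straight angle at one corner would use up all 3 units and leave the other
    corners empty.\<close>
  have E0: "nE X = 0" "nE Y = 0" "nE Z = 0" using t nz by auto
  have "nC X + nC Y + nC Z \<noteq> 1"
  proof
    assume C1: "nC X + nC Y + nC Z = 1"
    then have s: "nA X + nA Y + nA Z = 1" "nB X + nB Y + nB Z = 1" using t E0 I0 by auto
    have one: "x = 1 \<and> y = 0 \<and> z = 0 \<or> x = 0 \<and> y = 1 \<and> z = 0 \<or> x = 0 \<and> y = 0 \<and> z = 1" if "x + y + z = 1" for x y z :: nat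
      using that by presburger
    have "{#cang Y X Z, cang X Y Z, cang X Z Y#} = {#\<alpha>, \<beta>, 2 * pi / 3#}"
      using one[OF s(1)] one[OF s(2)] one[OF C1] nz eq E0 I0 by (elim disjE conjE) (simp_all add: add_mset_commute)
    then show False using ns by blast
  qed
  moreover have "nC X + nC Y + nC Z \<le> 1"
  proof -
    have "x \<le> 1" if "2 * x \<le> 3" for x :: nat using that by presburger
    moreover have "2 * (nC X + nC Y + nC Z) \<le> 3" using t(2) by linarith
    ultimately show ?thesis by blast
  qed
  ultimately have "nC X + nC Y + nC Z = 0" by linarith
  then have C0: "nC X = 0" "nC Y = 0" "nC Z = 0" by auto
  show ?thesis using t unfolding eq[symmetric] E0 I0 C0 by simp
qed

section \<open>Stars against points with three pairs of small angles\<close>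

definition stars :: "complex set" where
  "stars = {w. w \<notin> {X, Y, Z} \<and> nA w = 0 \<and> nC w = 3}"

text \<open>Named after the pair (\<open>nA\<close>, \<open>nC\<close>); \<open>vertex_types\<close>
  adds \<open>nB w = 3\<close>.\<close>

definition t30 :: "complex set" where
  "t30 = {w. w \<notin> {X, Y, Z} \<and> nA w = 3 \<and> nC w = 0}"

lemma count_pos_VV: "nA w > 0 \<or> nB w > 0 \<or> nC w > 0 \<Longrightarrow> w \<in> VV"
  unfolding nA_def nB_def nC_def VV_def cells_def card_gt_0_iff by auto

lemma finite_stars: "finite stars" "finite t30"
  by (rule finite_subset[OF _ finite_VV], use count_pos_VV in \<open>force simp: stars_def t30_def\<close>)+

text \<open>Each tile has one angle of each kind, so nA + nB - 2 nC sums to 0 over all vertices. The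
  corners contribute 6, so the rest contributes -6; only stars are negative, with -6 each, while
  points of \<open>t30\<close> give 6 each.\<close>

lemma star_count:
  assumes c: "nA X + nA Y + nA Z = 3" "nB X + nB Y + nB Z = 3" "nC X = 0" "nC Y = 0" "nC Z = 0"
  shows "card t30 < card stars"
proof -
  have ne: "X \<noteq> Y" "Y \<noteq> Z" "X \<noteq> Z" using NONDEG by auto
  have sub: "tA ` I \<subseteq> VV" "tB ` I \<subseteq> VV" "tC ` I \<subseteq> VV" by (auto simp: VV_def cells_def)
  have XV: "{X, Y, Z} \<subseteq> VV" by (auto simp: VV_def cells_def)
  define f where "f w = int (nA w) + int (nB w) - 2 * int (nC w)" for w
  have "(\<Sum>w\<in>VV. f w) = int (\<Sum>w\<in>VV. nA w) + int (\<Sum>w\<in>VV. nB w) - 2 * int (\<Sum>w\<in>VV. nC w)"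
    by (simp add: f_def sum.distrib sum_subtractf sum_distrib_left)
  also have "\<dots> = 0"
    using sum_card_fibres[OF fin finite_VV] sub by (simp add: nA_def nB_def nC_def)
  finally have 0: "(\<Sum>w\<in>VV. f w) = 0" .
  have "(\<Sum>w\<in>VV. f w) = (\<Sum>w\<in>VV - {X, Y, Z}. f w) + (\<Sum>w\<in>{X, Y, Z}. f w)"
    using finite_VV XV by (intro sum.subset_diff) auto
  moreover have "(\<Sum>w\<in>{X, Y, Z}. f w) = 6" using ne c by (simp add: f_def)
  moreover have "(\<Sum>w\<in>VV - {X, Y, Z}. f w) \<ge> (\<Sum>w\<in>VV - {X, Y, Z}. 6 * (if w \<in> t30 then 1 else 0) - 6 * (if w \<in> stars then 1 else 0))"
  proof (rule sum_mono)
    fix w assume "w \<in> VV - {X, Y, Z}"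
    then have w: "w \<notin> {X, Y, Z}" by simp
    have B: "nB w = nA w" using vertex_types(1)[OF w] .
    have "nA w + 2 * nC w + 3 * nE w + 6 * nI w = 0 \<or> nA w + 2 * nC w + 3 * nE w + 6 * nI w = 3 \<or>
      nA w + 2 * nC w + 3 * nE w + 6 * nI w = 6" using vertex_types(2-4)[OF w] by blast
    then have s: "nA w + 2 * nC w = 0 \<or> nA w + 2 * nC w = 3 \<or> nA w + 2 * nC w = 6" by presburger
    \<comment> \<open>As nB = nA, the weight is 2 nA - 2 nC: for nA + 2 nC = 6 it is 12, 6, 0, -6
      when nC = 0, 1, 2, 3, and for nA + 2 nC = 3 it is 6, 0 when nC = 0, 1.\<close>
    then consider "nC w = 0" | "nC w = 1" | "nC w = 2" | "nC w = 3" by linarith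
    then show "6 * (if w \<in> t30 then 1 else 0) - 6 * (if w \<in> stars then 1 else 0) \<le> f w"
      using s B w by cases (auto simp: t30_def stars_def f_def)
  qed
  moreover have "(\<Sum>w\<in>VV - {X, Y, Z}. 6 * (if w \<in> t30 then 1 else 0) - 6 * (if w \<in> stars then 1 else 0)) = 6 * int (card t30) - 6 * int (card stars)"
  proof -
    have s: "t30 \<subseteq> VV - {X, Y, Z}" "stars \<subseteq> VV - {X, Y, Z}"
      using count_pos_VV by (force simp: stars_def t30_def)+
    have g: "(\<Sum>w\<in>VV - {X, Y, Z}. (if w \<in> S then 1 else 0)) = int (card S)" if "S \<subseteq> VV - {X, Y, Z}" for S
    proof -
      have "(\<Sum>w\<in>VV - {X, Y, Z}. (if w \<in> S then 1 else 0 :: int)) = (\<Sum>w\<in>(VV - {X, Y, Z}) \<inter> S. 1)"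
        using finite_VV by (subst sum.inter_restrict) auto
      also have "(VV - {X, Y, Z}) \<inter> S = S" using that by blast
      finally show ?thesis by simp
    qed
    show ?thesis using g[OF s(1)] g[OF s(2)] by (simp only: sum_subtractf sum_distrib_left[symmetric])
  qed
  ultimately show ?thesis using 0 by linarith
qed

end

section \<open>Runs of edges of equal length\<close>

lemma ded_third: "cr A B C \<noteq> 0 \<Longrightarrow> (x, y) \<in> ded A B C \<Longrightarrow> \<exists>z\<in>{A, B, C}. cr x y z > 0"
proof -
  assume a: "cr A B C \<noteq> 0" "(x, y) \<in> ded A B C"
  show ?thesis
  proof (cases "cr A B C > 0")
    case True
    then have "cr B C A > 0" "cr C A B > 0" using cr_rotate[of A B C] by simp_all
    then show ?thesis using a True by (auto simp: ded_def)
  next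
    case False
    then have "cr B A C > 0" using a(1) cr_swap(1)[of B A C] by linarith
    moreover from this have "cr A C B > 0" "cr C B A > 0" using cr_rotate[of B A C] by simp_all
    ultimately show ?thesis using a False by (auto simp: ded_def)
  qed
qed

lemma cr_lin_dir:
  assumes "x \<noteq> y" "sgn (y - x) = u" "x \<in> lin v u"
  shows "cr x y z = norm (y - x) * Im (cnj u * (z - v))"
proof -
  obtain t where t: "x = v + of_real t * u" using assms by (auto simp: lin_def)
  define n where "n = norm (y - x)"
  have y: "y - x = of_real n * u" using endpoint_sgn[of y x] assms(2) by (simp add: n_def algebra_simps)
  have "cr x y z = Im (cnj (of_real n * u) * (z - x))" by (simp add: cr_def y)
  also have "\<dots> = n * Im (cnj u * (z - v))" unfolding t by (simp add: algebra_simps)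
  finally show ?thesis by (simp add: n_def)
qed

lemma cov_lin: "cov w u x y \<Longrightarrow> w \<in> lin v u \<Longrightarrow> x \<in> lin v u \<and> y \<in> lin v u"
proof -
  assume c: "cov w u x y" and w: "w \<in> lin v u"
  obtain s where s: "w = v + of_real s * u" using w by (auto simp: lin_def)
  have su: "sgn (y - x) = u" using c by (simp add: cov_def)
  obtain t where t: "w = x + of_real t * u" using c unfolding cov_def oseg_iff by (metis add.right_neutral mult_zero_left of_real_0)
  have x: "x = v + of_real (s - t) * u" using s t by (simp add: algebra_simps)
  define m where "m = norm (y - x)"
  have "y = x + of_real m * u" using endpoint_sgn[of y x] su by (simp add: m_def)
  then have "y = v + of_real (s - t + m) * u" using x by (simp add: algebra_simps)
  then show ?thesis using x unfolding lin_def by blast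
qed

lemma sgn_real_mult: "0 < r \<Longrightarrow> norm u = 1 \<Longrightarrow> sgn (of_real r * u) = u" for u :: complex
  by (simp add: sgn_eq norm_mult)

context tile_tiling
begin

text \<open>The tile edges bounding a tile to the left (\<open>FF True\<close>) or to the right (\<open>FF False\<close>).\<close>

definition FF :: "bool \<Rightarrow> ('i \<times> complex \<times> complex) set" where
  "FF s = {(i, x, y). if s then (Some i, x, y) \<in> EE else (Some i, y, x) \<in> EE}"

definition isA :: "'i \<Rightarrow> complex \<Rightarrow> complex \<Rightarrow> bool" where
  "isA i x y \<longleftrightarrow> {x, y} = {tB i, tC i}"

lemma FF_rev: "(i, x, y) \<in> FF s \<longleftrightarrow> (i, y, x) \<in> FF (\<not> s)"
  by (auto simp: FF_def)

lemma isA_rev: "isA i x y \<longleftrightarrow> isA i y x"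
  by (auto simp: isA_def)

lemma FF_D:
  assumes "(i, x, y) \<in> FF s"
  shows "i \<in> I" "x \<noteq> y" "x \<in> {tA i, tB i, tC i}" "y \<in> {tA i, tB i, tC i}" "x \<in> VV" "y \<in> VV"
proof -
  have e: "(Some i, x, y) \<in> EE \<or> (Some i, y, x) \<in> EE" using assms by (auto simp: FF_def split: if_splits)
  then show "i \<in> I" by (auto simp: EE_def cells_def)
  show "x \<noteq> y" using e EE_neq by metis
  show "x \<in> {tA i, tB i, tC i}" "y \<in> {tA i, tB i, tC i}" using e ed_verts[of _ _ "Some i"] by (auto simp: EE_def)
  show "x \<in> VV" "y \<in> VV" using e EE_VV by blast+
qed

lemma FF_len:
  assumes "(i, x, y) \<in> FF s"
  shows "isA i x y \<Longrightarrow> norm (y - x) = a" "\<not> isA i x y \<Longrightarrow> norm (y - x) = b \<or> norm (y - x) = c"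
proof -
  note d = FF_D[OF assms]
  show "isA i x y \<Longrightarrow> norm (y - x) = a"
    using lens[OF d(1)] by (auto simp: isA_def doubleton_eq_iff norm_minus_commute)
  show "\<not> isA i x y \<Longrightarrow> norm (y - x) = b \<or> norm (y - x) = c"
    using lens[OF d(1)] d(2-4) by (auto simp: isA_def norm_minus_commute)
qed

lemma FF_unique:
  assumes "(i, x, y) \<in> FF s" "cov v u x y" "(j, x', y') \<in> FF s" "cov v u x' y'"
  shows "i = j \<and> x = x' \<and> y = y'"
  using assms germ_unique[of "Some i" x y v u "Some j" x' y'] germ_unique_rev[of "Some i" y x v u "Some j" y' x']
  by (cases s) (auto simp: FF_def)

text \<open>\<open>germ_iff\<close> for tiles alone: the edge facing a tile edge belongs to a tile
  as long as the outer cell has no edge there.\<close>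

lemma FF_exchange:
  assumes "(i, x, y) \<in> FF s" "cov v u x y" "\<And>x' y'. (None, x', y') \<in> EE \<Longrightarrow> \<not> cov v u x' y' \<and> \<not> cov v u y' x'"
  shows "\<exists>j x' y'. (j, x', y') \<in> FF (\<not> s) \<and> cov v u x' y'"
proof (cases s)
  case True
  then have "\<exists>(j, x, y)\<in>EE. cov v u x y" using assms by (auto simp: FF_def)
  then obtain j x' y' where e: "(j, x', y') \<in> EE" "cov v u y' x'" using germ_iff[of v u] by blast
  then show ?thesis using assms(3) True by (cases j) (auto simp: FF_def)
next
  case False
  then have "\<exists>(j, x, y)\<in>EE. cov v u y x" using assms by (auto simp: FF_def)
  then obtain j x' y' where e: "(j, x', y') \<in> EE" "cov v u x' y'" using germ_iff[of v u] by blast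
  then show ?thesis using assms(3) False by (cases j) (auto simp: FF_def)
qed

lemma FF_side:
  assumes "(i, x, y) \<in> FF s" "sgn (y - x) = u" "x \<in> lin v u"
  shows "\<exists>z\<in>tri X Y Z. if s then Im (cnj u * (z - v)) > 0 else Im (cnj u * (z - v)) < 0"
proof -
  note d = FF_D[OF assms(1)]
  have *: "\<exists>z\<in>tri X Y Z. cr x y z > 0" if "(Some i, x, y) \<in> EE" for x y
    using ded_third[OF nondeg[OF d(1)], of x y] that vertex_in_tri[OF d(1)] unfolding EE_def by auto
  have k: "cr x y z = norm (y - x) * Im (cnj u * (z - v))" for z
    using cr_lin_dir assms d(2) by blast
  have n: "norm (y - x) > 0" using d(2) by simp
  show ?thesis
  proof (cases s)
    case True
    then have "(Some i, x, y) \<in> EE" using assms(1) by (auto simp: FF_def)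
    then show ?thesis using *[of x y] k n True by (auto simp: zero_less_mult_iff)
  next
    case False
    then have "(Some i, y, x) \<in> EE" using assms(1) by (auto simp: FF_def)
    then obtain z where "z \<in> tri X Y Z" "cr y x z > 0" using * by blast
    then have "norm (y - x) * Im (cnj u * (z - v)) < 0" using k[of z] cr_swap(1)[of x y z] by simp
    then show ?thesis using \<open>z \<in> tri X Y Z\<close> False n by (auto simp: mult_less_0_iff)
  qed
qed

text \<open>Tiles on both sides of the line put points of the big triangle strictly on both sides,
  whereas the big triangle lies on one side of each of its own edges. So the outer cell never
  interferes along the line of a run.\<close>

lemma no_boundary_line:
  assumes "(i, x, y) \<in> FF s" "sgn (y - x) = u" "x \<in> lin v u" "(j, x', y') \<in> FF (\<not> s)" "sgn (y' - x') = u" "x' \<in> lin v u"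
    and N: "(None, p, q) \<in> EE" and w: "w \<in> lin v u"
  shows "\<not> cov w u p q \<and> \<not> cov w u q p"
proof -
  obtain z z' where z: "z \<in> tri X Y Z" "z' \<in> tri X Y Z" "Im (cnj u * (z - v)) * Im (cnj u * (z' - v)) < 0"
  proof -
    obtain z z' where h: "z \<in> tri X Y Z" "z' \<in> tri X Y Z"
      "if s then Im (cnj u * (z - v)) > 0 else Im (cnj u * (z - v)) < 0"
      "if \<not> s then Im (cnj u * (z' - v)) > 0 else Im (cnj u * (z' - v)) < 0"
      using FF_side[OF assms(1-3)] FF_side[OF assms(4-6)] by blast
    show thesis
    proof (cases s)
      case True
      then have "Im (cnj u * (z - v)) > 0" "Im (cnj u * (z' - v)) < 0" using h(3,4) by (simp_all only: if_True if_False not_True_eq_False)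
      then have "Im (cnj u * (z - v)) * Im (cnj u * (z' - v)) < 0" by (rule mult_pos_neg)
      then show ?thesis by (rule that[OF h(1,2)])
    next
      case False
      then have "Im (cnj u * (z - v)) < 0" "Im (cnj u * (z' - v)) > 0" using h(3,4) by (simp_all only: if_True if_False not_False_eq_True)
      then have "Im (cnj u * (z - v)) * Im (cnj u * (z' - v)) < 0" by (rule mult_neg_pos)
      then show ?thesis by (rule that[OF h(1,2)])
    qed
  qed
  have "(q, p) \<in> ded X Y Z" using N by (auto simp: EE_def)
  then have nn: "cr q p z \<ge> 0" "cr q p z' \<ge> 0" using z by (auto simp: tri_def)
  have ne: "p \<noteq> q" using EE_neq[OF N] .
  have prod: "cr q p z * cr q p z' < 0" if k: "\<And>z. cr q p z = k * Im (cnj u * (z - v))" "k \<noteq> 0" for k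
  proof -
    have "cr q p z * cr q p z' = (k * k) * (Im (cnj u * (z - v)) * Im (cnj u * (z' - v)))" unfolding k(1) by (simp only: ac_simps)
    moreover have "k * k > 0" using k(2) by (metis not_real_square_gt_zero)
    ultimately show ?thesis using z(3) by (simp only: mult_pos_neg)
  qed
  have "\<not> cov w u q p"
  proof
    assume c: "cov w u q p"
    have k: "cr q p z = norm (p - q) * Im (cnj u * (z - v))" for z
      using cr_lin_dir[of q p u v z] cov_lin[OF c w] c by (auto simp: cov_def)
    have "cr q p z * cr q p z' < 0" by (rule prod[OF k]) (use ne in simp)
    then show False using mult_nonneg_nonneg[OF nn] by linarith
  qed
  moreover have "\<not> cov w u p q"
  proof
    assume c: "cov w u p q"
    have k: "cr q p z = - norm (q - p) * Im (cnj u * (z - v))" for z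
      using cr_lin_dir[of p q u v z] cov_lin[OF c w] c cr_swap(1)[of q p z] by (auto simp: cov_def)
    have "cr q p z * cr q p z' < 0" by (rule prod[OF k]) (use ne in simp)
    then show False using mult_nonneg_nonneg[OF nn] by linarith
  qed
  ultimately show ?thesis by blast
qed

text \<open>Otherwise the two edges would overlap just before \<open>y\<close> on the same side,
  against \<open>FF_unique\<close>. So the edges on one side of a line follow each other end to
  start.\<close>

lemma FF_end_start:
  assumes "(i, x, y) \<in> FF s" "sgn (y - x) = u" "(j, x', y') \<in> FF s" "cov y u x' y'"
  shows "x' = y"
proof (rule ccontr)
  assume "x' \<noteq> y"
  then have o: "y \<in> open_segment x' y'" and su': "sgn (y' - x') = u" using assms(4) by (auto simp: cov_def)
  have xy: "x \<noteq> y" using FF_D(2)[OF assms(1)] .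
  obtain t where t: "0 < t" "t < norm (y' - x')" "y = x' + of_real t * u" using o su' by (auto simp: oseg_iff)
  define n where "n = norm (y - x)"
  have n: "n > 0" using xy by (simp add: n_def)
  have y: "y = x + of_real n * u" using endpoint_sgn[of y x] assms(2) by (simp add: n_def)
  define e where "e = min t n / 2"
  have e: "0 < e" "e < t" "e < n" using t n by (auto simp: e_def)
  define w where "w = y - of_real e * u"
  have "w = x + of_real (n - e) * u" using y by (simp add: w_def algebra_simps)
  then have 1: "cov w u x y" unfolding cov_def oseg_iff assms(2) n_def[symmetric] using e xy by (auto intro!: exI[of _ "n - e"])
  have "w = x' + of_real (t - e) * u" using t(3) by (simp add: w_def algebra_simps)
  then have 2: "cov w u x' y'" unfolding cov_def oseg_iff su' using e t o by (auto intro!: exI[of _ "t - e"])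
  have "y = y'" using FF_unique[OF assms(1) 1 assms(3) 2] by simp
  then show False using o by (auto simp: open_segment_def)
qed

lemma a_pos: "I \<noteq> {} \<Longrightarrow> a > 0 \<and> b > 0 \<and> c > 0"
proof -
  assume "I \<noteq> {}"
  then obtain i where i: "i \<in> I" by blast
  have "norm (tC i - tB i) > 0" "norm (tC i - tA i) > 0" "norm (tB i - tA i) > 0" using tile_neq[OF i] by auto
  then show ?thesis unfolding lens[OF i] by blast
qed

text \<open>Starting points of runs, with direction \<open>u\<close> and the side \<open>s\<close> of the line on which the edge of length \<open>a\<close> lies.\<close>

definition Rec :: "(complex \<times> complex \<times> bool) set" where
  "Rec = {(v, u, s). \<exists>i x j y. (i, v, x) \<in> FF s \<and> isA i v x \<and> sgn (x - v) = u \<and>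
     (j, v, y) \<in> FF (\<not> s) \<and> \<not> isA j v y \<and> sgn (y - v) = u}"

definition good_run :: "complex \<Rightarrow> complex \<Rightarrow> bool \<Rightarrow> nat \<Rightarrow> bool" where
  "good_run v u s n \<longleftrightarrow> (\<forall>k<n. \<exists>i. (i, v + of_real (real k * a) * u, v + of_real (real (Suc k) * a) * u) \<in> FF s \<and>
      isA i (v + of_real (real k * a) * u) (v + of_real (real (Suc k) * a) * u))"

lemma Rec_exchange:
  assumes "(v, u, s) \<in> Rec" "(i, x, y) \<in> FF r" "cov w u x y" "w \<in> lin v u"
  shows "\<exists>j x' y'. (j, x', y') \<in> FF (\<not> r) \<and> cov w u x' y'"
proof -
  obtain i' x' j' y' where e: "(i', v, x') \<in> FF s" "sgn (x' - v) = u" "(j', v, y') \<in> FF (\<not> s)" "sgn (y' - v) = u"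
    using assms(1) unfolding Rec_def by blast
  have "v \<in> lin v u" by (auto simp: lin_def intro: exI[of _ 0])
  then show ?thesis using FF_exchange[OF assms(2,3)] no_boundary_line[OF e(1,2) _ e(3,4) _ _ assms(4)] by blast
qed

lemma Rec_norm: "(v, u, s) \<in> Rec \<Longrightarrow> norm u = 1"
  unfolding Rec_def by (auto simp: norm_sgn dest: FF_D(2))

lemma in_lin [simp]: "v + of_real t * u \<in> lin v u"
  by (auto simp: lin_def)

lemma run_cover:
  assumes "good_run v u s n" "norm u = 1" "0 \<le> t" "t < real n * a" "a > 0"
  shows "\<exists>i x y. (i, x, y) \<in> FF s \<and> cov (v + of_real t * u) u x y"
proof -
  define k where "k = nat \<lfloor>t / a\<rfloor>"
  have fl: "real k \<le> t / a" "t / a < real k + 1" using assms by (auto simp: k_def)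
  then have k: "real k * a \<le> t" "t < real (Suc k) * a" using assms(5) by (auto simp: field_simps)
  have "k < n"
  proof -
    have "real k * a < real n * a" using k(1) assms(4) by linarith
    then show ?thesis using assms(5) by simp
  qed
  define x where "x = v + of_real (real k * a) * u"
  define y where "y = v + of_real (real (Suc k) * a) * u"
  obtain i where i: "(i, x, y) \<in> FF s" using assms(1) \<open>k < n\<close> unfolding good_run_def x_def y_def by blast
  have yx: "y - x = of_real a * u" by (simp add: x_def y_def algebra_simps)
  have su: "sgn (y - x) = u" unfolding yx using assms(2,5) by (intro sgn_real_mult)
  have n: "norm (y - x) = a" unfolding yx using assms(2,5) by (simp add: norm_mult)
  have "cov (v + of_real t * u) u x y"
  proof (cases "t = real k * a")
    case True
    then show ?thesis using FF_D(2)[OF i] su by (simp add: cov_def x_def)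
  next
    case False
    have "v + of_real t * u = x + of_real (t - real k * a) * u" by (simp add: x_def algebra_simps)
    moreover have "0 < t - real k * a" "t - real k * a < a" using k False by (auto simp: algebra_simps)
    ultimately show ?thesis unfolding cov_def oseg_iff su n using FF_D(2)[OF i] by blast
  qed
  then show ?thesis using i by blast
qed

text \<open>Walk from \<open>v\<close> along the other side of the run. The edges there follow each
  other end to start; either one of them contains the point at distance \<open>\<tau>\<close> in its
  interior, or one ends exactly there and \<open>\<tau>\<close> is a sum of side lengths. The first
  of them is not an a-edge, whence j + k > 0.\<close>

lemma other_side:
  assumes R: "(v, u, s) \<in> Rec" and g: "good_run v u s n" and \<tau>: "0 < \<tau>" "\<tau> \<le> real n * a" and a0: "a > 0" "b > 0" "c > 0"
  shows "(\<exists>i j k :: nat. \<tau> = real i * a + real j * b + real k * c \<and> j + k > 0) \<or>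
    (\<exists>j x y. (j, x, y) \<in> FF (\<not> s) \<and> sgn (y - x) = u \<and> v + of_real \<tau> * u \<in> open_segment x y)"
proof (rule disjCI)
  assume np: "\<not> (\<exists>j x y. (j, x, y) \<in> FF (\<not> s) \<and> sgn (y - x) = u \<and> v + of_real \<tau> * u \<in> open_segment x y)"
  have nu: "norm u = 1" using Rec_norm[OF R] .
  have u0: "u \<noteq> 0" using nu by auto
  \<comment> \<open>Ends of edges on the other side, up to \<open>\<tau>\<close>, whose distance
    from \<open>v\<close> is such a sum. If the largest of them fell short of \<open>\<tau>\<close>,
    the run would still cover it, and the edge facing the run there would lead to a larger
    one.\<close>
  define T where "T = {t. 0 < t \<and> t \<le> \<tau> \<and> (\<exists>j x. (j, x, v + of_real t * u) \<in> FF (\<not> s) \<and> sgn (v + of_real t * u - x) = u) \<and>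
    (\<exists>i j k :: nat. t = real i * a + real j * b + real k * c \<and> j + k > 0)}"
  have "(\<lambda>t. v + of_real t * u) ` T \<subseteq> VV" unfolding T_def using FF_D(6) by blast
  moreover have "inj_on (\<lambda>t. v + of_real t * u) T" using u0 by (auto simp: inj_on_def)
  ultimately have finT: "finite T" using finite_VV finite_imageD finite_subset by blast
  have step: "\<exists>t'>t. t' \<in> T" if t: "0 \<le> t" "t < \<tau>"
    and e: "(j, v + of_real t * u, y) \<in> FF (\<not> s)" "sgn (y - (v + of_real t * u)) = u"
    and len: "\<exists>i j k :: nat. t + norm (y - (v + of_real t * u)) = real i * a + real j * b + real k * c \<and> j + k > 0" for t j y
  proof -
    define l where "l = norm (y - (v + of_real t * u))"
    have l: "l > 0" using FF_D(2)[OF e(1)] by (simp add: l_def)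
    have y: "y = v + of_real (t + l) * u" using endpoint_sgn[of y "v + of_real t * u"] e(2) by (simp add: l_def algebra_simps)
    have "t + l \<le> \<tau>"
    proof (rule ccontr)
      assume "\<not> t + l \<le> \<tau>"
      then have "v + of_real \<tau> * u \<in> open_segment (v + of_real t * u) y"
        unfolding oseg_iff e(2) l_def[symmetric] using t by (intro exI[of _ "\<tau> - t"]) (auto simp: algebra_simps)
      then show False using np e by blast
    qed
    have m1: "(j, v + of_real t * u, v + of_real (t + l) * u) \<in> FF (\<not> s)" using e(1) unfolding y .
    have m2: "sgn (v + of_real (t + l) * u - (v + of_real t * u)) = u" using e(2) unfolding y .
    have m3: "\<exists>i j k :: nat. t + l = real i * a + real j * b + real k * c \<and> j + k > 0" using len unfolding l_def .
    have m4: "0 < t + l" using l t by simp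
    have "t + l \<in> T" unfolding T_def using m1 m2 m3 m4 \<open>t + l \<le> \<tau>\<close> by blast
    then show ?thesis using l by (intro exI[of _ "t + l"]) auto
  qed
  obtain j0 y0 where e0: "(j0, v, y0) \<in> FF (\<not> s)" "\<not> isA j0 v y0" "sgn (y0 - v) = u" using R unfolding Rec_def by blast
  have "\<exists>i j k :: nat. norm (y0 - v) = real i * a + real j * b + real k * c \<and> j + k > 0"
    using FF_len(2)[OF e0(1,2)] by (elim disjE) (rule exI[of _ 0], rule exI[of _ 1], rule exI[of _ 0], simp,
      rule exI[of _ 0], rule exI[of _ 0], rule exI[of _ 1], simp)
  then have "T \<noteq> {}" using step[of 0 j0 y0] e0 \<tau>(1) by auto
  define t where "t = Max T"
  have tT: "t \<in> T" and tmax: "\<And>t'. t' \<in> T \<Longrightarrow> t' \<le> t" using finT \<open>T \<noteq> {}\<close> by (auto simp: t_def)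
  have t: "0 < t" "t \<le> \<tau>" using tT by (auto simp: T_def)
  obtain j x where jx: "(j, x, v + of_real t * u) \<in> FF (\<not> s)" "sgn (v + of_real t * u - x) = u" using tT by (auto simp: T_def)
  obtain ti tj tk :: nat where rel: "t = real ti * a + real tj * b + real tk * c" "tj + tk > 0" using tT by (auto simp: T_def)
  have "t = \<tau>"
  proof (rule ccontr)
    assume "t \<noteq> \<tau>"
    then have lt: "t < \<tau>" using t by simp
    then obtain i x1 y1 where c1: "(i, x1, y1) \<in> FF s" "cov (v + of_real t * u) u x1 y1"
      using run_cover[OF g nu, of t] t \<tau> a0 by auto
    obtain j' x' y' where c2: "(j', x', y') \<in> FF (\<not> s)" "cov (v + of_real t * u) u x' y'"
      using Rec_exchange[OF R c1 in_lin] by blast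
    have x': "x' = v + of_real t * u" using FF_end_start[OF jx c2] .
    have su: "sgn (y' - x') = u" using c2 by (simp add: cov_def)
    have "norm (y' - x') = a \<or> norm (y' - x') = b \<or> norm (y' - x') = c" using FF_len[OF c2(1)] by blast
    then have "\<exists>i j k :: nat. t + norm (y' - x') = real i * a + real j * b + real k * c \<and> j + k > 0"
    proof (elim disjE)
      assume "norm (y' - x') = a"
      then show ?thesis using rel by (intro exI[of _ "Suc ti"] exI[of _ tj] exI[of _ tk]) (auto simp: algebra_simps)
    next
      assume "norm (y' - x') = b"
      then show ?thesis using rel by (intro exI[of _ ti] exI[of _ "Suc tj"] exI[of _ tk]) (auto simp: algebra_simps)
    next
      assume "norm (y' - x') = c"
      then show ?thesis using rel by (intro exI[of _ ti] exI[of _ tj] exI[of _ "Suc tk"]) (auto simp: algebra_simps)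
    qed
    then obtain t' where "t' > t" "t' \<in> T" using step[of t j' y'] c2(1) su t(1) lt unfolding x' by auto
    then show False using tmax by fastforce
  qed
  then show "\<exists>i j k :: nat. \<tau> = real i * a + real j * b + real k * c \<and> j + k > 0" using rel by blast
qed

text \<open>End points of runs in the interior of an edge on the other side.\<close>

definition turn_at :: "complex \<Rightarrow> complex \<Rightarrow> bool \<Rightarrow> bool" where
  "turn_at w u s \<longleftrightarrow> (\<exists>i x. (i, x, w) \<in> FF s \<and> isA i x w \<and> sgn (w - x) = u) \<and>
     (\<exists>j y. (j, w, y) \<in> FF s \<and> \<not> isA j w y \<and> sgn (y - w) = u) \<and>
     (\<exists>k z z'. (k, z, z') \<in> FF (\<not> s) \<and> sgn (z' - z) = u \<and> w \<in> open_segment z z')"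

text \<open>Take the longest run; the finitely many vertices bound its length. By
  \<open>other_side\<close> and \<open>norel\<close> its end lies inside an edge of the other side.
  Facing that edge the side of the run goes on, with an edge that starts at the end point and by
  maximality is not an a-edge.\<close>

lemma run_end:
  assumes R: "(v, u, s) \<in> Rec"
    and norel: "\<And>m i j k :: nat. real m * a = real i * a + real j * b + real k * c \<Longrightarrow> j = 0 \<and> k = 0"
  shows "\<exists>n. good_run v u s n \<and> turn_at (v + of_real (real n * a) * u) u s"
proof -
  have nu: "norm u = 1" using Rec_norm[OF R] .
  have u0: "u \<noteq> 0" using nu by auto
  obtain i0 x0 where e0: "(i0, v, x0) \<in> FF s" "isA i0 v x0" "sgn (x0 - v) = u" using R unfolding Rec_def by blast
  have pos: "a > 0" "b > 0" "c > 0" using a_pos FF_D(1)[OF e0(1)] by blast+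
  have x0: "x0 = v + of_real a * u" using endpoint_sgn[of x0 v] e0(3) FF_len(1)[OF e0(1,2)] by simp
  have g1: "good_run v u s 1" unfolding good_run_def using e0 x0 by auto
  have bound: "n \<le> card VV" if "good_run v u s n" for n
  proof -
    have "(\<lambda>k. v + of_real (real k * a) * u) ` {..<n} \<subseteq> VV"
      using that FF_D(5) unfolding good_run_def by blast
    moreover have "inj_on (\<lambda>k. v + of_real (real k * a) * u) {..<n}" using u0 pos by (auto simp: inj_on_def)
    ultimately have "card {..<n} \<le> card VV" using card_inj_on_le finite_VV by blast
    then show ?thesis by simp
  qed
  define n where "n = (GREATEST n. good_run v u s n)"
  have gn: "good_run v u s n" unfolding n_def using GreatestI_nat[of "good_run v u s" 1 "card VV"] g1 bound by blast
  have nmax: "m \<le> n" if "good_run v u s m" for m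
    unfolding n_def using Greatest_le_nat[of "good_run v u s" m "card VV"] that bound by blast
  have n1: "n \<ge> 1" using nmax[OF g1] .
  define w where "w = v + of_real (real n * a) * u"
  have "(\<exists>j x y. (j, x, y) \<in> FF (\<not> s) \<and> sgn (y - x) = u \<and> w \<in> open_segment x y)"
    using other_side[OF R gn, of "real n * a"] n1 pos norel unfolding w_def by fastforce
  then obtain k z z' where P: "(k, z, z') \<in> FF (\<not> s)" "sgn (z' - z) = u" "w \<in> open_segment z z'" by blast
  obtain i where i: "(i, v + of_real (real (n - 1) * a) * u, w) \<in> FF s" "isA i (v + of_real (real (n - 1) * a) * u) w"
  proof -
    have "Suc (n - 1) = n" using n1 by simp
    then show thesis using gn that n1 unfolding good_run_def w_def by (metis lessI)
  qed
  have si: "sgn (w - (v + of_real (real (n - 1) * a) * u)) = u"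
  proof -
    have "w - (v + of_real (real (n - 1) * a) * u) = of_real a * u" using n1 by (simp add: w_def of_nat_diff algebra_simps)
    then show ?thesis using sgn_real_mult[OF pos(1) nu] by (simp only:)
  qed
  have "cov w u z z'" using P by (auto simp: cov_def)
  then obtain j x y where c: "(j, x, y) \<in> FF s" "cov w u x y" 
    using Rec_exchange[OF R P(1), of w] in_lin[of v "real n * a" u] unfolding w_def[symmetric] by auto
  have xw: "x = w" using FF_end_start[OF i(1) si c] .
  have sy: "sgn (y - w) = u" using c xw by (simp add: cov_def)
  have "\<not> isA j w y"
  proof
    assume A: "isA j w y"
    have "y = v + of_real (real (Suc n) * a) * u"
      using endpoint_sgn[of y w] sy FF_len(1)[OF c(1)] A xw by (simp add: w_def algebra_simps)
    then have "good_run v u s (Suc n)"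
      using gn c(1) A xw unfolding good_run_def w_def by (auto simp: less_Suc_eq)
    then show False using nmax by fastforce
  qed
  then have "turn_at w u s" unfolding turn_at_def using i si c(1) xw sy P by blast
  then show ?thesis using gn w_def by blast
qed

section \<open>Points where runs start and end\<close>

lemma oseg_status:
  assumes "cr A B C \<noteq> 0"
  shows "\<forall>(x, y)\<in>ded A B C. \<forall>w\<in>open_segment x y. w \<in> tri A B C - itri A B C - {A, B, C}"
proof -
  have *: "w \<in> tri A B C - itri A B C - {A, B, C}" if d: "cr A B C > 0" and w: "w \<in> open_segment A B" for A B C w
    using oseg_triD[OF d w] by (auto simp: tri_ccw[OF d])
  have 2: "\<forall>(x, y)\<in>ded A B C. \<forall>w\<in>open_segment x y. w \<in> tri A B C - itri A B C - {A, B, C}"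
    if d: "cr A B C > 0" for A B C
  proof -
    have d': "cr B C A > 0" "cr C A B > 0" using d cr_rotate[of A B C] by simp_all
    have "tri B C A = tri A B C" "tri C A B = tri A B C" "itri B C A = itri A B C" "itri C A B = itri A B C"
      by (auto simp: tri_ccw[OF d] tri_ccw[OF d'(1)] tri_ccw[OF d'(2)])
    then show ?thesis using *[OF d] *[OF d'(1)] *[OF d'(2)] d by (auto simp: ded_def)
  qed
  show ?thesis
    by (rule ccw_wlog[OF assms, of "\<lambda>D T J S. \<forall>(x, y)\<in>D. \<forall>w\<in>open_segment x y. w \<in> T - J - S"]) (rule 2)
qed

lemma FF_pass:
  assumes "(k, z, z') \<in> FF r" "w \<in> open_segment z z'"
  shows "k \<in> I" "w \<in> tri (tA k) (tB k) (tC k) - itri (tA k) (tB k) (tC k) - {tA k, tB k, tC k}"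
proof -
  show k: "k \<in> I" using FF_D(1)[OF assms(1)] .
  have "(z, z') \<in> ded (tA k) (tB k) (tC k) \<or> (z', z) \<in> ded (tA k) (tB k) (tC k)"
    using assms(1) by (auto simp: FF_def EE_def split: if_splits)
  then show "w \<in> tri (tA k) (tB k) (tC k) - itri (tA k) (tB k) (tC k) - {tA k, tB k, tC k}"
    using oseg_status[OF nondeg[OF k]] assms(2) open_segment_commute[of z z'] by (elim disjE) (blast, force)
qed

lemma nE_pos: "(k, z, z') \<in> FF r \<Longrightarrow> w \<in> open_segment z z' \<Longrightarrow> nE w > 0"
proof -
  assume a: "(k, z, z') \<in> FF r" "w \<in> open_segment z z'"
  let ?S = "{i\<in>I. w \<in> tri (tA i) (tB i) (tC i) - itri (tA i) (tB i) (tC i) - {tA i, tB i, tC i}}"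
  have "k \<in> ?S" using FF_pass[OF a] by (intro CollectI conjI)
  then have "?S \<noteq> {}" by (metis empty_iff)
  moreover have "finite ?S" using fin by simp
  ultimately show ?thesis unfolding nE_def card_gt_0_iff by (rule conjI)
qed

text \<open>The edge with \<open>w\<close> in its interior takes a straight angle, too much for a
  corner. The incoming a-edge adds an angle \<beta> or 2\<pi>/3, too much for a boundary point.
  Inside, 3 of the 6 units remain.\<close>

lemma turn_types:
  assumes "turn_at w u s"
  shows "w \<notin> {X, Y, Z}" "nE w = 1" "nB w = nA w" "nA w + 2 * nC w = 3" "w \<in> itri X Y Z"
proof -
  obtain i x k z z' where A: "(i, x, w) \<in> FF s" "isA i x w" and P: "(k, z, z') \<in> FF (\<not> s)" "w \<in> open_segment z z'"
    using assms unfolding turn_at_def by blast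
  have E: "nE w \<ge> 1" using nE_pos[OF P] by simp
  have "w = tB i \<or> w = tC i" "i \<in> I" using A FF_D(1)[OF A(1)] by (auto simp: isA_def doubleton_eq_iff)
  then have BC: "nB w > 0 \<or> nC w > 0" unfolding nB_def nC_def card_gt_0_iff using fin by auto
  show ncor: "w \<notin> {X, Y, Z}"
  proof
    assume c: "w \<in> {X, Y, Z}"
    have ne: "X \<noteq> Y" "Y \<noteq> Z" "X \<noteq> Z" using NONDEG by auto
    have "cang Y X Z < pi" "cang X Y Z < pi" "cang X Z Y < pi"
      using cang_bounds[of X Y Z] cang_bounds[of Y X Z] cang_bounds[of Z X Y] NONDEG cr_swap[of X Y Z] cr_rotate[of X Y Z] by auto
    then have "wang X Y Z w < pi" using c ne by (auto simp: wang_def)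
    moreover have "nE w * pi \<ge> 1 * pi" using E by (intro mult_right_mono) auto
    moreover have "nA w * \<alpha> \<ge> 0" "nB w * \<beta> \<ge> 0" "nC w * (2 * pi / 3) \<ge> 0" "nI w * (2 * pi) \<ge> 0" using ab_pos by auto
    ultimately show False using vertex_equation[of w] by linarith
  qed
  show B: "nB w = nA w" using vertex_types(1)[OF ncor] .
  note vt = vertex_types(2-4)[OF ncor]
  show in1: "w \<in> itri X Y Z" using vt(2,3) E BC B by (cases "w \<in> tri X Y Z"; cases "w \<in> itri X Y Z") auto
  have "nA w > 0 \<or> nC w > 0" using BC B by simp
  then show E1: "nE w = 1" using vt(1)[OF in1] E by presburger
  have "nI w = 0" using vt(1)[OF in1] E by linarith
  then show "nA w + 2 * nC w = 3" using vt(1)[OF in1] E1 by linarith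
qed

text \<open>Only one tile has \<open>w\<close> inside an edge, and the open edges of a tile are
  disjoint. Listed for the other side, the same edge is reversed.\<close>

lemma pass_unique:
  assumes "nE w = 1" "(k, z, z') \<in> FF r" "w \<in> open_segment z z'" "(k', y, y') \<in> FF r'" "w \<in> open_segment y y'"
  shows "if r = r' then y = z \<and> y' = z' else y = z' \<and> y' = z"
proof -
  let ?S = "{i\<in>I. w \<in> tri (tA i) (tB i) (tC i) - itri (tA i) (tB i) (tC i) - {tA i, tB i, tC i}}"
  obtain e where e: "?S = {e}"
    using assms(1) unfolding nE_def by (rule card_1_singletonE)
  have "k \<in> ?S" using FF_pass[OF assms(2,3)] by (intro CollectI conjI)
  moreover have "k' \<in> ?S" using FF_pass[OF assms(4,5)] by (intro CollectI conjI)
  ultimately have kk: "k' = k" unfolding e by simp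
  have "Some k \<in> cells" using FF_pass(1)[OF assms(2,3)] by (simp add: cells_def)
  note ed = ed_disjoint[OF this]
  have o: "w \<in> open_segment z' z" "w \<in> open_segment y' y" using assms(3,5) by (simp_all add: open_segment_commute)
  have m: "if r then (z, z') \<in> ed (Some k) else (z', z) \<in> ed (Some k)"
    "if r' then (y, y') \<in> ed (Some k) else (y', y) \<in> ed (Some k)"
    using assms(2,4) kk unfolding FF_def EE_def by (auto split: if_splits)
  show ?thesis
  proof (cases r; cases r')
    assume "r" "r'"
    then show ?thesis using ed[of z z' y y' w] m assms(3,5) by simp
  next
    assume "r" "\<not> r'"
    then show ?thesis using ed[of z z' y' y w] m assms(3) o by simp
  next
    assume "\<not> r" "r'"
    then show ?thesis using ed[of z' z y y' w] m assms(5) o by simp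
  next
    assume "\<not> r" "\<not> r'"
    then show ?thesis using ed[of z' z y' y w] m o by simp
  qed
qed

lemma interior_no_None:
  assumes "w \<in> itri X Y Z" "(None, x, y) \<in> EE"
  shows "\<not> cov w u x y \<and> \<not> cov w u y x"
proof -
  have d: "(y, x) \<in> ded X Y Z" using assms by (auto simp: EE_def)
  then have "w \<notin> open_segment y x" using oseg_status[OF NONDEG] assms(1) by blast
  moreover have "cr y x w > 0" using d assms(1) by (auto simp: itri_def)
  ultimately show ?thesis by (auto simp: cov_def open_segment_commute)
qed

definition AS :: "complex \<Rightarrow> ('i \<times> complex \<times> bool) set" where
  "AS w = {(i, x, s). (i, w, x) \<in> FF s \<and> isA i w x}"

text \<open>A tile with its \<beta> or its 2\<pi>/3 at \<open>w\<close> has exactly one a-edge at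
  \<open>w\<close>, the one joining these two vertices. At stars the parity of the number will
  matter, at turns its exact value.\<close>

lemma card_AS: "card (AS w) = nB w + nC w" "finite (AS w)"
proof -
  have inj: "inj_on fst (AS w)"
  proof (rule inj_onI)
    fix e e' assume ee: "e \<in> AS w" "e' \<in> AS w" "fst e = fst e'"
    obtain i x s where e: "e = (i, x, s)" using prod_cases3 by blast
    obtain x' s' where e': "e' = (i, x', s')" using ee(3) e by (metis fst_conv surj_pair)
    have f: "(i, w, x) \<in> FF s" "isA i w x" "(i, w, x') \<in> FF s'" "isA i w x'" using ee by (auto simp: AS_def e e')
    have x: "x' = x" using f(2,4) by (auto simp: isA_def doubleton_eq_iff)
    have "\<not> ((w, x) \<in> ded (tA i) (tB i) (tC i) \<and> (x, w) \<in> ded (tA i) (tB i) (tC i))"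
      using tile_neq[OF FF_D(1)[OF f(1)]] FF_D(2)[OF f(1)] by (auto simp: ded_def split: if_splits)
    then have "s' = s" using f(1,3) x by (auto simp: FF_def EE_def split: if_splits)
    then show "e = e'" using e e' x by simp
  qed
  have im: "fst ` AS w = {i\<in>I. tB i = w} \<union> {i\<in>I. tC i = w}"
  proof
    show "fst ` AS w \<subseteq> {i\<in>I. tB i = w} \<union> {i\<in>I. tC i = w}"
      using FF_D(1) by (fastforce simp: AS_def isA_def doubleton_eq_iff)
    show "{i\<in>I. tB i = w} \<union> {i\<in>I. tC i = w} \<subseteq> fst ` AS w"
    proof
      fix i assume i: "i \<in> {i\<in>I. tB i = w} \<union> {i\<in>I. tC i = w}"
      define x where "x = (if tB i = w then tC i else tB i)"
      have A: "isA i w x" using i by (auto simp: isA_def x_def)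
      have "(w, x) \<in> ded (tA i) (tB i) (tC i) \<or> (x, w) \<in> ded (tA i) (tB i) (tC i)"
        using i by (auto simp: x_def ded_def)
      then have "(i, w, x) \<in> FF True \<or> (i, w, x) \<in> FF False" using i by (auto simp: FF_def EE_def cells_def)
      then show "i \<in> fst ` AS w" using A by (force simp: AS_def)
    qed
  qed
  have disj0: "{i\<in>I. tB i = w} \<inter> {i\<in>I. tC i = w} = {}"
  proof (rule equals0I)
    fix i assume "i \<in> {i\<in>I. tB i = w} \<inter> {i\<in>I. tC i = w}"
    then show False using tile_neq[of i] by simp
  qed
  have "card (AS w) = card (fst ` AS w)" using inj by (simp add: card_image)
  also have "\<dots> = card {i\<in>I. tB i = w} + card {i\<in>I. tC i = w}"
    unfolding im by (intro card_Un_disjoint) (use fin disj0 in simp_all)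
  finally show "card (AS w) = nB w + nC w" by (simp add: nB_def nC_def)
  have "finite (fst ` AS w)" unfolding im using fin by simp
  then show "finite (AS w)" using inj finite_imageD by blast
qed

lemma start_other_side:
  assumes "w \<in> itri X Y Z" "(i, w, x) \<in> FF s" "sgn (x - w) = u"
    and np: "\<And>k z z'. (k, z, z') \<in> FF (\<not> s) \<Longrightarrow> w \<in> open_segment z z' \<Longrightarrow> sgn (z' - z) \<noteq> u"
  shows "\<exists>j y. (j, w, y) \<in> FF (\<not> s) \<and> sgn (y - w) = u"
proof -
  have "cov w u w x" using assms FF_D(2) by (auto simp: cov_def)
  then obtain j x' y' where j: "(j, x', y') \<in> FF (\<not> s)" "cov w u x' y'"
    using FF_exchange[OF assms(2)] interior_no_None[OF assms(1)] by blast
  have "x' = w" using j np[OF j(1)] unfolding cov_def by blast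
  then show ?thesis using j unfolding cov_def by blast
qed

text \<open>No edge passes through a star, so every a-edge leaving it faces another edge leaving it.
  Without a start of a run, a-edges would face a-edges and come in pairs; but there are
  three.\<close>

lemma star_record:
  assumes "w \<in> stars"
  shows "\<exists>u s. (w, u, s) \<in> Rec"
proof (rule ccontr)
  assume no: "\<not> (\<exists>u s. (w, u, s) \<in> Rec)"
  have w: "w \<notin> {X, Y, Z}" "nA w = 0" "nC w = 3" using assms by (auto simp: stars_def)
  have wi: "w \<in> itri X Y Z" using vertex_types(3,4)[OF w(1)] w by (cases "w \<in> tri X Y Z"; cases "w \<in> itri X Y Z") auto
  have E0: "nE w = 0" using vertex_types(2)[OF w(1) wi] w by simp
  define D where "D s = {sgn (x - w) | i x. (i, x, s) \<in> AS w}" for s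
  have sub: "D s \<subseteq> D (\<not> s)" for s
  proof
    fix u assume "u \<in> D s"
    then obtain i x where e: "(i, w, x) \<in> FF s" "isA i w x" "sgn (x - w) = u" by (auto simp: D_def AS_def)
    obtain j y where j: "(j, w, y) \<in> FF (\<not> s)" "sgn (y - w) = u"
      using start_other_side[OF wi e(1,3)] nE_pos E0 by (metis less_irrefl)
    have "isA j w y" using no e j unfolding Rec_def by blast
    then show "u \<in> D (\<not> s)" using j by (auto simp: D_def AS_def)
  qed
  have DD: "D True = D False" using sub[of True] sub[of False] by auto
  have cs: "card {e \<in> AS w. snd (snd e) = s} = card (D s)" for s
  proof -
    have "inj_on (\<lambda>e. sgn (fst (snd e) - w)) {e \<in> AS w. snd (snd e) = s}"
    proof (rule inj_onI)
      fix e e' assume ee: "e \<in> {e \<in> AS w. snd (snd e) = s}" "e' \<in> {e \<in> AS w. snd (snd e) = s}"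
        "sgn (fst (snd e) - w) = sgn (fst (snd e') - w)"
      obtain i x where e: "e = (i, x, s)" using ee(1) by (cases e) auto
      obtain j y where e': "e' = (j, y, s)" using ee(2) by (cases e') auto
      have f: "(i, w, x) \<in> FF s" "(j, w, y) \<in> FF s" using ee by (auto simp: AS_def e e')
      then have "cov w (sgn (x - w)) w x" "cov w (sgn (x - w)) w y" using FF_D(2) ee(3) by (auto simp: cov_def e e')
      then show "e = e'" using FF_unique[OF f(1) _ f(2)] e e' by blast
    qed
    moreover have "(\<lambda>e. sgn (fst (snd e) - w)) ` {e \<in> AS w. snd (snd e) = s} = D s"
      by (auto simp: D_def image_def Bex_def)
    ultimately show ?thesis using card_image by fastforce
  qed
  have "AS w = {e \<in> AS w. snd (snd e) = True} \<union> {e \<in> AS w. snd (snd e) = False}" by auto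
  then have "card (AS w) = card {e \<in> AS w. snd (snd e) = True} + card {e \<in> AS w. snd (snd e) = False}"
    using card_AS(2)[of w] card_Un_disjoint[of "{e \<in> AS w. snd (snd e) = True}" "{e \<in> AS w. snd (snd e) = False}"] by auto
  then have "card (AS w) = card (D True) + card (D False)" unfolding cs .
  then have "card (AS w) = 2 * card (D True)" using DD by simp
  moreover have "card (AS w) = 3" using card_AS(1)[of w] w vertex_types(1)[OF w(1)] by simp
  ultimately show False by presburger
qed

text \<open>Besides the passing edge, one angle of each kind meets \<open>w\<close>, so two a-edges
  touch it: the incoming one and one other. The other one leaves the line of the run, so the edge
  facing it also starts at \<open>w\<close>; that edge is not an a-edge, being a third one
  otherwise.\<close>

lemma turn_record:
  assumes T: "turn_at w u s" and C: "nC w = 1"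
  shows "\<exists>u s. (w, u, s) \<in> Rec"
proof -
  note tt = turn_types[OF T]
  obtain i x j y k z z' where A: "(i, x, w) \<in> FF s" "isA i x w" "sgn (w - x) = u"
    and N: "(j, w, y) \<in> FF s" "\<not> isA j w y" "sgn (y - w) = u"
    and P: "(k, z, z') \<in> FF (\<not> s)" "sgn (z' - z) = u" "w \<in> open_segment z z'"
    using T unfolding turn_at_def by blast
  have c2: "card (AS w) = 2" using card_AS(1)[of w] tt C by simp
  have e1: "(i, x, \<not> s) \<in> AS w" using A FF_rev[of i x w s] isA_rev by (auto simp: AS_def)
  then obtain i2 x2 s2 where e2: "(i2, x2, s2) \<in> AS w" "(i2, x2, s2) \<noteq> (i, x, \<not> s)"
    using c2 by (metis card_2_iff prod_cases3 singletonD insert_iff doubleton_eq_iff)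
  define u2 where "u2 = sgn (x2 - w)"
  have f2: "(i2, w, x2) \<in> FF s2" "isA i2 w x2" using e2 by (auto simp: AS_def)
  have cov2: "cov w u2 w x2" using FF_D(2)[OF f2(1)] by (auto simp: cov_def u2_def)
  have sx: "sgn (x - w) = - u" using A(3) sgn_swap[of x w] by simp
  have P': "(k, z', z) \<in> FF s" "cov w (- u) z' z" "cov w u z z'"
    using P FF_rev[of k z z' "\<not> s"] sgn_swap[of z z'] by (auto simp: cov_def open_segment_commute)
  have zw: "z \<noteq> w" "z' \<noteq> w" using P(3) by (auto simp: open_segment_def)
  \<comment> \<open>Backwards the line is occupied by the incoming edge and the passing edge,
    forwards by the continuation, which is not an a-edge, and the passing edge. Neither ray has room
    for the second a-edge.\<close>
  have n1: "u2 \<noteq> - u"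
  proof
    assume u: "u2 = - u"
    show False
    proof (cases "s2 = s")
      case True
      then show False using FF_unique[OF _ cov2 P'(1)] f2(1) P'(2) u zw by auto
    next
      case False
      then have "s2 = (\<not> s)" by auto
      moreover have "(i, w, x) \<in> FF (\<not> s)" "cov w (- u) w x" using e1 sx FF_D(2) by (auto simp: AS_def cov_def)
      ultimately show False using FF_unique[OF _ cov2[unfolded u], of i2 "\<not> s" i w x] f2(1) e2(2) by auto
    qed
  qed
  have n2: "u2 \<noteq> u"
  proof
    assume u: "u2 = u"
    show False
    proof (cases "s2 = s")
      case True
      have "cov w u w y" using N FF_D(2) by (auto simp: cov_def)
      then show False using FF_unique[OF _ cov2[unfolded u], of i2 s j w y] f2 N True by auto
    next
      case False
      then have "s2 = (\<not> s)" by auto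
      then show False using FF_unique[OF _ cov2[unfolded u], of i2 "\<not> s" k z z'] f2 P(1) P'(3) zw by auto
    qed
  qed
  have "sgn (y' - x') \<noteq> u2" if "(k', x', y') \<in> FF (\<not> s2)" "w \<in> open_segment x' y'" for k' x' y'
    using pass_unique[OF tt(2) P(1,3) that] P(2) n1 n2 sgn_swap[of z z'] by (auto split: if_splits)
  then obtain j2 y2 where j2: "(j2, w, y2) \<in> FF (\<not> s2)" "sgn (y2 - w) = u2"
    using start_other_side[OF tt(5) f2(1), of u2] u2_def by blast
  have "\<not> isA j2 w y2"
  proof
    assume "isA j2 w y2"
    then have e3: "(j2, y2, \<not> s2) \<in> AS w" using j2 by (auto simp: AS_def)
    have "(j2, y2, \<not> s2) \<noteq> (i, x, \<not> s)" using j2(2) n1 sx by auto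
    then have "card {(i, x, \<not> s), (i2, x2, s2), (j2, y2, \<not> s2)} = 3" using e2(2) by auto
    moreover have "{(i, x, \<not> s), (i2, x2, s2), (j2, y2, \<not> s2)} \<subseteq> AS w" using e1 e2 e3 by auto
    ultimately show False using card_mono[OF card_AS(2)[of w]] c2 by (metis Suc_n_not_le_n numeral_2_eq_2 numeral_3_eq_3)
  qed
  then show ?thesis using f2 j2 u2_def unfolding Rec_def by blast
qed

text \<open>Only one edge passes through \<open>w\<close>, so two runs that end there lie on one
  line. If they came from opposite directions, the last edge of one would be the continuation of the
  other, which is not an a-edge.\<close>

lemma turn_dir_unique:
  assumes T: "turn_at w u s" and T': "turn_at w u' s'"
  shows "u' = u \<and> s' = s"
proof -
  note tt = turn_types[OF T]
  obtain i x j y k z z' where A: "(i, x, w) \<in> FF s" "isA i x w" "sgn (w - x) = u"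
    and N: "(j, w, y) \<in> FF s" "\<not> isA j w y" "sgn (y - w) = u"
    and P: "(k, z, z') \<in> FF (\<not> s)" "sgn (z' - z) = u" "w \<in> open_segment z z'"
    using T unfolding turn_at_def by blast
  obtain i2 x2 k2 y2 y2' where A2: "(i2, x2, w) \<in> FF s'" "isA i2 x2 w" "sgn (w - x2) = u'"
    and P2: "(k2, y2, y2') \<in> FF (\<not> s')" "sgn (y2' - y2) = u'" "w \<in> open_segment y2 y2'"
    using T' unfolding turn_at_def by blast
  note pu = pass_unique[OF tt(2) P(1,3) P2(1,3)]
  show ?thesis
  proof (cases "s' = s")
    case True
    then show ?thesis using pu P(2) P2(2) by auto
  next
    case False
    then have s': "s' = (\<not> s)" by auto
    then have "u' = - u" using pu P(2) P2(2) sgn_swap[of z z'] by auto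
    then have sx: "sgn (x2 - w) = u" using A2(3) sgn_swap[of x2 w] by simp
    have F: "(i2, w, x2) \<in> FF s" using A2(1) FF_rev[of i2 x2 w s'] s' by simp
    have "cov w u w x2" "cov w u w y" using sx N(3) FF_D(2)[OF F] FF_D(2)[OF N(1)] by (auto simp: cov_def)
    then have "i2 = j \<and> x2 = y" using FF_unique[OF F _ N(1)] by blast
    then show ?thesis using A2(2) N(2) isA_rev by blast
  qed
qed

text \<open>All runs are counted at once instead of following chains of them: |stars| + |W1| \<le>
  |Rec| \<le> |W| \<le> |W1| + |t30|, and \<open>W1\<close>, the set of turns with one angle
  2\<pi>/3, cancels.\<close>

theorem side_relation:
  assumes "card t30 < card stars"
  shows "\<exists>m i j k :: nat. real m * a = real i * a + real j * b + real k * c \<and> j + k > 0"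
proof (rule ccontr)
  assume "\<not> ?thesis"
  then have norel: "\<And>m i j k :: nat. real m * a = real i * a + real j * b + real k * c \<Longrightarrow> j = 0 \<and> k = 0" by force
  define W where "W = {w. \<exists>u s. turn_at w u s}"
  have "W \<subseteq> VV" unfolding W_def turn_at_def using FF_D(6) by blast
  then have finW: "finite W" using finite_VV finite_subset by blast
  define n where "n = (\<lambda>(v, u, s). SOME n. good_run v u s n \<and> turn_at (v + of_real (real n * a) * u) u s)"
  have n: "good_run v u s (n (v, u, s)) \<and> turn_at (v + of_real (real (n (v, u, s)) * a) * u) u s" if "(v, u, s) \<in> Rec" for v u s
    unfolding n_def prod.case by (rule someI_ex) (rule run_end[OF that norel])
  define f where "f = (\<lambda>(v, u, s). v + of_real (real (n (v, u, s)) * a) * u)"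
  have fW: "f ` Rec \<subseteq> W"
  proof
    fix w assume "w \<in> f ` Rec"
    then obtain v u s where "(v, u, s) \<in> Rec" "w = f (v, u, s)" by (metis imageE prod_cases3)
    then have "turn_at w u s" using n unfolding f_def prod.case by blast
    then show "w \<in> W" unfolding W_def by blast
  qed
  have "inj_on f Rec"
  proof (rule inj_onI)
    fix e e' assume ee: "e \<in> Rec" "e' \<in> Rec" "f e = f e'"
    obtain v u s where e: "e = (v, u, s)" using prod_cases3 by blast
    obtain v' u' s' where e': "e' = (v', u', s')" using prod_cases3 by blast
    have R: "(v, u, s) \<in> Rec" "(v', u', s') \<in> Rec" using ee e e' by auto
    have "turn_at (f e) u s" using n[OF R(1)] unfolding f_def e prod.case by blast
    moreover have "turn_at (f e) u' s'" using n[OF R(2)] unfolding ee(3) unfolding f_def e' prod.case by blast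
    ultimately have us: "u' = u \<and> s' = s" by (rule turn_dir_unique)
    \<comment> \<open>Of two runs with the same end and direction, the longer one passes over the
      start \<open>v'\<close> of the other. There \<open>other_side\<close> asks for an edge with
      \<open>v'\<close> in its interior, although the start of a run has an edge leaving
      \<open>v'\<close> on that side.\<close>
    have key: False if R: "(v, u, s) \<in> Rec" "(v', u, s) \<in> Rec" and g: "good_run v u s m" and m: "m' < m"
      and eq: "v + of_real (real m * a) * u = v' + of_real (real m' * a) * u" for v v' m m'
    proof -
      obtain i0 x0 j0 y0 where e0: "(i0, v, x0) \<in> FF s" "(j0, v', y0) \<in> FF (\<not> s)" "sgn (y0 - v') = u" using R unfolding Rec_def by blast
      have pos: "a > 0" "b > 0" "c > 0" using a_pos FF_D(1)[OF e0(1)] by blast+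
      have v': "v' = v + of_real (real (m - m') * a) * u" using eq m by (simp add: of_nat_diff algebra_simps)
      have "(\<exists>i j k :: nat. real (m - m') * a = real i * a + real j * b + real k * c \<and> j + k > 0) \<or>
        (\<exists>j x y. (j, x, y) \<in> FF (\<not> s) \<and> sgn (y - x) = u \<and> v' \<in> open_segment x y)"
        unfolding v' using m pos by (intro other_side[OF R(1) g]) auto
      then obtain j x y where p: "(j, x, y) \<in> FF (\<not> s)" "sgn (y - x) = u" "v' \<in> open_segment x y" using norel by fastforce
      have "cov v' u x y" "cov v' u v' y0" using p e0 FF_D(2) by (auto simp: cov_def)
      then have "x = v'" using FF_unique[OF p(1) _ e0(2)] by blast
      then show False using p(3) by (auto simp: open_segment_def)
    qed
    have eq: "v + of_real (real (n (v, u, s)) * a) * u = v' + of_real (real (n (v', u, s)) * a) * u"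
      using ee(3) us unfolding f_def e e' by simp
    have "n (v, u, s) = n (v', u, s)"
    proof (rule ccontr)
      assume "n (v, u, s) \<noteq> n (v', u, s)"
      then consider "n (v', u, s) < n (v, u, s)" | "n (v, u, s) < n (v', u, s)" by linarith
      moreover have R': "(v', u, s) \<in> Rec" using R(2) us by simp
      ultimately show False
        using key[OF R(1) R' conjunct1[OF n[OF R(1)]] _ eq] key[OF R' R(1) conjunct1[OF n[OF R']] _ eq[symmetric]] by cases
    qed
    then have "v = v'" using eq by simp
    then show "e = e'" using us e e' by simp
  qed
  then have 1: "card Rec \<le> card W" and finR: "finite Rec" using card_inj_on_le[OF _ fW finW] finite_imageD finite_subset[OF fW finW] by blast+
  define W1 where "W1 = {w\<in>W. nC w = 1}"
  have tt: "nA w + 2 * nC w = 3 \<and> w \<notin> {X, Y, Z}" if "w \<in> W" for w using that turn_types(1,4) unfolding W_def by blast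
  have "W \<subseteq> W1 \<union> t30"
  proof
    fix w assume w: "w \<in> W"
    then have "nC w = 0 \<or> nC w = 1" using tt by fastforce
    then show "w \<in> W1 \<union> t30" using w tt[OF w] by (auto simp: W1_def t30_def)
  qed
  then have 2: "card W \<le> card W1 + card t30"
    using card_mono[of "W1 \<union> t30" W] card_Un_le[of W1 t30] finite_stars finW by (force simp: W1_def)
  have "stars \<union> W1 \<subseteq> fst ` Rec"
  proof
    fix w assume "w \<in> stars \<union> W1"
    then obtain u s where "(w, u, s) \<in> Rec" using star_record turn_record unfolding W1_def W_def by blast
    then show "w \<in> fst ` Rec" by force
  qed
  then have "card (stars \<union> W1) \<le> card Rec" using finR by (meson card_image_le card_mono finite_imageI le_trans)
  moreover have "card (stars \<union> W1) = card stars + card W1"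
    using finite_stars finW by (intro card_Un_disjoint) (auto simp: W1_def stars_def)
  ultimately show False using 1 2 assms by linarith
qed

end

section \<open>Signed perimeters\<close>

interpretation rat_real: vector_space "\<lambda>(q::rat) (x::real). of_rat q * x"
  by unfold_locales (simp_all add: algebra_simps of_rat_add of_rat_mult)

interpretation rat_real2: vector_space_pair "\<lambda>(q::rat) (x::real). of_rat q * x" "\<lambda>(q::rat) (x::real). of_rat q * x"
  by unfold_locales

text \<open>\<open>x\<close> and \<open>y\<close> are linearly independent over the rationals, so a
  linear map may take any prescribed values on them (extend to a Hamel basis).\<close>

lemma additive_extension:
  fixes x y :: real
  assumes "x \<noteq> 0" "\<And>q. q \<in> \<rat> \<Longrightarrow> y \<noteq> q * x"
  obtains f :: "real \<Rightarrow> real" where "\<And>s t. f (s + t) = f s + f t" "f x = u" "f y = v"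
proof -
  have "y \<notin> rat_real.span {x}"
  proof
    assume "y \<in> rat_real.span {x}"
    then obtain k where "y = of_rat k * x" by (auto simp: rat_real.span_singleton)
    then show False using assms(2)[of "of_rat k"] by simp
  qed
  moreover have "rat_real.independent {x}" using assms(1) by simp
  ultimately have ind: "rat_real.independent {y, x}" by (rule rat_real.independent_insertI)
  have "y \<noteq> x" using assms(2)[of 1] by auto
  obtain f where f: "Vector_Spaces.linear (\<lambda>(q::rat) (x::real). of_rat q * x) (\<lambda>(q::rat) (x::real). of_rat q * x) f"
    "\<forall>z\<in>{y, x}. f z = (if z = x then u else v)"
    using rat_real2.linear_independent_extend[OF ind, of "\<lambda>z. if z = x then u else v"] by blast
  show thesis
  proof (rule that[of f])
    show "f (s + t) = f s + f t" for s t using f(1) by (simp add: rat_real2.linear_add)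
  qed (use f(2) \<open>y \<noteq> x\<close> in auto)
qed

text \<open>The normalisation makes \<open>chi\<close> below well defined: a full turn has value 6, which is even.\<close>

locale character =
  fixes g :: "real \<Rightarrow> real"
  assumes add: "g (s + t) = g s + g t" and g_pi: "g pi = 3"
begin

lemma g_0: "g 0 = 0" using add[of 0 0] by simp

lemma g_minus: "g (- t) = - g t" using add[of t "- t"] g_0 by simp

lemma g_nat: "g (real n * t) = real n * g t"
  by (induction n) (simp_all add: g_0 add algebra_simps)

lemma g_int: "g (of_int n * t) = of_int n * g t"
proof (cases "n \<ge> 0")
  case True
  then show ?thesis using g_nat[of "nat n" t] by simp
next
  case False
  then have "g (- (real (nat (- n)) * t)) = - (real (nat (- n)) * g t)" by (simp only: g_minus g_nat)
  then show ?thesis using False by simp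
qed

definition chi :: "complex \<Rightarrow> complex" where
  "chi z = cis (pi * g (Arg z))"

lemma cis_period:
  assumes "cis x = cis y"
  shows "cis (pi * g x) = cis (pi * g y)"
proof -
  have "cis (x - y) = 1" using assms by (simp add: cis_divide[symmetric])
  then have "cos (x - y) = 1" by (metis cis.sel(1) one_complex.sel(1))
  then obtain n :: int where n: "x - y = of_int n * 2 * pi" using cos_one_2pi_int by auto
  have "x = y + of_int (2 * n) * pi" using n by (simp add: algebra_simps)
  then have "g x = g y + g (of_int (2 * n) * pi)" by (simp only: add)
  also have "g (of_int (2 * n) * pi) = of_int (6 * n)" unfolding g_int g_pi by simp
  finally have "pi * g x = pi * g y + 2 * pi * of_int (3 * n)" by (simp add: algebra_simps)
  then have "cis (pi * g x) = cis (pi * g y) * cis (2 * pi * of_int (3 * n))" by (simp only: cis_mult)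
  also have "cis (2 * pi * of_int (3 * n)) = 1" by (rule cis_multiple_2pi) simp
  finally show ?thesis by simp
qed

lemma chi_mult:
  assumes "z \<noteq> 0" "w \<noteq> 0"
  shows "chi (z * w) = chi z * chi w"
proof -
  have "cis (Arg (z * w)) = cis (Arg z + Arg w)"
    using assms by (simp add: cis_Arg sgn_mult cis_mult[symmetric])
  from cis_period[OF this] show ?thesis by (simp only: chi_def add distrib_left cis_mult)
qed

lemma chi_pos: "0 < t \<Longrightarrow> chi (of_real t) = 1"
  by (simp add: chi_def g_0)

text \<open>The value 3 of a half turn is odd, so opposite directions get opposite values; this
  makes \<open>wt\<close> below change sign when a segment is reversed.\<close>

lemma chi_neg1: "chi (-1) = -1"
proof -
  have "Arg (-1) = pi" using Arg_of_real[of "-1"] by simp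
  then have "chi (-1) = cis (3 * pi)" by (simp add: chi_def g_pi mult.commute)
  also have "\<dots> = cis (2 * pi) * cis pi" unfolding cis_mult by (simp add: algebra_simps)
  finally show ?thesis by simp
qed

lemma chi_minus: "z \<noteq> 0 \<Longrightarrow> chi (- z) = - chi z"
  using chi_mult[of "-1" z] chi_neg1 by simp

lemma cis_int: "cis (pi * of_int m) = (if even m then 1 else -1)"
proof -
  have "cis (pi * of_int m) = of_real (cos (of_int m * pi)) + \<i> * of_real (sin (of_int m * pi))"
    by (simp add: complex_eq_iff mult.commute)
  moreover have "cos (of_int m * pi) = (if even m then 1 else -1)" "sin (of_int m * pi) = 0"
    using cos_int_times_real[of m] by (auto simp: cos_npi_int mult.commute sin_npi_int)
  ultimately show ?thesis by simp
qed

text \<open>The factor is its own inverse, so it does not matter to which side the corner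
  turns.\<close>

lemma chi_corner:
  assumes "cr q p r \<noteq> 0" and m: "g (cang p q r) = of_int m"
  shows "chi (r - q) = (if even m then 1 else -1) * chi (p - q)"
proof -
  have ne: "p \<noteq> q" "r \<noteq> q" using assms(1) by auto
  have *: "chi ((r - q) / (p - q)) = (if even m then 1 else -1)" if "cr q p r > 0" "g (cang p q r) = of_int m" for p q r m
    using Arg_eq_cang[OF that(1)] that(2) cis_int by (simp add: chi_def)
  show ?thesis
  proof (cases "cr q p r > 0")
    case True
    have "chi (r - q) = chi ((r - q) / (p - q)) * chi (p - q)" using chi_mult[of "(r - q) / (p - q)" "p - q"] ne by simp
    then show ?thesis using *[OF True m] by simp
  next
    case False
    then have "cr q r p > 0" using assms(1) cr_swap(2)[of q r p] by linarith
    moreover have "g (cang r q p) = of_int m" using m cang_commute[of r q p] by simp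
    ultimately have "chi ((p - q) / (r - q)) = (if even m then 1 else -1)" by (rule *)
    moreover have "chi (p - q) = chi ((p - q) / (r - q)) * chi (r - q)" using chi_mult[of "(p - q) / (r - q)" "r - q"] ne by simp
    ultimately show ?thesis by simp
  qed
qed

end

section \<open>Twisted lengths\<close>

locale weight = character g for g +
  fixes \<phi> :: "real \<Rightarrow> real"
  assumes \<phi>_add: "\<phi> (s + t) = \<phi> s + \<phi> t"
begin

lemma \<phi>_0: "\<phi> 0 = 0" using \<phi>_add[of 0 0] by simp

lemma \<phi>_minus: "\<phi> (- t) = - \<phi> t" using \<phi>_add[of t "- t"] \<phi>_0 by simp

definition wt :: "complex \<Rightarrow> complex \<Rightarrow> complex" where
  "wt p q = of_real (\<phi> (norm (q - p))) * chi (q - p)"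

text \<open>For negative \<open>t\<close> both factors change sign, since \<open>\<phi>\<close> is
  odd and \<open>chi\<close> takes opposite values on opposite directions. So the formula holds for
  signed lengths and \<open>wt\<close> adds up along a line.\<close>

lemma wt_line:
  assumes "d \<noteq> 0"
  shows "wt p (p + of_real t * d) = of_real (\<phi> (t * norm d)) * chi d"
proof -
  consider "t > 0" | "t = 0" | "t < 0" by linarith
  then show ?thesis
  proof cases
    case 1
    then show ?thesis using assms by (simp add: wt_def norm_mult chi_mult chi_pos)
  next
    case 2
    then show ?thesis by (simp add: wt_def \<phi>_0)
  next
    case 3
    have "chi (of_real t * d) = chi (of_real (- t) * (- d))" by simp
    also have "\<dots> = chi (of_real (- t)) * chi (- d)" using 3 assms by (intro chi_mult) auto
    also have "\<dots> = - chi d" using 3 chi_pos[of "- t"] chi_minus[OF assms] by simp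
    finally have "chi (of_real t * d) = - chi d" .
    moreover have "norm (of_real t * d) = - (t * norm d)" using 3 by (simp add: norm_mult)
    ultimately show ?thesis by (simp add: wt_def \<phi>_minus)
  qed
qed

lemma wt_add:
  assumes "cr p q r = 0"
  shows "wt p q + wt q r = wt p r"
proof (cases "p = q")
  case True
  then show ?thesis by (simp add: wt_def \<phi>_0)
next
  case False
  define d where "d = q - p"
  have d: "d \<noteq> 0" using False by (simp add: d_def)
  have "Im ((r - p) / d) = 0" using assms by (simp add: cr_alt Im_divide algebra_simps d_def)
  then have "(r - p) / d = of_real (Re ((r - p) / d))" by (simp add: complex_eq_iff)
  then have "r = p + of_real (Re ((r - p) / d)) * d" using d by (simp add: field_simps)
  then obtain t where t: "r = p + of_real t * d" by blast
  have q: "q = p + of_real 1 * d" by (simp add: d_def)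
  have "r = q + of_real (t - 1) * d" using t q by (simp add: algebra_simps)
  then have "wt q r = of_real (\<phi> ((t - 1) * norm d)) * chi d" using wt_line[OF d, of q "t - 1"] by (simp only:)
  moreover have "wt p q = of_real (\<phi> (1 * norm d)) * chi d" using wt_line[OF d, of p 1] unfolding q[symmetric] .
  moreover have "wt p r = of_real (\<phi> (t * norm d)) * chi d" using wt_line[OF d, of p t] unfolding t[symmetric] .
  moreover have "\<phi> (t * norm d) = \<phi> ((t - 1) * norm d) + \<phi> (1 * norm d)"
    using \<phi>_add[of "(t - 1) * norm d" "1 * norm d"] by (simp add: algebra_simps)
  ultimately show ?thesis by (simp add: algebra_simps)
qed

text \<open>Going round, each edge direction is the reversed previous one turned by the corner
  between them: a corner contributes its factor and a reversal a -1.\<close>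

lemma wt_triangle:
  assumes nd: "cr A B C \<noteq> 0" and B: "g (cang A B C) = of_int m" and C: "g (cang A C B) = of_int n"
  shows "wt A B + wt B C + wt C A = chi (B - A) * of_real (\<phi> (norm (B - A)) -
    (if even m then 1 else -1) * \<phi> (norm (C - B)) + (if even m then 1 else -1) * (if even n then 1 else -1) * \<phi> (norm (A - C)))"
proof -
  have ne: "A \<noteq> B" "B \<noteq> C" "C \<noteq> A" using nd by auto
  have c1: "cr B A C \<noteq> 0" "cr C B A \<noteq> 0" using nd cr_swap[of A B C] cr_rotate[of B A C] by auto
  have "chi (C - B) = (if even m then 1 else -1) * chi (A - B)" by (rule chi_corner[OF c1(1) B])
  also have "chi (A - B) = - chi (B - A)" using chi_minus[of "B - A"] ne by simp
  finally have 1: "chi (C - B) = (if even m then 1 else -1) * - chi (B - A)" .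
  have "g (cang B C A) = of_int n" using C cang_commute[of B C A] by simp
  then have "chi (A - C) = (if even n then 1 else -1) * chi (B - C)" by (rule chi_corner[OF c1(2)])
  also have "chi (B - C) = - chi (C - B)" using chi_minus[of "C - B"] ne by simp
  finally have 2: "chi (A - C) = (if even n then 1 else -1) * - chi (C - B)" .
  show ?thesis unfolding wt_def 2 1 by (simp add: algebra_simps)
qed

end

section \<open>The law of sines\<close>

lemma cang_sin:
  assumes "cr A B C \<noteq> 0"
  shows "sin (cang B A C) = \<bar>cr A B C\<bar> / (norm (B - A) * norm (C - A))"
proof -
  have *: "sin (cang B A C) = cr A B C / (norm (B - A) * norm (C - A))" if d: "cr A B C > 0" for A B C
  proof -
    define z where "z = (C - A) / (B - A)"
    have ne: "B \<noteq> A" "C \<noteq> A" using d by auto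
    then have "sin (Arg z) = Im z / norm z" by (intro sin_Arg) (simp add: z_def)
    also have "Im z = cr A B C / (norm (B - A))\<^sup>2" unfolding z_def by (rule Im_div_cr)
    also have "norm z = norm (C - A) / norm (B - A)" by (simp add: z_def norm_divide)
    finally show ?thesis using Arg_eq_cang[OF d] ne by (simp add: z_def field_simps power2_eq_square)
  qed
  show ?thesis
  proof (cases "cr A B C > 0")
    case False
    then have "cr A C B > 0" using assms cr_swap(2)[of A C B] by linarith
    from *[OF this] show ?thesis using False assms cr_swap(2)[of A C B] cang_commute[of C A B] by (simp add: mult.commute)
  qed (use * in auto)
qed

lemma law_of_sines:
  assumes "cr A B C \<noteq> 0"
  obtains k where "k > 0" "norm (C - B) = k * sin (cang B A C)" "norm (A - C) = k * sin (cang A B C)" "norm (B - A) = k * sin (cang A C B)"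
proof -
  have ne: "A \<noteq> B" "B \<noteq> C" "C \<noteq> A" using assms by auto
  define d where "d = \<bar>cr A B C\<bar>"
  have d: "d > 0" using assms by (simp add: d_def)
  have e: "\<bar>cr B A C\<bar> = d" "\<bar>cr C A B\<bar> = d" using cr_swap[of A B C] cr_rotate[of A B C] by (auto simp: d_def)
  have nd: "cr B A C \<noteq> 0" "cr C A B \<noteq> 0" using e d by auto
  have n: "norm (A - B) = norm (B - A)" "norm (A - C) = norm (C - A)" "norm (B - C) = norm (C - B)"
    by (simp_all add: norm_minus_commute)
  have p: "norm (B - A) > 0" "norm (C - B) > 0" "norm (C - A) > 0" using ne by auto
  show thesis
  proof (rule that[of "norm (B - A) * norm (C - B) * norm (C - A) / d"])
    show "norm (B - A) * norm (C - B) * norm (C - A) / d > 0" using p d by simp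
    show "norm (C - B) = norm (B - A) * norm (C - B) * norm (C - A) / d * sin (cang B A C)"
      unfolding cang_sin[OF assms] using p d by (simp add: d_def[symmetric] field_simps)
    show "norm (A - C) = norm (B - A) * norm (C - B) * norm (C - A) / d * sin (cang A B C)"
      unfolding cang_sin[OF nd(1)] e n using p d by (simp add: field_simps)
    show "norm (B - A) = norm (B - A) * norm (C - B) * norm (C - A) / d * sin (cang A C B)"
      unfolding cang_sin[OF nd(2)] e n using p d by (simp add: field_simps)
  qed
qed

context tile_tiling
begin

text \<open>If the signed perimeter were no rational multiple of c + a - b, some additive
  \<open>\<phi>\<close> would vanish on the latter and be 1 on the former. But the twisted lengths
  of every tile cancel, hence so do those of the big triangle.\<close>

theorem signed_perimeter:
  assumes sums: "nB X + nB Y + nB Z = 3"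
    and angX: "cang Y X Z = nA X * \<alpha> + nB X * \<beta>" and angY: "cang X Y Z = nA Y * \<alpha> + nB Y * \<beta>"
    and angZ: "cang X Z Y = nA Z * \<alpha> + nB Z * \<beta>" and pos: "c + a - b > 0"
  shows "\<exists>m\<in>\<rat>. (-1) ^ nB X * norm (Z - Y) + (-1) ^ nB Y * norm (X - Z) + (-1) ^ nB Z * norm (Y - X) = m * (c + a - b)"
proof (rule ccontr)
  define S where "S = (-1) ^ nB X * norm (Z - Y) + (-1) ^ nB Y * norm (X - Z) + (-1) ^ nB Z * norm (Y - X)"
  assume "\<not> ?thesis"
  then have "\<And>q. q \<in> \<rat> \<Longrightarrow> S \<noteq> q * (c + a - b)" unfolding S_def by blast
  then obtain \<phi> :: "real \<Rightarrow> real" where \<phi>: "\<And>s t. \<phi> (s + t) = \<phi> s + \<phi> t" "\<phi> (c + a - b) = 0" "\<phi> S = 1"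
    using additive_extension[of "c + a - b" S 0 1] pos by auto
  have "\<alpha> \<noteq> q * (pi / 3)" if "q \<in> \<rat>" for q using irr[of "q / 3"] that by auto
  \<comment> \<open>With \<alpha> mapped to 0 and \<pi>/3 to 1, \<beta> gets 1, 2\<pi>/3 gets 2 and
    \<pi> the required 3; a corner gets its number of \<beta>.\<close>
  then obtain g :: "real \<Rightarrow> real" where g: "\<And>s t. g (s + t) = g s + g t" "g (pi / 3) = 1" "g \<alpha> = 0"
    using additive_extension[of "pi / 3" \<alpha> 1 0] by auto
  have gpi: "g pi = 3"
    using g(1)[of "pi / 3" "pi / 3"] g(1)[of "pi / 3 + pi / 3" "pi / 3"] g(2) by simp
  interpret weight g \<phi> using g(1) gpi \<phi>(1) by unfold_locales
  have g\<beta>: "g \<beta> = 1" using g(1)[of \<alpha> \<beta>] ab_sum g(2,3) by simp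
  have g\<gamma>: "g (2 * pi / 3) = 2" using g(1)[of "pi / 3" "pi / 3"] g(2) by simp
  have corner: "g (real p * \<alpha> + real q * \<beta>) = real q" for p q using g\<beta> g(3) by (simp add: add g_nat)
  have \<phi>rel: "\<phi> c + \<phi> a - \<phi> b = 0"
    using \<phi>(1)[of "c + a" "- b"] \<phi>(1)[of c a] \<phi>(2) \<phi>_minus[of b] by simp
  then have \<phi>b: "\<phi> b = \<phi> c + \<phi> a" by simp
  have "wt (tA i) (tB i) + wt (tB i) (tC i) + wt (tC i) (tA i) = 0" if i: "i \<in> I" for i
  proof -
    have "g (cang (tA i) (tB i) (tC i)) = of_int 1" "g (cang (tA i) (tC i) (tB i)) = of_int 2"
      unfolding angs[OF i] g\<beta> g\<gamma> by simp_all
    from wt_triangle[OF nondeg[OF i] this] show ?thesis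
      using lens[OF i] \<phi>b by (simp add: norm_minus_commute)
  qed
  then have "sgn (cr X Y Z) *\<^sub>R (wt X Y + wt Y Z + wt Z X) = 0"
    using boundary_sum[of wt] wt_add by simp
  then have 0: "wt X Y + wt Y Z + wt Z X = 0" using NONDEG by (simp add: sgn_zero_iff)
  have gY: "g (cang X Y Z) = of_int (int (nB Y))" and gZ: "g (cang X Z Y) = of_int (int (nB Z))"
    unfolding angY angZ corner by simp_all
  have "chi (Y - X) \<noteq> 0" by (simp add: chi_def)
  then have "\<phi> (norm (Y - X)) - (if even (int (nB Y)) then 1 else -1) * \<phi> (norm (Z - Y)) +
     (if even (int (nB Y)) then 1 else -1) * (if even (int (nB Z)) then 1 else -1) * \<phi> (norm (X - Z)) = 0"
    using 0 unfolding wt_triangle[OF NONDEG gY gZ] by (metis mult_eq_0_iff of_real_eq_0_iff)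
  then have eq: "\<phi> (norm (Y - X)) - (-1) ^ nB Y * \<phi> (norm (Z - Y)) + (-1) ^ nB Y * (-1) ^ nB Z * \<phi> (norm (X - Z)) = 0"
    by (simp add: minus_one_power_iff)
  have sg: "\<phi> ((-1) ^ n * t) = (-1) ^ n * \<phi> t" for n :: nat and t
    by (cases "even n") (simp_all add: \<phi>_minus)
  have "\<phi> S = (-1) ^ nB X * \<phi> (norm (Z - Y)) + (-1) ^ nB Y * \<phi> (norm (X - Z)) + (-1) ^ nB Z * \<phi> (norm (Y - X))"
    unfolding S_def \<phi>(1) sg ..
  also have "\<dots> = (-1) ^ nB Z * (\<phi> (norm (Y - X)) - (-1) ^ nB Y * \<phi> (norm (Z - Y)) + (-1) ^ nB Y * (-1) ^ nB Z * \<phi> (norm (X - Z)))"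
  proof -
    \<comment> \<open>Oddness turns the sign of the side from Y to Z, minus the product of the signs
      at Y and Z, into the sign at X: each side carries the sign of the opposite corner.\<close>
    have "odd (nB X + nB Y + nB Z)" unfolding sums by simp
    then show ?thesis
      by (cases "even (nB X)"; cases "even (nB Y)"; cases "even (nB Z)") (simp_all add: minus_one_power_iff)
  qed
  finally show False using eq \<phi>(3) by simp
qed

end

section \<open>The arithmetic of the corner angles\<close>

text \<open>\<open>f p q\<close> is the sine of \<open>p \<alpha> + q \<beta>\<close> in units of \<open>sin \<alpha>\<close>; \<open>\<rho>\<close> and \<open>c\<close> are the sides
  opposite \<open>\<beta>\<close> and \<open>2\<pi>/3\<close> in units of the side opposite \<open>\<alpha>\<close>.\<close>

locale tile_ratio =
  fixes \<alpha> \<beta> \<rho> c :: real and f :: "nat \<Rightarrow> nat \<Rightarrow> real"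
  assumes pos: "\<alpha> > 0" "\<beta> > 0" and sum: "\<alpha> + \<beta> = pi / 3"
    and \<rho>: "sin \<beta> = \<rho> * sin \<alpha>" and c: "sin (pi / 3) = c * sin \<alpha>"
    and f: "\<And>p q. sin (real p * \<alpha> + real q * \<beta>) = f p q * sin \<alpha>"
begin

lemma sin_pos: "sin \<alpha> > 0" "sin \<beta> > 0"
  using pos sum by (auto intro!: sin_gt_zero)

lemma c_pos: "c > 0" "\<rho> > 0"
  using sin_pos sin_60 c \<rho> by (auto simp: zero_less_mult_iff) (metis divide_pos_pos real_sqrt_gt_0_iff zero_less_mult_pos zero_less_mult_pos2 zero_less_numeral)+

text \<open>Expand sin \<beta> = sin (\<pi>/3 - \<alpha>) and sin \<alpha> = sin (\<pi>/3 -
  \<beta>), and divide by sin \<alpha>.\<close>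

lemma cos_values: "cos \<alpha> = (2 * \<rho> + 1) / (2 * c)" "cos \<beta> = (2 + \<rho>) / (2 * c)"
proof -
  have b: "\<beta> = pi / 3 - \<alpha>" "\<alpha> = pi / 3 - \<beta>" using sum by simp_all
  have "sin \<beta> = sin (pi / 3) * cos \<alpha> - cos (pi / 3) * sin \<alpha>" unfolding b(1) by (rule sin_diff)
  then have "\<rho> * sin \<alpha> = c * sin \<alpha> * cos \<alpha> - 1 / 2 * sin \<alpha>" unfolding \<rho> c cos_60 .
  then have "(c * cos \<alpha> - 1 / 2 - \<rho>) * sin \<alpha> = 0" by (simp add: algebra_simps)
  then have "c * cos \<alpha> - 1 / 2 - \<rho> = 0" using sin_pos by simp
  then show "cos \<alpha> = (2 * \<rho> + 1) / (2 * c)" using c_pos by (simp add: field_simps)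
  have "sin \<alpha> = sin (pi / 3) * cos \<beta> - cos (pi / 3) * sin \<beta>" by (subst b(2)) (rule sin_diff)
  then have "sin \<alpha> = c * sin \<alpha> * cos \<beta> - 1 / 2 * (\<rho> * sin \<alpha>)" unfolding \<rho> c cos_60 .
  then have "(c * cos \<beta> - \<rho> / 2 - 1) * sin \<alpha> = 0" by (simp add: algebra_simps)
  then have "c * cos \<beta> - \<rho> / 2 - 1 = 0" using sin_pos by simp
  then show "cos \<beta> = (2 + \<rho>) / (2 * c)" using c_pos by (simp add: field_simps)
qed

lemma sin_sq: "(sin \<alpha>)\<^sup>2 = 3 / (4 * c\<^sup>2)"
proof -
  have "(c * sin \<alpha>)\<^sup>2 = 3 / 4" unfolding c[symmetric] sin_60 by (simp add: power_divide)
  then show ?thesis using c_pos by (simp add: field_simps power_mult_distrib)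
qed

text \<open>The law of cosines at the angle 2\<pi>/3.\<close>

lemma c_sq: "c\<^sup>2 = 1 + \<rho> + \<rho>\<^sup>2"
proof -
  have "(sin \<alpha>)\<^sup>2 + (cos \<alpha>)\<^sup>2 = 1" by simp
  then have "3 / (4 * c\<^sup>2) + (2 * \<rho> + 1)\<^sup>2 / (4 * c\<^sup>2) = 1" unfolding sin_sq cos_values by (simp add: power_divide)
  then have "3 + (2 * \<rho> + 1)\<^sup>2 = 4 * c\<^sup>2" using c_pos by (simp add: field_simps)
  then show ?thesis by (simp add: power2_eq_square algebra_simps)
qed

lemma f_eqI: "sin (real p * \<alpha> + real q * \<beta>) = x * sin \<alpha> \<Longrightarrow> f p q = x"
  using f[of p q] sin_pos by simp

text \<open>Three nonempty corners leave at most four of the six angles to one of them, so these are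
  all corner types except (2, 2). Since 3\<alpha> + 3\<beta> = \<pi>, the types (p, q) and (3 - p, 3
  - q) have the same sine.\<close>

lemma f_values:
  "f 1 0 = 1" "f 0 1 = \<rho>" "f 1 1 = c" "f 2 0 = (2 * \<rho> + 1) / c" "f 0 2 = \<rho> * (2 + \<rho>) / c"
  "f 2 1 = 1 + \<rho>" "f 1 2 = 1 + \<rho>" "f 3 0 = 3 * (\<rho> + \<rho>\<^sup>2) / c\<^sup>2" "f 0 3 = 3 * (\<rho> + \<rho>\<^sup>2) / c\<^sup>2"
  "f 3 1 = \<rho> * (2 + \<rho>) / c" "f 1 3 = (2 * \<rho> + 1) / c"
proof -
  have b: "\<beta> = pi / 3 - \<alpha>" "\<alpha> = pi / 3 - \<beta>" using sum by simp_all
  show "f 1 0 = 1" "f 0 1 = \<rho>" "f 1 1 = c" by (rule f_eqI; simp add: \<rho> sum c)+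
  have s2: "sin (2 * \<alpha>) = (2 * \<rho> + 1) / c * sin \<alpha>" unfolding sin_double cos_values by simp
  have s2': "sin (2 * \<beta>) = \<rho> * (2 + \<rho>) / c * sin \<alpha>" unfolding sin_double cos_values \<rho> by simp
  show f20: "f 2 0 = (2 * \<rho> + 1) / c" by (rule f_eqI) (use s2 in simp)
  show f02: "f 0 2 = \<rho> * (2 + \<rho>) / c" by (rule f_eqI) (use s2' in simp)
  have "2 * \<alpha> + \<beta> = pi / 3 + \<alpha>" using sum by simp
  then have "sin (2 * \<alpha> + \<beta>) = sin (pi / 3) * cos \<alpha> + cos (pi / 3) * sin \<alpha>" by (simp only: sin_add)
  also have "\<dots> = (1 + \<rho>) * sin \<alpha>" unfolding c cos_values cos_60 using c_pos by (simp add: field_simps)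
  finally have s21: "sin (2 * \<alpha> + \<beta>) = (1 + \<rho>) * sin \<alpha>" .
  then show "f 2 1 = 1 + \<rho>" by (intro f_eqI) simp
  have "\<alpha> + 2 * \<beta> = pi - (2 * \<alpha> + \<beta>)" using sum by simp
  then have "sin (\<alpha> + 2 * \<beta>) = (1 + \<rho>) * sin \<alpha>" using s21 by (simp only: sin_pi_minus)
  then show "f 1 2 = 1 + \<rho>" by (intro f_eqI) simp
  have "sin (3 * \<alpha>) = sin (2 * \<alpha> + \<alpha>)" by simp
  also have "\<dots> = 2 * sin \<alpha> * (cos \<alpha>)\<^sup>2 + (1 - 2 * (sin \<alpha>)\<^sup>2) * sin \<alpha>"
    unfolding sin_add sin_double cos_double_sin by (simp add: power2_eq_square algebra_simps)
  also have "(cos \<alpha>)\<^sup>2 = 1 - (sin \<alpha>)\<^sup>2" by (simp add: cos_squared_eq)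
  also have "2 * sin \<alpha> * (1 - (sin \<alpha>)\<^sup>2) + (1 - 2 * (sin \<alpha>)\<^sup>2) * sin \<alpha> = (3 - 4 * (sin \<alpha>)\<^sup>2) * sin \<alpha>"
    by (simp add: algebra_simps)
  also have "3 - 4 * (sin \<alpha>)\<^sup>2 = 3 * (\<rho> + \<rho>\<^sup>2) / c\<^sup>2"
  proof -
    have "\<rho> + \<rho>\<^sup>2 = c\<^sup>2 - 1" using c_sq by simp
    then show ?thesis unfolding sin_sq using c_pos by (simp only:) (simp add: field_simps)
  qed
  finally have s3: "sin (3 * \<alpha>) = 3 * (\<rho> + \<rho>\<^sup>2) / c\<^sup>2 * sin \<alpha>" .
  then show "f 3 0 = 3 * (\<rho> + \<rho>\<^sup>2) / c\<^sup>2" by (intro f_eqI) simp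
  have "3 * \<beta> = pi - 3 * \<alpha>" using sum by simp
  then have "sin (3 * \<beta>) = 3 * (\<rho> + \<rho>\<^sup>2) / c\<^sup>2 * sin \<alpha>" using s3 by (simp only: sin_pi_minus)
  then show "f 0 3 = 3 * (\<rho> + \<rho>\<^sup>2) / c\<^sup>2" by (intro f_eqI) simp
  have "3 * \<alpha> + \<beta> = pi - 2 * \<beta>" "\<alpha> + 3 * \<beta> = pi - 2 * \<alpha>" using sum by simp_all
  then have "sin (3 * \<alpha> + \<beta>) = \<rho> * (2 + \<rho>) / c * sin \<alpha>" "sin (\<alpha> + 3 * \<beta>) = (2 * \<rho> + 1) / c * sin \<alpha>"
    using s2 s2' by (simp_all only: sin_pi_minus)
  then show "f 3 1 = \<rho> * (2 + \<rho>) / c" "f 1 3 = (2 * \<rho> + 1) / c" by (intro f_eqI; simp)+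
qed

text \<open>The corners have angles \<open>p\<^sub>i \<alpha> + q\<^sub>i \<beta>\<close>, and the signed perimeters for both characters are nonzero rational
  multiples of those of the tile.\<close>

definition bad :: "nat \<Rightarrow> nat \<Rightarrow> nat \<Rightarrow> nat \<Rightarrow> nat \<Rightarrow> nat \<Rightarrow> bool" where
  "bad p1 q1 p2 q2 p3 q3 \<longleftrightarrow> (\<exists>\<mu>>0. \<exists>m\<in>\<rat>. \<exists>n\<in>\<rat>. m \<noteq> 0 \<and> n \<noteq> 0 \<and>
     \<mu> * ((-1) ^ q1 * f p1 q1 + (-1) ^ q2 * f p2 q2 + (-1) ^ q3 * f p3 q3) = m * (c + 1 - \<rho>) \<and>
     \<mu> * ((-1) ^ p1 * f p1 q1 + (-1) ^ p2 * f p2 q2 + (-1) ^ p3 * f p3 q3) = n * (c + \<rho> - 1))"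

lemma bad_perm1: "bad p1 q1 p2 q2 p3 q3 \<longleftrightarrow> bad p2 q2 p1 q1 p3 q3"
  unfolding bad_def by (simp add: add.commute add.left_commute)

lemma bad_perm2: "bad p1 q1 p2 q2 p3 q3 \<longleftrightarrow> bad p1 q1 p3 q3 p2 q2"
  unfolding bad_def by (simp add: add.commute add.left_commute)

section \<open>Comparing rational and irrational parts\<close>

context
  assumes rat: "\<rho> \<in> \<rat>" and ne1: "\<rho> \<noteq> 1" and irrat: "c \<notin> \<rat>"
begin

lemma rat_lin:
  assumes "x + y * c = 0" "x \<in> \<rat>" "y \<in> \<rat>"
  shows "x = 0 \<and> y = 0"
proof -
  have "y = 0"
  proof (rule ccontr)
    assume "y \<noteq> 0"
    then have "c = - x / y" using assms(1) by (simp add: field_simps)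
    then show False using irrat assms(2,3) by simp
  qed
  then show ?thesis using assms(1) by simp
qed

text \<open>Cross-multiplying the two equations of \<open>bad\<close> eliminates
  \<open>\<mu>\<close>. As \<open>c\<^sup>2\<close> is rational by \<open>c_sq\<close>, the
  coefficients of 1 and \<open>c\<close> vanish separately, which gives the two premises of
  \<open>sol\<close>. The factor \<open>k\<close> clears powers of \<open>c\<close> from
  denominators.\<close>

lemma not_bad_core:
  assumes "k > 0" "k * ((-1) ^ q1 * f p1 q1 + (-1) ^ q2 * f p2 q2 + (-1) ^ q3 * f p3 q3) = x + y * c"
    and "k * ((-1) ^ p1 * f p1 q1 + (-1) ^ p2 * f p2 q2 + (-1) ^ p3 * f p3 q3) = x' + y' * c"
    and r: "x \<in> \<rat>" "y \<in> \<rat>" "x' \<in> \<rat>" "y' \<in> \<rat>"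
    and sol: "\<And>m n. n * (y * (1 + \<rho> + \<rho>\<^sup>2) + x * (\<rho> - 1)) = m * (y' * (1 + \<rho> + \<rho>\<^sup>2) + x' * (1 - \<rho>)) \<Longrightarrow>
       n * (x + y * (\<rho> - 1)) = m * (x' + y' * (1 - \<rho>)) \<Longrightarrow> m = 0 \<or> n = 0"
  shows "\<not> bad p1 q1 p2 q2 p3 q3"
proof
  assume "bad p1 q1 p2 q2 p3 q3"
  then obtain \<mu> m n where b: "\<mu> > 0" "m \<in> \<rat>" "n \<in> \<rat>" "m \<noteq> 0" "n \<noteq> 0"
     "\<mu> * ((-1) ^ q1 * f p1 q1 + (-1) ^ q2 * f p2 q2 + (-1) ^ q3 * f p3 q3) = m * (c + 1 - \<rho>)"
     "\<mu> * ((-1) ^ p1 * f p1 q1 + (-1) ^ p2 * f p2 q2 + (-1) ^ p3 * f p3 q3) = n * (c + \<rho> - 1)"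
    unfolding bad_def by blast
  define P where "P = (-1) ^ q1 * f p1 q1 + (-1) ^ q2 * f p2 q2 + (-1) ^ q3 * f p3 q3"
  define Q where "Q = (-1) ^ p1 * f p1 q1 + (-1) ^ p2 * f p2 q2 + (-1) ^ p3 * f p3 q3"
  have e: "\<mu> * P = m * (c + 1 - \<rho>)" "\<mu> * Q = n * (c + \<rho> - 1)" "k * P = x + y * c" "k * Q = x' + y' * c"
    using b(6,7) assms(2,3) by (simp_all add: P_def Q_def)
  have "\<mu> * (n * (c + \<rho> - 1) * (x + y * c)) = \<mu> * (m * (c + 1 - \<rho>) * (x' + y' * c))"
  proof -
    have "\<mu> * (n * (c + \<rho> - 1) * (x + y * c)) = k * (n * (c + \<rho> - 1)) * (\<mu> * P)" unfolding e(3)[symmetric] by simp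
    also have "\<dots> = k * (\<mu> * Q) * (m * (c + 1 - \<rho>))" unfolding e(1,2) by simp
    also have "\<dots> = \<mu> * (m * (c + 1 - \<rho>) * (k * Q))" by simp
    finally show ?thesis unfolding e(4) .
  qed
  then have "n * (c + \<rho> - 1) * (x + y * c) = m * (c + 1 - \<rho>) * (x' + y' * c)" using b(1) by simp
  then have "n * (y * c\<^sup>2 + x * (\<rho> - 1)) - m * (y' * c\<^sup>2 + x' * (1 - \<rho>)) +
     (n * (x + y * (\<rho> - 1)) - m * (x' + y' * (1 - \<rho>))) * c = 0"
    by (simp add: power2_eq_square algebra_simps)
  then have "n * (y * c\<^sup>2 + x * (\<rho> - 1)) - m * (y' * c\<^sup>2 + x' * (1 - \<rho>)) = 0 \<and>
     n * (x + y * (\<rho> - 1)) - m * (x' + y' * (1 - \<rho>)) = 0"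
    using rat r b(2,3) by (intro rat_lin) (auto simp: c_sq)
  then show False using sol[of n m] b(4,5) by (auto simp: c_sq)
qed

text \<open>With equal parities the two signed perimeters coincide, which forces m = n and (m + n)(1
  - \<rho>) = 0. This is where the tile must not be isosceles.\<close>

lemma not_bad_even:
  assumes "even p1 \<longleftrightarrow> even q1" "even p2 \<longleftrightarrow> even q2" "even p3 \<longleftrightarrow> even q3"
  shows "\<not> bad p1 q1 p2 q2 p3 q3"
proof
  assume "bad p1 q1 p2 q2 p3 q3"
  then obtain \<mu> m n where b: "\<mu> > 0" "m \<in> \<rat>" "n \<in> \<rat>" "m \<noteq> 0" "n \<noteq> 0"
     "\<mu> * ((-1) ^ q1 * f p1 q1 + (-1) ^ q2 * f p2 q2 + (-1) ^ q3 * f p3 q3) = m * (c + 1 - \<rho>)"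
     "\<mu> * ((-1) ^ p1 * f p1 q1 + (-1) ^ p2 * f p2 q2 + (-1) ^ p3 * f p3 q3) = n * (c + \<rho> - 1)"
    unfolding bad_def by blast
  have "((-1) ^ p1 :: real) = (-1) ^ q1" "((-1) ^ p2 :: real) = (-1) ^ q2" "((-1) ^ p3 :: real) = (-1) ^ q3"
    using assms by (simp_all add: minus_one_power_iff)
  then have "m * (c + 1 - \<rho>) = n * (c + \<rho> - 1)" using b(6,7) by simp
  then have "(m + n) * (1 - \<rho>) + (m - n) * c = 0" by (simp add: algebra_simps)
  then have "(m + n) * (1 - \<rho>) = 0 \<and> m - n = 0" using rat b(2,3) by (intro rat_lin) auto
  then show False using ne1 b(4) by auto
qed

text \<open>Up to the order of the corners these types are what \<open>not_bad_even\<close> and the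
  exclusion of (2, 2) leave over. Each time the two rational equations amount to m + n = 0 and m - n
  = 0, up to factors that do not vanish for positive \<rho>.\<close>

lemma not_bad_types:
  "\<not> bad 3 1 0 1 0 1" "\<not> bad 1 3 1 0 1 0" "\<not> bad 3 0 0 1 0 2" "\<not> bad 0 3 1 0 2 0" "\<not> bad 2 1 1 0 0 2" "\<not> bad 1 2 0 1 2 0" "\<not> bad 2 1 1 1 0 1" "\<not> bad 1 2 1 1 1 0"
proof -
  note [simp] = f_values f_values[simplified]
  have c0: "c > 0" "c \<noteq> 0" "\<rho> > 0" "\<rho> \<noteq> 0" "1 + \<rho> \<noteq> 0" "\<rho> + 2 \<noteq> 0" "1 + 2 * \<rho> \<noteq> 0" using c_pos by auto
  have zero: "m = 0 \<or> n = 0" if "m + n = 0" "m - n = 0" for m n :: real using that by simp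
  show "\<not> bad 3 1 0 1 0 1"
  \<comment> \<open>The last four witnesses are the rational coefficients of 1 and \<open>c\<close>
    in the two signed perimeters, multiplied by the first witness.\<close>
  proof (rule not_bad_core[of "c" _ _ _ _ _ _ "- (\<rho> * (2 + \<rho>))" "- (2 * \<rho>)" "- (\<rho> * (2 + \<rho>))" "2 * \<rho>"])
    fix m n :: real
    assume "n * ((- (2 * \<rho>)) * (1 + \<rho> + \<rho>\<^sup>2) + (- (\<rho> * (2 + \<rho>))) * (\<rho> - 1)) = m * ((2 * \<rho>) * (1 + \<rho> + \<rho>\<^sup>2) + (- (\<rho> * (2 + \<rho>))) * (1 - \<rho>))"
      and "n * (- (\<rho> * (2 + \<rho>)) + (- (2 * \<rho>)) * (\<rho> - 1)) = m * (- (\<rho> * (2 + \<rho>)) + (2 * \<rho>) * (1 - \<rho>))"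
    then have "3 * \<rho>\<^sup>2 * (1 + \<rho>) * (m + n) = 0" "3 * \<rho>\<^sup>2 * (m - n) = 0" by algebra+
    then show "m = 0 \<or> n = 0" using c0 by (intro zero) simp_all
  qed (use c0 rat in \<open>simp_all add: field_simps power2_eq_square \<close>)
  show "\<not> bad 1 3 1 0 1 0"
  proof (rule not_bad_core[of "c" _ _ _ _ _ _ "- (2 * \<rho> + 1)" "2" "- (2 * \<rho> + 1)" "- 2"])
    fix m n :: real
    assume "n * ((2) * (1 + \<rho> + \<rho>\<^sup>2) + (- (2 * \<rho> + 1)) * (\<rho> - 1)) = m * ((- 2) * (1 + \<rho> + \<rho>\<^sup>2) + (- (2 * \<rho> + 1)) * (1 - \<rho>))"
      and "n * (- (2 * \<rho> + 1) + (2) * (\<rho> - 1)) = m * (- (2 * \<rho> + 1) + (- 2) * (1 - \<rho>))"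
    then have "3 * (1 + \<rho>) * (m + n) = 0" "3 * (m - n) = 0" by algebra+
    then show "m = 0 \<or> n = 0" using c0 by (intro zero) simp_all
  qed (use c0 rat in \<open>simp_all add: field_simps power2_eq_square \<close>)
  show "\<not> bad 3 0 0 1 0 2"
  proof (rule not_bad_core[of "c\<^sup>2" _ _ _ _ _ _ "3 * (\<rho> + \<rho>\<^sup>2) - \<rho> * (1 + \<rho> + \<rho>\<^sup>2)" "\<rho> * (2 + \<rho>)" "\<rho> * (1 + \<rho> + \<rho>\<^sup>2) - 3 * (\<rho> + \<rho>\<^sup>2)" "\<rho> * (2 + \<rho>)"])
    fix m n :: real
    assume "n * ((\<rho> * (2 + \<rho>)) * (1 + \<rho> + \<rho>\<^sup>2) + (3 * (\<rho> + \<rho>\<^sup>2) - \<rho> * (1 + \<rho> + \<rho>\<^sup>2)) * (\<rho> - 1)) = m * ((\<rho> * (2 + \<rho>)) * (1 + \<rho> + \<rho>\<^sup>2) + (\<rho> * (1 + \<rho> + \<rho>\<^sup>2) - 3 * (\<rho> + \<rho>\<^sup>2)) * (1 - \<rho>))"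
      and "n * (3 * (\<rho> + \<rho>\<^sup>2) - \<rho> * (1 + \<rho> + \<rho>\<^sup>2) + (\<rho> * (2 + \<rho>)) * (\<rho> - 1)) = m * (\<rho> * (1 + \<rho> + \<rho>\<^sup>2) - 3 * (\<rho> + \<rho>\<^sup>2) + (\<rho> * (2 + \<rho>)) * (1 - \<rho>))"
    then have "3 * \<rho>\<^sup>2 * (1 + 2 * \<rho>) * (m - n) = 0" "3 * \<rho>\<^sup>2 * (m + n) = 0" by algebra+
    then show "m = 0 \<or> n = 0" using c0 by (intro zero) simp_all
  next
    show "c\<^sup>2 * ((-1) ^ 0 * f 3 0 + (-1) ^ 1 * f 0 1 + (-1) ^ 2 * f 0 2) = 3 * (\<rho> + \<rho>\<^sup>2) - \<rho> * (1 + \<rho> + \<rho>\<^sup>2) + \<rho> * (2 + \<rho>) * c"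
      unfolding c_sq[symmetric] using c0 by (simp add: field_simps power2_eq_square)
    show "c\<^sup>2 * ((-1) ^ 3 * f 3 0 + (-1) ^ 0 * f 0 1 + (-1) ^ 0 * f 0 2) = \<rho> * (1 + \<rho> + \<rho>\<^sup>2) - 3 * (\<rho> + \<rho>\<^sup>2) + \<rho> * (2 + \<rho>) * c"
      unfolding c_sq[symmetric] using c0 by (simp add: field_simps power2_eq_square)
  qed (use c0 rat in simp_all)
  show "\<not> bad 0 3 1 0 2 0"
  proof (rule not_bad_core[of "c\<^sup>2" _ _ _ _ _ _ "1 + \<rho> + \<rho>\<^sup>2 - 3 * (\<rho> + \<rho>\<^sup>2)" "2 * \<rho> + 1" "3 * (\<rho> + \<rho>\<^sup>2) - (1 + \<rho> + \<rho>\<^sup>2)" "2 * \<rho> + 1"])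
    fix m n :: real
    assume "n * ((2 * \<rho> + 1) * (1 + \<rho> + \<rho>\<^sup>2) + (1 + \<rho> + \<rho>\<^sup>2 - 3 * (\<rho> + \<rho>\<^sup>2)) * (\<rho> - 1)) = m * ((2 * \<rho> + 1) * (1 + \<rho> + \<rho>\<^sup>2) + (3 * (\<rho> + \<rho>\<^sup>2) - (1 + \<rho> + \<rho>\<^sup>2)) * (1 - \<rho>))"
      and "n * (1 + \<rho> + \<rho>\<^sup>2 - 3 * (\<rho> + \<rho>\<^sup>2) + (2 * \<rho> + 1) * (\<rho> - 1)) = m * (3 * (\<rho> + \<rho>\<^sup>2) - (1 + \<rho> + \<rho>\<^sup>2) + (2 * \<rho> + 1) * (1 - \<rho>))"
    then have "3 * \<rho> * (\<rho> + 2) * (m - n) = 0" "3 * \<rho> * (m + n) = 0" by algebra+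
    then show "m = 0 \<or> n = 0" using c0 by (intro zero) simp_all
  next
    show "c\<^sup>2 * ((-1) ^ 3 * f 0 3 + (-1) ^ 0 * f 1 0 + (-1) ^ 0 * f 2 0) = 1 + \<rho> + \<rho>\<^sup>2 - 3 * (\<rho> + \<rho>\<^sup>2) + (2 * \<rho> + 1) * c"
      unfolding c_sq[symmetric] using c0 by (simp add: field_simps power2_eq_square)
    show "c\<^sup>2 * ((-1) ^ 0 * f 0 3 + (-1) ^ 1 * f 1 0 + (-1) ^ 2 * f 2 0) = 3 * (\<rho> + \<rho>\<^sup>2) - (1 + \<rho> + \<rho>\<^sup>2) + (2 * \<rho> + 1) * c"
      unfolding c_sq[symmetric] using c0 by (simp add: field_simps power2_eq_square)
  qed (use c0 rat in simp_all)
  show "\<not> bad 2 1 1 0 0 2"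
  proof (rule not_bad_core[of "c" _ _ _ _ _ _ "\<rho> * (2 + \<rho>)" "- \<rho>" "\<rho> * (2 + \<rho>)" "\<rho>"])
    fix m n :: real
    assume "n * ((- \<rho>) * (1 + \<rho> + \<rho>\<^sup>2) + (\<rho> * (2 + \<rho>)) * (\<rho> - 1)) = m * ((\<rho>) * (1 + \<rho> + \<rho>\<^sup>2) + (\<rho> * (2 + \<rho>)) * (1 - \<rho>))"
      and "n * (\<rho> * (2 + \<rho>) + (- \<rho>) * (\<rho> - 1)) = m * (\<rho> * (2 + \<rho>) + (\<rho>) * (1 - \<rho>))"
    then have "3 * \<rho> * (m + n) = 0" "3 * \<rho> * (m - n) = 0" by algebra+
    then show "m = 0 \<or> n = 0" using c0 by (intro zero) simp_all
  qed (use c0 rat in \<open>simp_all add: field_simps power2_eq_square \<close>)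
  show "\<not> bad 1 2 0 1 2 0"
  proof (rule not_bad_core[of "c" _ _ _ _ _ _ "2 * \<rho> + 1" "1" "2 * \<rho> + 1" "- 1"])
    fix m n :: real
    assume "n * ((1) * (1 + \<rho> + \<rho>\<^sup>2) + (2 * \<rho> + 1) * (\<rho> - 1)) = m * ((- 1) * (1 + \<rho> + \<rho>\<^sup>2) + (2 * \<rho> + 1) * (1 - \<rho>))"
      and "n * (2 * \<rho> + 1 + (1) * (\<rho> - 1)) = m * (2 * \<rho> + 1 + (- 1) * (1 - \<rho>))"
    then have "3 * \<rho>\<^sup>2 * (m + n) = 0" "3 * \<rho> * (m - n) = 0" by algebra+
    then show "m = 0 \<or> n = 0" using c0 by (intro zero) simp_all
  qed (use c0 rat in \<open>simp_all add: field_simps power2_eq_square \<close>)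
  show "\<not> bad 2 1 1 1 0 1"
  proof (rule not_bad_core[of "1" _ _ _ _ _ _ "- (1 + 2 * \<rho>)" "- 1" "1 + 2 * \<rho>" "- 1"])
    fix m n :: real
    assume "n * ((- 1) * (1 + \<rho> + \<rho>\<^sup>2) + (- (1 + 2 * \<rho>)) * (\<rho> - 1)) = m * ((- 1) * (1 + \<rho> + \<rho>\<^sup>2) + (1 + 2 * \<rho>) * (1 - \<rho>))"
      and "n * (- (1 + 2 * \<rho>) + (- 1) * (\<rho> - 1)) = m * (1 + 2 * \<rho> + (- 1) * (1 - \<rho>))"
    then have "3 * \<rho>\<^sup>2 * (m - n) = 0" "3 * \<rho> * (m + n) = 0" by algebra+
    then show "m = 0 \<or> n = 0" using c0 by (intro zero) simp_all
  qed (use c0 rat in \<open>simp_all add: field_simps power2_eq_square \<close>)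
  show "\<not> bad 1 2 1 1 1 0"
  proof (rule not_bad_core[of "1" _ _ _ _ _ _ "2 + \<rho>" "- 1" "- (2 + \<rho>)" "- 1"])
    fix m n :: real
    assume "n * ((- 1) * (1 + \<rho> + \<rho>\<^sup>2) + (2 + \<rho>) * (\<rho> - 1)) = m * ((- 1) * (1 + \<rho> + \<rho>\<^sup>2) + (- (2 + \<rho>)) * (1 - \<rho>))"
      and "n * (2 + \<rho> + (- 1) * (\<rho> - 1)) = m * (- (2 + \<rho>) + (- 1) * (1 - \<rho>))"
    then have "3 * (m - n) = 0" "3 * (m + n) = 0" by algebra+
    then show "m = 0 \<or> n = 0" using c0 by (intro zero) simp_all
  qed (use c0 rat in \<open>simp_all add: field_simps power2_eq_square \<close>)
qed

lemma not_bad: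
  assumes "p1 + p2 + p3 = 3" "q1 + q2 + q3 = 3" "p1 + q1 > 0" "p2 + q2 > 0" "p3 + q3 > 0"
    "\<not> (2, 2) \<in> {(p1, q1), (p2, q2), (p3, q3)}"
  shows "\<not> bad p1 q1 p2 q2 p3 q3"
proof -
  have enum: "(x, y, z) \<in> {(0, 0, 3), (0, 1, 2), (0, 2, 1), (0, 3, 0), (1, 0, 2), (1, 1, 1), (1, 2, 0), (2, 0, 1), (2, 1, 0), (3, 0, 0)}"
    if "x + y + z = 3" for x y z :: nat
  proof -
    have "x = 0 \<or> x = 1 \<or> x = 2 \<or> x = 3" "y = 0 \<or> y = 1 \<or> y = 2 \<or> y = 3" "z = 3 - x - y" using that by linarith+
    then show ?thesis using that by (elim disjE) simp_all
  qed
  have perms: "\<not> bad p2 q2 p1 q1 p3 q3 \<and> \<not> bad p1 q1 p3 q3 p2 q2 \<and> \<not> bad p2 q2 p3 q3 p1 q1 \<and>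
      \<not> bad p3 q3 p1 q1 p2 q2 \<and> \<not> bad p3 q3 p2 q2 p1 q1"
    if "\<not> bad p1 q1 p2 q2 p3 q3" for p1 q1 p2 q2 p3 q3
    using that bad_perm1 bad_perm2 by metis
  note facts = not_bad_types not_bad_types[THEN perms]
  show ?thesis using enum[OF assms(1)] enum[OF assms(2)] assms(3-6)
    by (simp only: insert_iff prod.inject empty_iff simp_thms, elim disjE conjE)
      (simp_all del: One_nat_def add: facts not_bad_even)
qed

end

end

section \<open>Commensurability of the sides\<close>

lemma strict_triangle:
  assumes "cr A B C \<noteq> 0"
  shows "norm (C - A) < norm (B - A) + norm (C - B)"
proof -
  have "norm (C - A) \<noteq> norm (C - B) + norm (B - A)"
  proof
    assume "norm (C - A) = norm (C - B) + norm (B - A)"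
    then have "dist C A = dist C B + dist B A" by (simp add: dist_norm)
    then have e: "norm (C - B) *\<^sub>R (B - A) = norm (B - A) *\<^sub>R (C - B)" by (simp only: dist_triangle_eq)
    have "norm (B - A) * cr A B C = Im (cnj (B - A) * (norm (B - A) *\<^sub>R (C - B)))"
      by (simp add: cr_alt algebra_simps)
    also have "\<dots> = 0" unfolding e[symmetric] by (simp add: algebra_simps)
    finally show False using assms by auto
  qed
  moreover have "norm (C - A) \<le> norm (C - B) + norm (B - A)" using norm_triangle_ineq[of "C - B" "B - A"] by simp
  ultimately show ?thesis by linarith
qed

lemma strict_triangles:
  assumes "cr A B C \<noteq> 0"
  shows "norm (A - C) < norm (B - A) + norm (C - B)" "norm (B - A) < norm (A - C) + norm (C - B)"
    "norm (C - B) < norm (B - A) + norm (A - C)"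
proof -
  have n: "cr A C B \<noteq> 0" "cr B A C \<noteq> 0" using assms cr_swap[of A B C] by auto
  show "norm (A - C) < norm (B - A) + norm (C - B)" using strict_triangle[OF assms] by (simp add: norm_minus_commute)
  show "norm (B - A) < norm (A - C) + norm (C - B)" using strict_triangle[OF n(1)] by (simp add: norm_minus_commute)
  show "norm (C - B) < norm (B - A) + norm (A - C)" using strict_triangle[OF n(2)] by (simp add: norm_minus_commute)
qed

text \<open>If the signs differ, the sum is, up to sign, two sides minus the third. This keeps the
  rational factors of the signed perimeters away from 0.\<close>

lemma signed_sum_nonzero:
  fixes x y z :: real and p q r :: nat
  assumes "x < y + z" "y < x + z" "z < x + y"
  shows "(-1) ^ p * x + (-1) ^ q * y + (-1) ^ r * z \<noteq> 0"
  using assms by (cases "even p"; cases "even q"; cases "even r") (simp_all add: minus_one_power_iff)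

context tile_tiling
begin

text \<open>Exchanging the vertices at \<alpha> and \<beta> only reverses orientations, but it turns
  results about a, \<alpha> and \<open>nB\<close> into results about b, \<beta> and
  \<open>nA\<close>: the second side relation and the second signed perimeter.\<close>

lemma swapped: "tile_tiling I tB tA tC X Y Z b a c \<beta> \<alpha>"
proof
  show "cr (tB i) (tA i) (tC i) \<noteq> 0" if "i \<in> I" for i using nondeg[OF that] cr_swap(1)[of "tB i" "tA i" "tC i"] by simp
  show "itri (tB i) (tA i) (tC i) \<inter> itri (tB j) (tA j) (tC j) = {}" if "i \<in> I" "j \<in> I" "i \<noteq> j" for i j
    using disj[OF that] tri_swap(2)[OF nondeg] that by simp
  show "(\<Union>i\<in>I. tri (tB i) (tA i) (tC i)) = tri X Y Z"
    using cover tri_swap(1)[OF nondeg] by simp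
  show "norm (tA i - tB i) = c" if "i \<in> I" for i using lens[OF that] by (simp add: norm_minus_commute)
  show "cang (tB i) (tC i) (tA i) = 2 * pi / 3" if "i \<in> I" for i
    using angs[OF that] cang_commute[of "tB i" "tC i" "tA i"] by simp
  show "\<beta> \<noteq> q * pi" if "q \<in> \<rat>" for q
  proof
    assume "\<beta> = q * pi"
    then have "\<alpha> = (1 / 3 - q) * pi" using ab_sum by (simp add: algebra_simps)
    then show False using irr[of "1 / 3 - q"] that by simp
  qed
qed (use fin NONDEG lens angs ab_pos ab_sum in auto)

theorem commensurable:
  assumes ns: "\<not> {#cang Y X Z, cang X Y Z, cang X Z Y#} = {#\<alpha>, \<beta>, 2 * pi / 3#}"
  shows "b / a \<in> \<rat> \<and> c / a \<in> \<rat>"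
proof -
  interpret sw: tile_tiling I tB tA tC X Y Z b a c \<beta> \<alpha> by (rule swapped)
  have swn: "sw.nA w = nB w" "sw.nB w = nA w" for w
    by (simp_all add: sw.nA_def sw.nB_def nA_def nB_def)
  have ct: "nA X + nA Y + nA Z = 3" "nB X + nB Y + nB Z = 3" "nC X = 0" "nC Y = 0" "nC Z = 0"
    and ang: "cang Y X Z = nA X * \<alpha> + nB X * \<beta>" "cang X Y Z = nA Y * \<alpha> + nB Y * \<beta>" "cang X Z Y = nA Z * \<alpha> + nB Z * \<beta>"
    using corner_types[OF ns] by blast+
  have "X \<in> tri X Y Z" using tri_hull[OF NONDEG] hull_inc[of X "{X, Y, Z}" convex] by simp
  then obtain i0 where i0: "i0 \<in> I" using cover by blast
  have pos: "a > 0" "b > 0" "c > 0" using a_pos i0 by blast+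
  have "card t30 < card stars" using ct by (rule star_count)
  from side_relation[OF this] obtain m i j k :: nat
    where r1: "real m * a = real i * a + real j * b + real k * c" "j + k > 0" by blast
  have "card sw.t30 < card sw.stars" by (rule sw.star_count) (simp_all only: swn ct)
  from sw.side_relation[OF this] obtain m' i' j' k' :: nat
    where r2: "real m' * b = real i' * b + real j' * a + real k' * c" "j' + k' > 0" by blast
  define M where "M = real m - real i"
  define M' where "M' = real m' - real i'"
  have Mr: "M \<in> \<rat>" "M' \<in> \<rat>" by (auto simp: M_def M'_def)
  have e1: "M * a = real j * b + real k * c" using r1(1) by (simp add: M_def algebra_simps)
  have e2: "M' * b = real j' * a + real k' * c" using r2(1) by (simp add: M'_def algebra_simps)
  have "real j' * a + real k' * c > 0"
    using r2(2) pos by (cases "j' > 0") (auto intro: add_pos_nonneg)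
  then have M'0: "M' > 0" using e2 pos by (metis zero_less_mult_pos2)
  have ba: "b / a \<in> \<rat>"
  proof (cases "k = 0")
    case True
    then have "b / a = M / real j" using e1 r1(2) pos by (simp add: field_simps)
    then show ?thesis using Mr by simp
  next
    case False
    \<comment> \<open>k' times the first relation and k times the second share the term k k' c.
      Eliminating it leaves a relation between a and b in which b has a positive
      coefficient.\<close>
    have "real k' * (M * a - real j * b) = real k * (M' * b - real j' * a)" unfolding e1 e2 by (simp add: algebra_simps)
    then have "(real k' * M + real k * real j') * a = (real k * M' + real k' * real j) * b" by (simp add: algebra_simps)
    moreover have "real k * M' + real k' * real j > 0" using False M'0 by (intro add_pos_nonneg) auto
    ultimately have "b / a = (real k' * M + real k * real j') / (real k * M' + real k' * real j)" using pos by (simp add: field_simps)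
    then show ?thesis using Mr by simp
  qed
  have "c / a \<in> \<rat>"
  proof (rule ccontr)
    assume nr: "c / a \<notin> \<rat>"
    obtain \<kappa> where \<kappa>: "\<kappa> > 0" "a = \<kappa> * sin \<alpha>" "b = \<kappa> * sin \<beta>" "c = \<kappa> * sin (2 * pi / 3)"
      using law_of_sines[OF nondeg[OF i0]] lens[OF i0] angs[OF i0] by (metis norm_minus_commute)
    have s3: "sin (2 * pi / 3) = sin (pi / 3)" using sin_pi_minus[of "pi / 3"] by (simp add: field_simps)
    have s\<alpha>: "sin \<alpha> > 0" using ab_pos ab_sum by (intro sin_gt_zero) auto
    define f where "f p q = sin (real p * \<alpha> + real q * \<beta>) / sin \<alpha>" for p q
    interpret tr: tile_ratio \<alpha> \<beta> "b / a" "c / a" f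
      by unfold_locales (use ab_pos ab_sum \<kappa> s\<alpha> s3 in \<open>simp_all add: f_def\<close>)
    have ne1: "b / a \<noteq> 1"
    proof
      assume "b / a = 1"
      then have "sin \<alpha> = sin \<beta>" using \<kappa>(1-3) pos by simp
      moreover have "- (pi / 2) \<le> \<alpha>" "\<alpha> \<le> pi / 2" "- (pi / 2) \<le> \<beta>" "\<beta> \<le> pi / 2" using ab_pos ab_sum pi_gt_zero by linarith+
      ultimately have "\<alpha> = \<beta>" using sin_inj_pi by blast
      then have "\<alpha> = 1 / 6 * pi" using ab_sum by simp
      then show False using irr[of "1 / 6"] by simp
    qed
    have tile: "c + a - b > 0" "c + b - a > 0"
      using strict_triangles[OF nondeg[OF i0]] lens[OF i0] by (simp_all add: norm_minus_commute)
    obtain m where m: "m \<in> \<rat>" "(-1) ^ nB X * norm (Z - Y) + (-1) ^ nB Y * norm (X - Z) + (-1) ^ nB Z * norm (Y - X) = m * (c + a - b)"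
      using signed_perimeter[OF ct(2) ang tile(1)] by blast
    have "sw.nB X + sw.nB Y + sw.nB Z = 3" "cang Y X Z = sw.nA X * \<beta> + sw.nB X * \<alpha>"
      "cang X Y Z = sw.nA Y * \<beta> + sw.nB Y * \<alpha>" "cang X Z Y = sw.nA Z * \<beta> + sw.nB Z * \<alpha>"
      unfolding swn using ct(1) ang by simp_all
    from sw.signed_perimeter[OF this tile(2)] obtain n where
      n: "n \<in> \<rat>" "(-1) ^ nA X * norm (Z - Y) + (-1) ^ nA Y * norm (X - Z) + (-1) ^ nA Z * norm (Y - X) = n * (c + b - a)"
      unfolding swn by blast
    note st = strict_triangles[OF NONDEG]
    have nz: "(-1) ^ p * norm (Z - Y) + (-1) ^ q * norm (X - Z) + (-1) ^ r * norm (Y - X) \<noteq> 0" for p q r :: nat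
      using st by (intro signed_sum_nonzero) auto
    have mn0: "m \<noteq> 0" "n \<noteq> 0" using m(2) n(2) nz by (metis mult_zero_left)+
    obtain l where l: "l > 0" "norm (Z - Y) = l * sin (cang Y X Z)" "norm (X - Z) = l * sin (cang X Y Z)" "norm (Y - X) = l * sin (cang X Z Y)"
      using law_of_sines[OF NONDEG] by blast
    define \<mu> where "\<mu> = l * sin \<alpha> / a"
    have \<mu>: "\<mu> > 0" using l s\<alpha> pos by (simp add: \<mu>_def)
    have side: "norm (Z - Y) = a * (\<mu> * f (nA X) (nB X))" "norm (X - Z) = a * (\<mu> * f (nA Y) (nB Y))" "norm (Y - X) = a * (\<mu> * f (nA Z) (nB Z))"
      unfolding l(2-4) ang using s\<alpha> pos by (simp_all add: \<mu>_def f_def)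
    have aux: "x = r * (c / a + 1 - b / a)" if "a * x = r * (c + a - b)" for x r
    proof -
      have "x = (a * x) / a" using pos by simp
      then show ?thesis unfolding that using pos by (simp add: diff_divide_distrib add_divide_distrib algebra_simps)
    qed
    have aux': "x = r * (c / a + b / a - 1)" if "a * x = r * (c + b - a)" for x r
    proof -
      have "x = (a * x) / a" using pos by simp
      then show ?thesis unfolding that using pos by (simp add: diff_divide_distrib add_divide_distrib algebra_simps)
    qed
    have "a * (\<mu> * ((-1) ^ nB X * f (nA X) (nB X) + (-1) ^ nB Y * f (nA Y) (nB Y) + (-1) ^ nB Z * f (nA Z) (nB Z))) = m * (c + a - b)"
      using m(2) unfolding side by (simp add: algebra_simps)
    then have b1: "\<mu> * ((-1) ^ nB X * f (nA X) (nB X) + (-1) ^ nB Y * f (nA Y) (nB Y) + (-1) ^ nB Z * f (nA Z) (nB Z)) = m * (c / a + 1 - b / a)" by (rule aux)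
    have "a * (\<mu> * ((-1) ^ nA X * f (nA X) (nB X) + (-1) ^ nA Y * f (nA Y) (nB Y) + (-1) ^ nA Z * f (nA Z) (nB Z))) = n * (c + b - a)"
      using n(2) unfolding side by (simp add: algebra_simps)
    then have b2: "\<mu> * ((-1) ^ nA X * f (nA X) (nB X) + (-1) ^ nA Y * f (nA Y) (nB Y) + (-1) ^ nA Z * f (nA Z) (nB Z)) = n * (c / a + b / a - 1)" by (rule aux')
    have "tr.bad (nA X) (nB X) (nA Y) (nB Y) (nA Z) (nB Z)"
      unfolding tr.bad_def using \<mu> m(1) n(1) mn0 b1 b2 by blast
    moreover have "\<not> tr.bad (nA X) (nB X) (nA Y) (nB Y) (nA Z) (nB Z)"
    proof (rule tr.not_bad[OF ba ne1 nr])
      have cpos: "0 < cang Y X Z" "0 < cang X Y Z" "0 < cang X Z Y"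
        using cang_bounds[of X Y Z] cang_bounds[of Y X Z] cang_bounds[of Z X Y] NONDEG cr_swap[of X Y Z] cr_rotate[of X Y Z] by auto
      show g: "nA X + nB X > 0" "nA Y + nB Y > 0" "nA Z + nB Z > 0" using cpos unfolding ang by (auto intro: ccontr)
      show "nA X + nA Y + nA Z = 3" "nB X + nB Y + nB Z = 3" by (rule ct)+
      have other: "p = 1 \<and> q = 0 \<and> p' = 0 \<and> q' = 1 \<or> p = 0 \<and> q = 1 \<and> p' = 1 \<and> q' = 0"
        if "p + p' = 1" "q + q' = 1" "p + q > 0" "p' + q' > 0" for p q p' q' :: nat
        using that by linarith
      \<comment> \<open>The type (2, 2) is the angle 2\<pi>/3 in disguise; the other corners are
        then \<alpha> and \<beta>, against \<open>ns\<close>.\<close>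
      have g2: "2 * \<alpha> + 2 * \<beta> = 2 * pi / 3" using ab_sum by simp
      show "\<not> (2, 2) \<in> {(nA X, nB X), (nA Y, nB Y), (nA Z, nB Z)}"
      proof
        assume "(2, 2) \<in> {(nA X, nB X), (nA Y, nB Y), (nA Z, nB Z)}"
        then consider "nA X = 2" "nB X = 2" | "nA Y = 2" "nB Y = 2" | "nA Z = 2" "nB Z = 2" by auto
        then have "{#cang Y X Z, cang X Y Z, cang X Z Y#} = {#\<alpha>, \<beta>, 2 * pi / 3#}"
        proof cases
          case 1
          then show ?thesis using other[of "nA Y" "nA Z" "nB Y" "nB Z"] ct(1,2) g g2 unfolding ang by (auto simp: add_mset_commute)
        next
          case 2
          then show ?thesis using other[of "nA X" "nA Z" "nB X" "nB Z"] ct(1,2) g g2 unfolding ang by (auto simp: add_mset_commute)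
        next
          case 3
          then show ?thesis using other[of "nA X" "nA Y" "nB X" "nB Y"] ct(1,2) g g2 unfolding ang by (auto simp: add_mset_commute)
        qed
        then show False using ns by blast
      qed
    qed
    ultimately show False by blast
  qed
  with ba show ?thesis by blast
qed

end

section \<open>Transport to the real plane\<close>

lemma inner_sides: "(B - A) \<bullet> (C - A) = ((norm (B - A))\<^sup>2 + (norm (C - A))\<^sup>2 - (norm (C - B))\<^sup>2) / 2"
  for A B C :: complex
  unfolding cmod_power2 by (simp add: inner_complex_def power2_eq_square algebra_simps)

text \<open>Lagrange's identity. The square hides the orientation, so nondegeneracy passes from the
  tile to its copies, reflected or not.\<close>

lemma cr_sq_sides: "(cr A B C)\<^sup>2 = (norm (B - A))\<^sup>2 * (norm (C - A))\<^sup>2 - ((B - A) \<bullet> (C - A))\<^sup>2"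
  unfolding cmod_power2 by (simp add: cr_alt inner_complex_def power2_eq_square algebra_simps)

lemma cang_sides:
  assumes "norm (B - A) = norm (B' - A')" "norm (C - A) = norm (C' - A')" "norm (C - B) = norm (C' - B')"
  shows "cang B A C = cang B' A' C'"
proof -
  have "(B - A) \<bullet> (C - A) = (B' - A') \<bullet> (C' - A')" unfolding inner_sides assms ..
  then show ?thesis unfolding cang_def assms by simp
qed

lemma image_hull_affine:
  fixes L :: "complex \<Rightarrow> complex"
  assumes "linear L"
  shows "(\<lambda>z. t + L z) ` (convex hull S) = convex hull ((\<lambda>z. t + L z) ` S)"
proof -
  have "(\<lambda>z. t + L z) ` (convex hull S) = (\<lambda>z. t + z) ` (L ` (convex hull S))" by (simp add: image_image)
  also have "\<dots> = convex hull ((\<lambda>z. t + z) ` (L ` S))"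
    using convex_hull_linear_image[OF assms] convex_hull_translation by metis
  finally show ?thesis by (simp add: image_image)
qed

text \<open>The law of sines makes the sides proportional. Then the positions \<open>w\<close> and
  \<open>w'\<close> of the third vertex relative to the first edge have equal modulus and real part,
  so they are equal or conjugate: a direct similarity or one with a reflection.\<close>

lemma similar_by_angles:
  assumes nd: "cr P1 P2 P3 \<noteq> 0" "cr Q1 Q2 Q3 \<noteq> 0"
    and ang: "cang P2 P1 P3 = cang Q2 Q1 Q3" "cang P1 P2 P3 = cang Q1 Q2 Q3" "cang P1 P3 P2 = cang Q1 Q3 Q2"
  shows "\<exists>k>0. \<exists>f :: complex \<Rightarrow> complex. (\<forall>x y. dist (f x) (f y) = k * dist x y) \<and>
    f ` (convex hull {P1, P2, P3}) = convex hull {Q1, Q2, Q3}"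
proof -
  have ne: "P1 \<noteq> P2" "Q1 \<noteq> Q2" using nd by auto
  obtain l where l: "l > 0" "norm (P3 - P2) = l * sin (cang P2 P1 P3)" "norm (P1 - P3) = l * sin (cang P1 P2 P3)" "norm (P2 - P1) = l * sin (cang P1 P3 P2)"
    using law_of_sines[OF nd(1)] by blast
  obtain l' where l': "l' > 0" "norm (Q3 - Q2) = l' * sin (cang Q2 Q1 Q3)" "norm (Q1 - Q3) = l' * sin (cang Q1 Q2 Q3)" "norm (Q2 - Q1) = l' * sin (cang Q1 Q3 Q2)"
    using law_of_sines[OF nd(2)] by blast
  define k where "k = l' / l"
  have k: "k > 0" using l l' by (simp add: k_def)
  have s: "norm (Q3 - Q2) = k * norm (P3 - P2)" "norm (Q1 - Q3) = k * norm (P1 - P3)" "norm (Q2 - Q1) = k * norm (P2 - P1)"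
    using l l' ang by (simp_all add: k_def)
  have s': "norm (Q3 - Q1) = k * norm (P3 - P1)" using s(2) by (simp add: norm_minus_commute)
  define w where "w = (P3 - P1) / (P2 - P1)"
  define w' where "w' = (Q3 - Q1) / (Q2 - Q1)"
  have "norm w' = norm w" using s s' k ne by (simp add: w_def w'_def norm_divide)
  moreover have "Re w' = Re w"
  proof -
    have R: "Re ((C - A) / (B - A)) = ((B - A) \<bullet> (C - A)) / (norm (B - A))\<^sup>2" for A B C :: complex
      unfolding cmod_power2 by (simp add: Re_divide inner_complex_def algebra_simps)
    have "(Q2 - Q1) \<bullet> (Q3 - Q1) = k\<^sup>2 * ((P2 - P1) \<bullet> (P3 - P1))"
      unfolding inner_sides s s' by (simp add: power_mult_distrib algebra_simps)
    then show ?thesis unfolding w_def w'_def R s using k by (simp add: power_mult_distrib)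
  qed
  ultimately have "(Im w')\<^sup>2 = (Im w)\<^sup>2" by (metis cmod_power2 add_left_cancel)
  then have "Im w' = Im w \<or> Im w' = - Im w" by (simp add: power2_eq_iff)
  then have "w' = w \<or> w' = cnj w" using \<open>Re w' = Re w\<close> by (auto simp: complex_eq_iff)
  moreover have Q3: "Q3 = Q1 + (Q2 - Q1) * w'" using ne by (simp add: w'_def)
  have P3: "P3 = P1 + (P2 - P1) * w" using ne by (simp add: w_def)
  ultimately show ?thesis
  proof (elim disjE)
    assume w: "w' = w"
    define d where "d = (Q2 - Q1) / (P2 - P1)"
    define f where "f z = (Q1 - d * P1) + d * z" for z
    have nd: "norm d = k" using s(3) ne by (simp add: d_def norm_divide)
    have di: "dist (f x) (f y) = k * dist x y" for x y
    proof -
      have "f x - f y = d * (x - y)" by (simp add: f_def algebra_simps)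
      then show ?thesis by (simp add: dist_norm norm_mult nd)
    qed
    have d2: "d * (P2 - P1) = Q2 - Q1" using ne by (simp add: d_def)
    have f1: "f P1 = Q1" by (simp add: f_def)
    have f2: "f P2 = Q2" using d2 by (simp add: f_def algebra_simps)
    have "f P3 = Q1 + d * (P3 - P1)" by (simp add: f_def algebra_simps)
    also have "P3 - P1 = (P2 - P1) * w" using P3 by simp
    also have "Q1 + d * ((P2 - P1) * w) = Q1 + (d * (P2 - P1)) * w" by simp
    also have "\<dots> = Q3" unfolding d2 using Q3 w by simp
    finally have f3: "f P3 = Q3" .
    have "linear (\<lambda>z. d * z)" by (intro linearI) (simp_all add: algebra_simps)
    then have "f ` (convex hull {P1, P2, P3}) = convex hull (f ` {P1, P2, P3})"
      using image_hull_affine[of "\<lambda>z. d * z" "Q1 - d * P1"] unfolding f_def by blast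
    then show ?thesis using k di f1 f2 f3 by (intro exI[of _ k] conjI exI[of _ f]) auto
  next
    assume w: "w' = cnj w"
    define d where "d = (Q2 - Q1) / cnj (P2 - P1)"
    define f where "f z = (Q1 - d * cnj P1) + d * cnj z" for z
    have nd: "norm d = k" using s(3) ne unfolding d_def norm_divide complex_mod_cnj by simp
    have di: "dist (f x) (f y) = k * dist x y" for x y
    proof -
      have "f x - f y = d * cnj (x - y)" by (simp add: f_def algebra_simps)
      then have "norm (f x - f y) = norm d * norm (cnj (x - y))" by (simp only: norm_mult)
      then show ?thesis unfolding dist_norm complex_mod_cnj nd .
    qed
    have d2: "d * cnj (P2 - P1) = Q2 - Q1" using ne unfolding d_def by (metis complex_cnj_zero_iff eq_iff_diff_eq_0 nonzero_eq_divide_eq)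
    have f1: "f P1 = Q1" by (simp add: f_def)
    have f2: "f P2 = Q2" using d2 by (simp add: f_def algebra_simps)
    have "f P3 = Q1 + d * cnj (P3 - P1)" by (simp add: f_def algebra_simps)
    also have "P3 - P1 = (P2 - P1) * w" using P3 by simp
    also have "Q1 + d * cnj ((P2 - P1) * w) = Q1 + (d * cnj (P2 - P1)) * cnj w" by simp
    also have "\<dots> = Q3" unfolding d2 using Q3 w by simp
    finally have f3: "f P3 = Q3" .
    have "linear (\<lambda>z. d * cnj z)" by (intro linearI) (simp_all add: algebra_simps scaleR_conv_of_real)
    then have "f ` (convex hull {P1, P2, P3}) = convex hull (f ` {P1, P2, P3})"
      using image_hull_affine[of "\<lambda>z. d * cnj z" "Q1 - d * cnj P1"] unfolding f_def by blast
    then show ?thesis using k di f1 f2 f3 by (intro exI[of _ k] conjI exI[of _ f]) auto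
  qed
qed

section \<open>From the real plane to the complex numbers\<close>

definition to_complex :: "real^2 \<Rightarrow> complex" where
  "to_complex x = Complex (x $ 1) (x $ 2)"

definition of_complex :: "complex \<Rightarrow> real^2" where
  "of_complex z = vector [Re z, Im z]"

lemma of_to [simp]: "of_complex (to_complex x) = x"
  by (simp add: of_complex_def to_complex_def vec_eq_iff forall_2)

lemma to_of [simp]: "to_complex (of_complex z) = z"
  by (simp add: of_complex_def to_complex_def)

lemma linear_to_complex: "linear to_complex"
  by (intro linearI) (simp_all add: to_complex_def complex_eq_iff)

lemma linear_of_complex: "linear of_complex"
  by (intro linearI) (simp_all add: of_complex_def vec_eq_iff forall_2)

lemma to_complex_diff: "to_complex x - to_complex y = to_complex (x - y)"
  by (simp add: linear_diff[OF linear_to_complex])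

lemma inner_to_complex: "to_complex x \<bullet> to_complex y = x \<bullet> y"
  by (simp add: to_complex_def inner_complex_def inner_vec_def sum_2)

lemma norm_to_complex: "norm (to_complex x) = norm x"
  by (simp add: norm_eq_sqrt_inner inner_to_complex)

lemma dist_to_complex: "dist (to_complex x) (to_complex y) = dist x y"
  by (simp add: dist_norm to_complex_diff norm_to_complex)

lemma dist_of_complex: "dist (of_complex x) (of_complex y) = dist x y"
  using dist_to_complex[of "of_complex x" "of_complex y"] by simp

lemma cang_to_complex: "cang (to_complex x) (to_complex y) (to_complex z) = angle x y z"
  by (simp add: cang_def angle_def to_complex_diff inner_to_complex norm_to_complex)

lemma to_complex_hull: "to_complex ` (convex hull S) = convex hull (to_complex ` S)"
  by (rule convex_hull_linear_image[OF linear_to_complex])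

lemma triangle_nondegenerate:
  assumes "is_triangle x y z"
  shows "cr (to_complex x) (to_complex y) (to_complex z) \<noteq> 0"
proof
  assume 0: "cr (to_complex x) (to_complex y) (to_complex z) = 0"
  have "collinear {x, y, z}"
  proof (cases "x = y")
    case True
    then show ?thesis by (simp add: insert_absorb)
  next
    case False
    define p q r where "p = to_complex x" and "q = to_complex y" and "r = to_complex z"
    have pq: "p \<noteq> q" using False of_to unfolding p_def q_def by metis
    have "Im ((r - p) / (q - p)) = 0" using 0 by (simp add: Im_div_cr p_def q_def r_def)
    then have "(r - p) / (q - p) = of_real (Re ((r - p) / (q - p)))" by (simp add: complex_eq_iff)
    then have "r = p + of_real (Re ((r - p) / (q - p))) * (q - p)" using pq by (simp add: field_simps)
    then obtain t where t: "r = p + t *\<^sub>R (q - p)" by (metis scaleR_conv_of_real)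
    have "z = of_complex r" by (simp add: r_def)
    also have "\<dots> = of_complex p + t *\<^sub>R (of_complex q - of_complex p)"
      unfolding t by (simp add: linear_add[OF linear_of_complex] linear_cmul[OF linear_of_complex] linear_diff[OF linear_of_complex])
    finally have "z = (1 - t) *\<^sub>R x + (1 - (1 - t)) *\<^sub>R y" by (simp add: p_def q_def algebra_simps)
    then have "collinear {x, z, y}" unfolding collinear_3_expand by blast
    then show ?thesis by (simp add: insert_commute)
  qed
  then show False using assms by (simp add: is_triangle_def)
qed

text \<open>A distance-preserving map of the plane is an orthogonal map followed by a
  translation.\<close>

lemma isometry_affine:
  fixes f :: "real^2 \<Rightarrow> real^2"
  assumes "\<forall>x y. dist (f x) (f y) = dist x y"
  shows "surj f" "f ` (convex hull S) = convex hull (f ` S)"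
proof -
  define g where "g x = f x - f 0" for x
  have "orthogonal_transformation g"
    unfolding orthogonal_transformation_isometry g_def using assms by (simp add: dist_norm)
  then have lin: "linear g" and sg: "surj g"
    using orthogonal_transformation_surj orthogonal_transformation_linear by blast+
  have fg: "f = (\<lambda>x. f 0 + g x)" by (simp add: g_def)
  show "surj f"
  proof (rule surjI)
    show "f (inv g (y - f 0)) = y" for y using surj_f_inv_f[OF sg, of "y - f 0"] by (simp add: g_def)
  qed
  have "f ` (convex hull S) = (\<lambda>z. f 0 + z) ` (g ` (convex hull S))" by (subst fg) (simp add: image_image)
  also have "\<dots> = convex hull ((\<lambda>z. f 0 + z) ` (g ` S))"
    using convex_hull_linear_image[OF lin] convex_hull_translation by metis
  also have "(\<lambda>z. f 0 + z) ` (g ` S) = f ` S" by (subst (2) fg) (simp add: image_image)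
  finally show "f ` (convex hull S) = convex hull (f ` S)" .
qed

text \<open>An infinite bounded set has a limit point, near which two distinct points come closer
  than \<open>r\<close>.\<close>

lemma separated_bounded_finite:
  fixes S :: "(real^2) set"
  assumes "bounded S" "r > 0" "\<And>x y. x \<in> S \<Longrightarrow> y \<in> S \<Longrightarrow> x \<noteq> y \<Longrightarrow> dist x y \<ge> r"
  shows "finite S"
proof (rule ccontr)
  assume "infinite S"
  then obtain l where l: "l islimpt S" using assms(1) bounded_infinite_imp_islimpt by blast
  obtain x where x: "x \<in> S" "x \<noteq> l" "dist x l < r / 2" using l assms(2) unfolding islimpt_approachable by (metis half_gt_zero)
  obtain y where y: "y \<in> S" "y \<noteq> l" "dist y l < min (r / 2) (dist x l)"
    using l assms(2) x unfolding islimpt_approachable by (metis half_gt_zero min_less_iff_conj zero_less_dist_iff)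
  have "x \<noteq> y" using y by auto
  moreover have "dist x y < r" using dist_triangle_half_l[of x l r y] x y by simp
  ultimately show False using assms(3) x y by fastforce
qed

text \<open>Copies of one ball inside the tile have centres at distance at least \<open>r\<close>: a
  centre in the ball of another tile would be interior to both tiles. And all centres stay in the
  big triangle.\<close>

lemma tiling_finite:
  fixes U V W A B C :: "real^2"
  assumes nd: "is_triangle U V W" and til: "is_tiling T (triangle_region A B C) (triangle_region U V W)"
  shows "finite T"
proof -
  define R where "R = triangle_region U V W"
  obtain x0 r where r: "r > 0" "ball x0 r \<subseteq> R"
  proof -
    have ai: "\<not> affine_dependent {U, V, W}" using nd unfolding is_triangle_def by (simp add: collinear_3_eq_affine_dependent)
    have dn: "U \<noteq> V" "U \<noteq> W" "V \<noteq> W" using nd unfolding is_triangle_def by (auto simp: insert_commute)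
    then have "interior (convex hull {U, V, W}) \<noteq> {}"
      using interior_convex_hull_eq_empty[of "{U, V, W}"] ai by simp
    then obtain x0 where "x0 \<in> interior R" unfolding R_def triangle_region_def by blast
    then show thesis using that unfolding mem_interior by blast
  qed
  have "\<forall>S\<in>T. \<exists>f. (\<forall>x y. dist (f x) (f y) = dist x y) \<and> f ` R = S"
    using til unfolding is_tiling_def congruent_sets_def R_def by blast
  then obtain F where F: "\<And>S x y. S \<in> T \<Longrightarrow> dist (F S x) (F S y) = dist x y" "\<And>S. S \<in> T \<Longrightarrow> F S ` R = S"
    by metis
  have bl: "ball (F S x0) r \<subseteq> S" if S: "S \<in> T" for S
  proof
    fix y assume y: "y \<in> ball (F S x0) r"
    obtain x where x: "y = F S x" using isometry_affine(1)[of "F S"] F(1)[OF S] by (metis surjD)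
    then have "x \<in> ball x0 r" using y F(1)[OF S, of x0 x] by simp
    then show "y \<in> S" using r(2) F(2)[OF S] x by blast
  qed
  have sep: "dist (F S x0) (F S' x0) \<ge> r" if SS: "S \<in> T" "S' \<in> T" "S \<noteq> S'" for S S'
  proof (rule ccontr)
    assume "\<not> dist (F S x0) (F S' x0) \<ge> r"
    then have 1: "F S' x0 \<in> ball (F S x0) r" by simp
    have "F S' x0 \<in> interior S" using 1 bl[OF SS(1)] interior_maximal[OF _ open_ball] by blast
    moreover have "F S' x0 \<in> interior S'" using bl[OF SS(2)] interior_maximal[OF _ open_ball] r(1) by (meson centre_in_ball subsetD)
    ultimately show False using til SS unfolding is_tiling_def pairwise_def by blast
  qed
  have inj: "inj_on (\<lambda>S. F S x0) T" using sep r(1) by (intro inj_onI) (metis dist_self not_less)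
  have "finite ((\<lambda>S. F S x0) ` T)"
  proof (rule separated_bounded_finite[OF _ r(1)])
    have "(\<lambda>S. F S x0) ` T \<subseteq> triangle_region A B C"
    proof
      fix y assume "y \<in> (\<lambda>S. F S x0) ` T"
      then obtain S where "S \<in> T" "y = F S x0" by blast
      then have "y \<in> S" using bl[of S] r(1) by (metis centre_in_ball subsetD)
      then show "y \<in> triangle_region A B C" using til \<open>S \<in> T\<close> unfolding is_tiling_def by blast
    qed
    moreover have "bounded (triangle_region A B C)"
      unfolding triangle_region_def by (intro bounded_convex_hull finite_imp_bounded) simp
    ultimately show "bounded ((\<lambda>S. F S x0) ` T)" using bounded_subset by blast
  qed (use sep in auto)
  then show ?thesis using inj finite_imageD by blast
qed

section \<open>Similarity from equal angles\<close>

lemma mset3_cases: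
  assumes "{#x, y, z#} = {#p, q, r#}"
  shows "x = p \<and> y = q \<and> z = r \<or> x = p \<and> y = r \<and> z = q \<or> x = q \<and> y = p \<and> z = r \<or>
    x = q \<and> y = r \<and> z = p \<or> x = r \<and> y = p \<and> z = q \<or> x = r \<and> y = q \<and> z = p"
  using assms by (auto simp: add_eq_conv_ex add_mset_eq_singleton_iff)

lemma similar_transport:
  assumes "is_triangle A B C" "is_triangle U V W"
    and "angle B A C = angle V U W" "angle A B C = angle U V W" "angle A C B = angle U W V"
  shows "similar (triangle_region A B C) (triangle_region U V W)"
proof -
  obtain k f where kf: "k > 0" "\<forall>x y. dist (f x) (f y) = k * dist x y"
    "f ` (convex hull {to_complex A, to_complex B, to_complex C}) = convex hull {to_complex U, to_complex V, to_complex W}"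
    using similar_by_angles[OF triangle_nondegenerate[OF assms(1)] triangle_nondegenerate[OF assms(2)]] assms(3-5)
    unfolding cang_to_complex by blast
  define f' where "f' x = of_complex (f (to_complex x))" for x
  have "dist (f' x) (f' y) = k * dist x y" for x y
    using kf(2) by (simp add: f'_def dist_of_complex dist_to_complex)
  moreover have "f' ` triangle_region A B C = triangle_region U V W"
  proof -
    have "f' ` triangle_region A B C = of_complex ` (f ` (to_complex ` (convex hull {A, B, C})))"
      by (simp add: f'_def image_image triangle_region_def)
    also have "to_complex ` (convex hull {A, B, C}) = convex hull {to_complex A, to_complex B, to_complex C}"
      by (simp add: to_complex_hull)
    also have "f ` \<dots> = to_complex ` (convex hull {U, V, W})" using kf(3) by (simp add: to_complex_hull)
    also have "of_complex ` \<dots> = triangle_region U V W" by (simp add: image_image triangle_region_def)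
    finally show ?thesis .
  qed
  ultimately show ?thesis unfolding similar_def using kf(1) by blast
qed

lemma angle_commute: "angle x y z = angle z y x"
  by (simp add: angle_def inner_commute mult.commute)

lemma similar_of_angle_mset:
  assumes t: "is_triangle A B C" "is_triangle U V W"
    and m: "{#angle B A C, angle A B C, angle A C B#} = {#angle V U W, angle U V W, angle U W V#}"
  shows "similar (triangle_region A B C) (triangle_region U V W)"
proof -
  have t': "is_triangle A C B" "is_triangle B A C" "is_triangle B C A" "is_triangle C A B" "is_triangle C B A"
    using t(1) by (simp_all add: is_triangle_def insert_commute)
  have r: "triangle_region A C B = triangle_region A B C" "triangle_region B A C = triangle_region A B C"
    "triangle_region B C A = triangle_region A B C" "triangle_region C A B = triangle_region A B C"
    "triangle_region C B A = triangle_region A B C"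
    by (simp_all add: triangle_region_def insert_commute)
  note s = similar_transport[OF t] similar_transport[OF t'(1) t(2), unfolded r] similar_transport[OF t'(2) t(2), unfolded r]
    similar_transport[OF t'(3) t(2), unfolded r] similar_transport[OF t'(4) t(2), unfolded r] similar_transport[OF t'(5) t(2), unfolded r]
  note c = angle_commute[of B A C] angle_commute[of A B C] angle_commute[of A C B]
  from mset3_cases[OF m] show ?thesis
    using s c by (elim disjE conjE) presburger+
qed

theorem theorem1p1:
  fixes U V W A B C :: "real^2" and a b c \<alpha> \<beta> \<gamma> :: real
  assumes "is_triangle U V W"
    and "a = dist V W" and "b = dist U W" and "c = dist U V"
    and "\<alpha> = angle V U W" and "\<beta> = angle U V W" and "\<gamma> = angle U W V"
    and "\<gamma> = 2 * pi / 3"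
    and "\<not> commensurable_angles U V W"
    and "is_triangle A B C"
    and "tiled_by (triangle_region A B C) (triangle_region U V W)"
    and "\<not> similar (triangle_region A B C) (triangle_region U V W)"
  shows "commensurable_sides U V W"
proof -
  obtain T where til: "is_tiling T (triangle_region A B C) (triangle_region U V W)"
    using assms(11) unfolding tiled_by_def by blast
  define R where "R = triangle_region U V W"
  have "\<forall>S\<in>T. \<exists>f. (\<forall>x y. dist (f x) (f y) = dist x y) \<and> f ` R = S"
    using til unfolding is_tiling_def congruent_sets_def R_def by blast
  then obtain F where F: "\<And>S x y. S \<in> T \<Longrightarrow> dist (F S x) (F S y) = dist x y" "\<And>S. S \<in> T \<Longrightarrow> F S ` R = S"
    by metis
  define tA where "tA S = to_complex (F S U)" for S
  define tB where "tB S = to_complex (F S V)" for S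
  define tC where "tC S = to_complex (F S W)" for S
  define u v w where "u = to_complex U" and "v = to_complex V" and "w = to_complex W"
  have nd0: "cr u v w \<noteq> 0" using triangle_nondegenerate[OF assms(1)] by (simp add: u_def v_def w_def)
  have nl: "norm (to_complex x - to_complex y) = dist x y" for x y by (simp add: dist_to_complex dist_norm[symmetric])
  have sides: "norm (tB S - tA S) = norm (v - u)" "norm (tC S - tA S) = norm (w - u)" "norm (tC S - tB S) = norm (w - v)"
    if "S \<in> T" for S
    using F(1)[OF that] by (simp_all add: tA_def tB_def tC_def u_def v_def w_def nl)
  have nd: "cr (tA S) (tB S) (tC S) \<noteq> 0" if "S \<in> T" for S
  proof -
    have "(cr (tA S) (tB S) (tC S))\<^sup>2 = (cr u v w)\<^sup>2" unfolding cr_sq_sides inner_sides sides[OF that] ..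
    then show ?thesis using nd0 by auto
  qed
  have reg: "to_complex ` S = tri (tA S) (tB S) (tC S)" if S: "S \<in> T" for S
  proof -
    have "S = convex hull (F S ` {U, V, W})"
      using F(2)[OF S] isometry_affine(2)[of "F S"] F(1)[OF S] unfolding R_def triangle_region_def by metis
    then have "to_complex ` S = convex hull {tA S, tB S, tC S}"
      using to_complex_hull[of "F S ` {U, V, W}"] by (simp add: tA_def tB_def tC_def)
    then show ?thesis using tri_hull[OF nd[OF S]] by simp
  qed
  have REG: "to_complex ` triangle_region A B C = tri (to_complex A) (to_complex B) (to_complex C)"
    using tri_hull[OF triangle_nondegenerate[OF assms(10)]] by (simp add: triangle_region_def to_complex_hull)
  have cont: "continuous_on UNIV to_complex" using linear_to_complex by (simp add: linear_continuous_on linear_conv_bounded_linear)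
  have int: "x \<in> interior S" if "S \<in> T" "to_complex x \<in> itri (tA S) (tB S) (tC S)" for S x
  proof -
    have "to_complex -` itri (tA S) (tB S) (tC S) \<subseteq> S"
    proof
      fix y assume "y \<in> to_complex -` itri (tA S) (tB S) (tC S)"
      then have "to_complex y \<in> to_complex ` S" using reg[OF that(1)] subsetD[OF itri_subset] by auto
      then show "y \<in> S" using of_to by (metis imageE)
    qed
    moreover have "open (to_complex -` itri (tA S) (tB S) (tC S))" using open_vimage[OF open_itri cont] .
    ultimately show ?thesis using that(2) by (meson interiorI vimageI)
  qed
  have ang: "cang v u w = \<alpha>" "cang u v w = \<beta>" "cang u w v = 2 * pi / 3"
    using assms(5-8) by (simp_all add: u_def v_def w_def cang_to_complex)
  have pos: "0 < \<alpha>" "0 < \<beta>"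
    using cang_bounds[OF nd0] cang_bounds[of v u w] nd0 cr_swap(1)[of u v w] ang by auto
  have sum: "\<alpha> + \<beta> = pi / 3" using triangle_angle_sum[OF nd0] ang by simp
  \<comment> \<open>A rational multiple of \<pi> for \<alpha> gives one for \<beta> = \<pi>/3 -
    \<alpha>, and the third angle is 2\<pi>/3.\<close>
  have irr: "\<alpha> \<noteq> q * pi" if "q \<in> \<rat>" for q
  proof
    assume q: "\<alpha> = q * pi"
    then have "\<beta> = (1 / 3 - q) * pi" using sum by (simp add: algebra_simps)
    moreover have "angle U W V = 2 / 3 * pi" using assms(7,8) by simp
    moreover have "1 / 3 - q \<in> \<rat>" "(2 / 3 :: real) \<in> \<rat>" using that by simp_all
    ultimately have "commensurable_angles U V W"
      unfolding commensurable_angles_def assms(5,6)[symmetric] using q that by (metis insert_iff singletonD)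
    then show False using assms(9) by blast
  qed
  interpret tile_tiling T tA tB tC "to_complex A" "to_complex B" "to_complex C" a b c \<alpha> \<beta>
  proof
    show "finite T" using tiling_finite[OF assms(1) til] .
    show "cr (to_complex A) (to_complex B) (to_complex C) \<noteq> 0" using triangle_nondegenerate[OF assms(10)] .
    show "itri (tA S) (tB S) (tC S) \<inter> itri (tA S') (tB S') (tC S') = {}" if SS: "S \<in> T" "S' \<in> T" "S \<noteq> S'" for S S'
    proof (rule equals0I)
      fix z assume z: "z \<in> itri (tA S) (tB S) (tC S) \<inter> itri (tA S') (tB S') (tC S')"
      then have "of_complex z \<in> interior S \<inter> interior S'" using int[OF SS(1), of "of_complex z"] int[OF SS(2), of "of_complex z"] by simp
      then show False using til SS unfolding is_tiling_def pairwise_def by blast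
    qed
    have "(\<Union>S\<in>T. to_complex ` S) = to_complex ` triangle_region A B C"
      using til unfolding is_tiling_def by blast
    then show "(\<Union>S\<in>T. tri (tA S) (tB S) (tC S)) = tri (to_complex A) (to_complex B) (to_complex C)"
      unfolding REG using reg by simp
    show "norm (tC S - tB S) = a" "norm (tC S - tA S) = b" "norm (tB S - tA S) = c" if "S \<in> T" for S
      unfolding sides[OF that] using assms(2-4) by (simp_all add: u_def v_def w_def nl dist_commute)
    show "cang (tB S) (tA S) (tC S) = \<alpha>" "cang (tA S) (tB S) (tC S) = \<beta>" "cang (tA S) (tC S) (tB S) = 2 * pi / 3" if "S \<in> T" for S
      unfolding ang[symmetric] using sides[OF that] by (intro cang_sides; simp add: norm_minus_commute)+
  qed (use nd pos sum irr in auto)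
  have "\<not> {#cang (to_complex B) (to_complex A) (to_complex C), cang (to_complex A) (to_complex B) (to_complex C),
      cang (to_complex A) (to_complex C) (to_complex B)#} = {#\<alpha>, \<beta>, 2 * pi / 3#}"
    unfolding cang_to_complex using similar_of_angle_mset[OF assms(10,1)] assms(5-8,12) by metis
  from commensurable[OF this] have r: "b / a \<in> \<rat>" "c / a \<in> \<rat>" by blast+
  have "a > 0" using assms(1,2) by (auto simp: is_triangle_def)
  have r': "s / a \<in> \<rat>" if "s \<in> {a, b, c}" for s using that r \<open>a > 0\<close> by auto
  have "s / t \<in> \<rat>" if "s \<in> {a, b, c}" "t \<in> {a, b, c}" for s t
  proof -
    have "s / t = (s / a) / (t / a)" using \<open>a > 0\<close> by simp
    then show ?thesis using r'[OF that(1)] r'[OF that(2)] by (simp only: Rats_divide)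
  qed
  then show ?thesis unfolding commensurable_sides_def assms(2-4) by blast
qed

end
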